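(* Let $N\ge 3$, $0<s<1<p<N$ and $\theta\in[s,1]$. Let $\Omega$ be an open bounded subset of $\mathbb{R}^{N}$ with $0\in\Omega$. Let $\{u_k\}$ be a sequence in $X(\Omega)$ such that $u_k\rightharpoonup u$ weakly for some $u\in X(\Omega)$. Then there exist two finite measures $\omega$ and $\sigma$ in $\mathbb{R}^N$ such that $$|\nabla u_k(x)|^p\,dx+\left(\int_{\mathbb{R}^N}\frac{|u_k(x)-u_k(y)|^p}{|x-y|^{N+ps}}\,dy\right)dx\ \stackrel{*}{\rightharpoonup}\ \omega\quad\text{and}\quad \frac{|u_k(x)|^p}{|x|^{p\theta}}\,dx\ \stackrel{*}{\rightharpoonup}\ \sigma\quad\text{in }\mathcal{M}(\mathbb{R}^N).$$ Furthermore, there exist two nonnegative numbers $\omega_0,\sigma_0$ such that $$\sigma=\frac{|u(x)|^p}{|x|^{p\theta}}\,dx+\sigma_0\delta_0$$ and $$\omega\ \ge\ |\nabla u(x)|^p\,dx+\left(\int_{\mathbb{R}^N}\frac{|u(x)-u(y)|^p}{|x-y|^{N+ps}}\,dy\right)dx+\omega_0\delta_0,\qquad 0\le\bar\mu(\theta)\,\sigma_0\le\omega_0 ,$$ where $\bar\mu(\theta)$ is the Hardy constant defined in the context.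
   Context: The space $X(\Omega)$ is the completion of $C_0^\infty(\Omega)$ with respect to the norm $\|u\|_X=\left(\|\nabla u\|_{p}^p+[u]_{s,p}^p\right)^{1/p}$, where $\|\cdot\|_p$ is the $L^p$ norm and $[u]_{s,p}^p=\iint_{\mathbb{R}^{2N}}\frac{|u(x)-u(y)|^p}{|x-y|^{N+ps}}\,dx\,dy$; functions in $X(\Omega)$ are regarded as functions on $\mathbb{R}^N$ vanishing a.e. in $\mathbb{R}^N\setminus\Omega$. Here $\mathcal{M}(\mathbb{R}^N)$ is the space of finite Radon measures on $\mathbb{R}^N$, $\stackrel{*}{\rightharpoonup}$ denotes weak-* convergence of measures, and $\delta_0$ is the Dirac mass at the origin. The constant $\bar\mu(\theta)$ is $$\bar\mu(\theta):=\begin{cases}C_{N,p,s}&\text{if }\theta=s,\\ \min\left\{\frac{C_H(1-s)}{\theta-s},\frac{C_{N,p,s}(1-s)}{1-\theta}\right\}&\text{if }\theta\in(s,1),\\ C_H&\text{if }\theta=1,\end{cases}$$ where $C_H=\left(\frac{N-p}{p}\right)^p$ is the best constant in the Hardy inequality $C_H\int_\Omega\frac{|u|^p}{|x|^p}dx\le\int_\Omega|\nabla u|^p dx$, $u\in W_0^{1,p}(\Omega)$, and $C_{N,p,s}$ is the best constant in the fractional Hardy inequality $C_{N,p,s}\int_{\mathbb{R}^N}\frac{|u|^p}{|x|^{ps}}dx\le\iint_{\mathbb{R}^{2N}}\frac{|u(x)-u(y)|^p}{|x-y|^{N+sp}}\,dx\,dy$, $u\in W^{s,p}(\mathbb{R}^N)$.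 Explicitly, $C_{N,p,s}=2\int_0^1 t^{ps-1}\left|1-t^{(N-ps)/p}\right|^p\Phi_{N,s,p}(t)\,dt$ with $\Phi_{N,s,p}(t)=|\mathbb{S}^{N-2}|\int_{-1}^1\frac{(1-r^2)^{(N-3)/2}\,dr}{(1-2rt+t^2)^{(N+ps)/2}}$ for $N\ge2$, where $|\mathbb{S}^{N-2}|$ is the surface measure of the unit sphere in $\mathbb{R}^{N-1}$.
   Formalization: The weak-* convergence of both sequences of measures is asserted only along a common subsequence of u_k; for the whole sequence the claim is false (interlace zero functions with a sequence concentrating at the origin). *)

theory Defs
  imports "HOL-Analysis.Analysis" "HOL-Probability.Giry_Monad"
begin

text \<open>
  Elements of function spaces are represented by Borel functions on all of \<open>\<real>\<^sup>N\<close>; two of them are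
  the same element iff they agree almost everywhere.  \<open>N\<close> is \<open>DIM('a)\<close>.
\<close>

fun Ck :: "nat \<Rightarrow> ('a::euclidean_space \<Rightarrow> real) \<Rightarrow> bool" where
  "Ck 0 f \<longleftrightarrow> continuous_on UNIV f"
| "Ck (Suc k) f \<longleftrightarrow> (\<forall>x. f differentiable (at x)) \<and>
     (\<forall>i\<in>Basis. Ck k (\<lambda>x. frechet_derivative f (at x) i))"

definition test_functions :: "'a::euclidean_space set \<Rightarrow> ('a \<Rightarrow> real) set" where
  "test_functions \<Omega> =
     {\<phi>. (\<forall>k. Ck k \<phi>) \<and> compact (closure {x. \<phi> x \<noteq> 0}) \<and> closure {x. \<phi> x \<noteq> 0} \<subseteq> \<Omega>}"

definition locally_integrable :: "('a::euclidean_space \<Rightarrow> 'b::euclidean_space) \<Rightarrow> bool" where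
  "locally_integrable f \<longleftrightarrow>
     f \<in> borel_measurable borel \<and> (\<forall>K. compact K \<longrightarrow> set_integrable lborel K f)"

definition is_weak_gradient :: "('a::euclidean_space \<Rightarrow> real) \<Rightarrow> ('a \<Rightarrow> 'a) \<Rightarrow> bool" where
  "is_weak_gradient u g \<longleftrightarrow> locally_integrable u \<and> locally_integrable g \<and>
     (\<forall>\<phi>\<in>test_functions UNIV. \<forall>i\<in>Basis.
        (\<integral>x. u x * frechet_derivative \<phi> (at x) i \<partial>lborel) = - (\<integral>x. (g x \<bullet> i) * \<phi> x \<partial>lborel))"

text \<open>The weak gradient is unique up to null sets, so the choice below is harmless.\<close>

definition weak_grad :: "('a::euclidean_space \<Rightarrow> real) \<Rightarrow> 'a \<Rightarrow> 'a" where
  "weak_grad u = (SOME g. is_weak_gradient u g)"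

definition frac_density :: "real \<Rightarrow> real \<Rightarrow> ('a::euclidean_space \<Rightarrow> real) \<Rightarrow> 'a \<Rightarrow> ennreal" where
  "frac_density p s u x =
     (\<integral>\<^sup>+y. ennreal (\<bar>u x - u y\<bar> powr p / norm (x - y) powr (real DIM('a) + p * s)) \<partial>lborel)"

definition gagliardo :: "real \<Rightarrow> real \<Rightarrow> ('a::euclidean_space \<Rightarrow> real) \<Rightarrow> ennreal" where
  "gagliardo p s u = (\<integral>\<^sup>+x. frac_density p s u x \<partial>lborel)"

text \<open>\<open>X_energy\<close> is the \<open>p\<close>-th power of the norm of \<open>X(\<Omega>)\<close>, with values in \<open>[0,\<infinity>]\<close>.\<close>

definition X_energy :: "real \<Rightarrow> real \<Rightarrow> ('a::euclidean_space \<Rightarrow> real) \<Rightarrow> ennreal" where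
  "X_energy p s u = (\<integral>\<^sup>+x. ennreal (norm (weak_grad u x) powr p) \<partial>lborel) + gagliardo p s u"

definition X_norm :: "real \<Rightarrow> real \<Rightarrow> ('a::euclidean_space \<Rightarrow> real) \<Rightarrow> real" where
  "X_norm p s u = enn2real (X_energy p s u) powr (1 / p)"

text \<open>
  For bounded \<open>\<Omega>\<close> the Poincare inequality turns a Cauchy sequence of test functions for the norm
  into one that converges in \<open>W\<^sup>1\<^sup>,\<^sup>p\<close>.  The completion is therefore the set of weakly
  differentiable functions of finite norm that vanish almost everywhere outside \<open>\<Omega>\<close> and are limits
  of test functions in the norm.
\<close>

definition X_space :: "real \<Rightarrow> real \<Rightarrow> 'a::euclidean_space set \<Rightarrow> ('a \<Rightarrow> real) set" where
  "X_space p s \<Omega> =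
     {u. u \<in> borel_measurable borel \<and> (\<exists>g. is_weak_gradient u g) \<and>
         (AE x in lborel. x \<notin> \<Omega> \<longrightarrow> u x = 0) \<and> X_energy p s u < \<infinity> \<and>
         (\<exists>\<phi>. (\<forall>n. \<phi> n \<in> test_functions \<Omega>) \<and>
              (\<lambda>n. X_energy p s (\<lambda>x. \<phi> n x - u x)) \<longlonglongrightarrow> 0)}"

text \<open>
  Bounded linear functionals on \<open>X(\<Omega>)\<close>.  By linearity and boundedness they do not distinguish
  functions that agree almost everywhere.
\<close>

definition X_dual :: "real \<Rightarrow> real \<Rightarrow> 'a::euclidean_space set \<Rightarrow> (('a \<Rightarrow> real) \<Rightarrow> real) set" where
  "X_dual p s \<Omega> =
     {F. (\<forall>v\<in>X_space p s \<Omega>. \<forall>w\<in>X_space p s \<Omega>. F (\<lambda>x. v x + w x) = F v + F w) \<and>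
         (\<forall>c. \<forall>v\<in>X_space p s \<Omega>. F (\<lambda>x. c * v x) = c * F v) \<and>
         (\<exists>C. \<forall>v\<in>X_space p s \<Omega>. \<bar>F v\<bar> \<le> C * X_norm p s v)}"

definition X_weakly_converges ::
    "real \<Rightarrow> real \<Rightarrow> 'a::euclidean_space set \<Rightarrow> (nat \<Rightarrow> 'a \<Rightarrow> real) \<Rightarrow> ('a \<Rightarrow> real) \<Rightarrow> bool" where
  "X_weakly_converges p s \<Omega> u v \<longleftrightarrow> (\<forall>F\<in>X_dual p s \<Omega>. (\<lambda>k. F (u k)) \<longlonglongrightarrow> F v)"

definition finite_radon :: "'a::euclidean_space measure \<Rightarrow> bool" where
  "finite_radon \<mu> \<longleftrightarrow> sets \<mu> = sets borel \<and> finite_measure \<mu>"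

text \<open>
  Weak-* convergence in \<open>\<M>(\<real>\<^sup>N)\<close>, the dual of the space of continuous functions vanishing at
  infinity.
\<close>

definition weak_star_converges ::
    "(nat \<Rightarrow> 'a::euclidean_space measure) \<Rightarrow> 'a measure \<Rightarrow> bool" where
  "weak_star_converges \<mu> \<nu> \<longleftrightarrow>
     (\<forall>f :: 'a \<Rightarrow> real. continuous_on UNIV f \<and> (f \<longlongrightarrow> 0) at_infinity \<longrightarrow>
        (\<lambda>k. \<integral>x. f x \<partial>\<mu> k) \<longlonglongrightarrow> (\<integral>x. f x \<partial>\<nu>))"

definition energy_measure :: "real \<Rightarrow> real \<Rightarrow> ('a::euclidean_space \<Rightarrow> real) \<Rightarrow> 'a measure" where
  "energy_measure p s u =
     density lborel (\<lambda>x. ennreal (norm (weak_grad u x) powr p) + frac_density p s u x)"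

definition hardy_measure :: "real \<Rightarrow> real \<Rightarrow> ('a::euclidean_space \<Rightarrow> real) \<Rightarrow> 'a measure" where
  "hardy_measure p \<theta> u = density lborel (\<lambda>x. ennreal (\<bar>u x\<bar> powr p / norm x powr (p * \<theta>)))"

abbreviation dirac0 :: "'a::euclidean_space measure" where
  "dirac0 \<equiv> return borel 0"

definition Wsp :: "real \<Rightarrow> real \<Rightarrow> ('a::euclidean_space \<Rightarrow> real) set" where
  "Wsp s p = {u. u \<in> borel_measurable borel \<and>
     (\<integral>\<^sup>+x. ennreal (\<bar>u x\<bar> powr p) \<partial>lborel) < \<infinity> \<and> gagliardo p s u < \<infinity>}"

definition C_H :: "'a::euclidean_space itself \<Rightarrow> real \<Rightarrow> real" where
  "C_H T p = ((real DIM('a) - p) / p) powr p"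

text \<open>The best constant in the fractional Hardy inequality on \<open>W\<^sup>s\<^sup>,\<^sup>p(\<real>\<^sup>N)\<close>.\<close>

definition C_frac :: "'a::euclidean_space itself \<Rightarrow> real \<Rightarrow> real \<Rightarrow> real" where
  "C_frac T p s = Sup {C. 0 \<le> C \<and> (\<forall>u\<in>(Wsp s p :: ('a \<Rightarrow> real) set).
     ennreal C * (\<integral>\<^sup>+x. ennreal (\<bar>u x\<bar> powr p / norm x powr (p * s)) \<partial>lborel) \<le> gagliardo p s u)}"

definition mu_bar :: "'a::euclidean_space itself \<Rightarrow> real \<Rightarrow> real \<Rightarrow> real \<Rightarrow> real" where
  "mu_bar T p s \<theta> =
     (if \<theta> = s then C_frac T p s
      else if \<theta> = 1 then C_H T p
      else min (C_H T p * (1 - s) / (\<theta> - s)) (C_frac T p s * (1 - s) / (1 - \<theta>)))"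

end

theory Submission
  imports Defs "HOL-Probability.Helly_Selection"
begin

text \<open>
  Weak convergence makes the energies bounded, by the uniform boundedness principle applied to the
  \<open>L\<^sup>p\<close> functions \<open>\<nabla>u\<^sub>k\<close> and \<open>(u\<^sub>k(x) - u\<^sub>k(y)) / |x - y|\<^bsup>(N+ps)/p\<^esup>\<close>, whose duality maps are explicit.
  The Gagliardo seminorm controls the distance of \<open>u\<close> to its averages over small balls, so
  \<open>u\<^sub>k \<rightarrow> u\<close> strongly in \<open>L\<^sup>p\<close>; hence the Hardy measures converge away from the origin and their limit
  differs from that of \<open>u\<close> by an atom of mass \<open>\<sigma>\<^sub>0\<close> at 0. The limit \<open>\<omega>\<close> of the energies dominates the energy
  of \<open>u\<close> by convexity of \<open>|\<cdot>|\<^sup>p\<close>, and since the latter has no atoms one can take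
  \<open>\<omega>\<^sub>0 = \<omega>({0})\<close>. If \<open>\<theta> < 1\<close>, then \<open>|x|\<^bsup>-p\<theta>\<^esup> \<le> \<rho>\<^bsup>p(1-\<theta>)\<^esup>|x|\<^bsup>-p\<^esup>\<close> near 0 together with the
  Hardy inequality forces \<open>\<sigma>\<^sub>0 = 0\<close>, so the fractional Hardy constant plays no role. If \<open>\<theta> = 1\<close>,
  a sharp Hardy inequality with a cutoff \<open>\<eta>\<close> has an error term with density \<open>|x \<cdot> \<nabla>\<eta>| |u|\<^sup>p/|x|\<^sup>p\<close>,
  which does not see the atom; shrinking the support of \<open>\<eta>\<close> gives \<open>C\<^sub>H \<sigma>\<^sub>0 \<le> \<omega>\<^sub>0\<close>.
\<close>

section \<open>Uniform boundedness and weak lower semicontinuity in \<open>L\<^sup>p\<close>\<close>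

text \<open>Applying Hardy's inequality to a cut-off function \<eta> u would bring in the Gagliardo
  seminorm of a product. The cutoff is instead placed in the vector field
  \<open>\<eta>(x) |u|^p x / (|x|^2 + e)^(p/2)\<close>, whose divergence contains only the local
  gradient; the nonlocal density is nonnegative and is added on the larger side afterwards.

  Weak convergence is known only through bounded functionals on X(\<Omega>). Pairing an L^q
  function, q = p/(p-1), with the weak gradient, with the weighted difference quotient on the
  product space, or (by a Poincare inequality) with the function itself gives such functionals. This
  moves boundedness, lower semicontinuity and the convergence of averages into L^p spaces over
  \<open>lborel\<close> and \<open>lborel \<Otimes>\<^sub>M lborel\<close>.

  Away from the origin the Hardy densities converge together with |u|^p, on all of space. Mass can
  therefore be lost only at 0, and one real number, the limit of the total masses, determines
  \<sigma>. General compactness of measures is reserved for the energies, whose nonlocal densities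
  have tails reaching to infinity.\<close>

lemma powr_convex_comb:
  fixes a b p t :: real
  assumes "1 \<le> p" "0 < t" "t < 1" "0 \<le> a" "0 \<le> b"
  shows "(a + b) powr p \<le> t powr (1 - p) * a powr p + (1 - t) powr (1 - p) * b powr p"
proof -
  have ge1: "1 \<le> s powr (1 - p)" if "0 < s" "s < 1" for s :: real
    using powr_mono2'[of "1-p" s 1] that assms by simp
  have eq: "s * (y / s) powr p = s powr (1 - p) * y powr p" if "0 < s" "0 \<le> y" for s y :: real
    using that by (simp add: powr_divide powr_diff)
  consider "a = 0" | "b = 0" | "0 < a" "0 < b"
    using assms by linarith
  then show ?thesis
  proof cases
    case 1
    then show ?thesis using ge1[of "1-t"] assms mult_right_mono[of 1 "(1 - t) powr (1 - p)" "b powr p"]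
      by simp
  next
    case 2
    then show ?thesis using ge1[of t] assms mult_right_mono[of 1 "t powr (1 - p)" "a powr p"]
      by simp
  next
    case 3
    \<comment> \<open>Convexity with weights t and 1 - t at the points a/t and b/(1-t). As t tends
      to 1 the coefficient of \<open>a powr p\<close> tends to 1, which is why t is kept free
      instead of being fixed at 1/2.\<close>
    have "(t * (a / t) + (1 - t) * (b / (1 - t))) powr p \<le> t * (a / t) powr p + (1 - t) * (b / (1 - t)) powr p"
      using convex_onD[OF powr_convex[OF assms(1)], of "1 - t" "a / t" "b / (1 - t)"] assms 3 by simp
    then show ?thesis using assms 3 by (simp add: eq)
  qed
qed

lemma powr_add_le:
  fixes a b p :: real
  assumes "1 \<le> p" "0 \<le> a" "0 \<le> b"
  shows "(a + b) powr p \<le> 2 powr (p - 1) * (a powr p + b powr p)"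
  using powr_convex_comb[OF assms(1), of "1/2" a b] assms
  by (simp add: powr_divide powr_diff powr_minus field_simps)

text \<open>Plays the part of the triangle inequality for L^p norms on the level of p-th powers:
  think of \<open>f k\<close>, \<open>a\<close>, \<open>d k\<close> as the p-th powers of the norms
  of h_k, g and h_k - g. First t is chosen close to 1; the coefficient of \<open>d k\<close> is then
  large but fixed, and k tends to infinity.\<close>

lemma tendsto_of_convex_bounds:
  fixes a :: real and f d :: "nat \<Rightarrow> real"
  assumes d: "d \<longlonglongrightarrow> 0"
    and up: "\<And>k t. 0 < t \<Longrightarrow> t < 1 \<Longrightarrow> f k \<le> t powr (1 - p) * a + (1 - t) powr (1 - p) * d k"
    and lo: "\<And>k t. 0 < t \<Longrightarrow> t < 1 \<Longrightarrow> a \<le> t powr (1 - p) * f k + (1 - t) powr (1 - p) * d k"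
  shows "f \<longlonglongrightarrow> a"
proof (rule order_tendstoI)
  have I: "\<forall>\<^sub>F t in at_left (1::real). 0 < t \<and> t < 1"
    by (auto simp: eventually_at_left_field intro!: exI[of _ 0])
  fix c
  assume c: "a < c"
  have "((\<lambda>t. t powr (1 - p) * a) \<longlongrightarrow> 1 powr (1 - p) * a) (at_left 1)"
    by (intro tendsto_intros) auto
  then have "\<forall>\<^sub>F t in at_left 1. t powr (1 - p) * a < c"
    using c by (intro order_tendstoD(2)[of _ a]) auto
  with I have "\<forall>\<^sub>F t in at_left 1. 0 < t \<and> t < 1 \<and> t powr (1 - p) * a < c"
    by eventually_elim auto
  then obtain t where t: "0 < t" "t < 1" "t powr (1 - p) * a < c"
    using eventually_happens'[of "at_left (1::real)"] by auto
  have "(\<lambda>k. t powr (1 - p) * a + (1 - t) powr (1 - p) * d k) \<longlonglongrightarrow> t powr (1 - p) * a + (1 - t) powr (1 - p) * 0"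
    by (intro tendsto_intros d)
  then have "\<forall>\<^sub>F k in sequentially. t powr (1 - p) * a + (1 - t) powr (1 - p) * d k < c"
    using t by (intro order_tendstoD(2)[of _ "t powr (1 - p) * a"]) auto
  then show "\<forall>\<^sub>F k in sequentially. f k < c"
    by eventually_elim (use up t in \<open>meson le_less_trans\<close>)
next
  have I: "\<forall>\<^sub>F t in at_left (1::real). 0 < t \<and> t < 1"
    by (auto simp: eventually_at_left_field intro!: exI[of _ 0])
  fix c
  assume c: "c < a"
  have "((\<lambda>t. t powr (p - 1) * a) \<longlongrightarrow> 1 powr (p - 1) * a) (at_left 1)"
    by (intro tendsto_intros) auto
  then have "\<forall>\<^sub>F t in at_left 1. t powr (p - 1) * a > c"
    using c by (intro order_tendstoD(1)[of _ a]) auto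
  with I have "\<forall>\<^sub>F t in at_left 1. 0 < t \<and> t < 1 \<and> t powr (p - 1) * a > c"
    by eventually_elim auto
  then obtain t where t: "0 < t" "t < 1" "t powr (p - 1) * a > c"
    using eventually_happens'[of "at_left (1::real)"] by auto
  have "(\<lambda>k. t powr (p - 1) * (a - (1 - t) powr (1 - p) * d k)) \<longlonglongrightarrow> t powr (p - 1) * (a - (1 - t) powr (1 - p) * 0)"
    by (intro tendsto_intros d)
  then have ev: "\<forall>\<^sub>F k in sequentially. t powr (p - 1) * (a - (1 - t) powr (1 - p) * d k) > c"
    using t by (intro order_tendstoD(1)[of _ "t powr (p - 1) * a"]) auto
  have "t powr (p - 1) * (a - (1 - t) powr (1 - p) * d k) \<le> f k" for k
  proof -
    have "t powr (p - 1) * (a - (1 - t) powr (1 - p) * d k) \<le> t powr (p - 1) * (t powr (1 - p) * f k)"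
      using lo[OF t(1,2), of k] by (intro mult_left_mono) auto
    also have "\<dots> = f k" using t by (simp add: mult.assoc[symmetric] powr_add[symmetric])
    finally show ?thesis .
  qed
  with ev show "\<forall>\<^sub>F k in sequentially. c < f k"
    by (auto elim!: eventually_mono intro: less_le_trans)
qed

text \<open>The scalar convexity bound, integrated against a weight. Working with p-th powers in
  [0, \<infinity>] postpones all questions of finiteness, and the free t feeds the limit argument
  for convergence of the integrals.\<close>

lemma nn_integral_powr_triangle:
  fixes f g :: "'b \<Rightarrow> 'e::euclidean_space"
  assumes [measurable]: "f \<in> borel_measurable M" "g \<in> borel_measurable M" "w \<in> borel_measurable M"
    and p: "1 \<le> p" and t: "0 < t" "t < 1"
  shows "(\<integral>\<^sup>+x. w x * ennreal (norm (f x) powr p) \<partial>M) \<le>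
    ennreal (t powr (1 - p)) * (\<integral>\<^sup>+x. w x * ennreal (norm (g x) powr p) \<partial>M) +
    ennreal ((1 - t) powr (1 - p)) * (\<integral>\<^sup>+x. w x * ennreal (norm (f x - g x) powr p) \<partial>M)"
proof -
  have "(\<integral>\<^sup>+x. w x * ennreal (norm (f x) powr p) \<partial>M) \<le>
     (\<integral>\<^sup>+x. ennreal (t powr (1 - p)) * (w x * ennreal (norm (g x) powr p)) +
        ennreal ((1 - t) powr (1 - p)) * (w x * ennreal (norm (f x - g x) powr p)) \<partial>M)"
  proof (rule nn_integral_mono)
    fix x
    have "norm (f x) powr p \<le> (norm (g x) + norm (f x - g x)) powr p"
      using p norm_triangle_ineq[of "g x" "f x - g x"] by (intro powr_mono2) auto
    also have "\<dots> \<le> t powr (1 - p) * norm (g x) powr p + (1 - t) powr (1 - p) * norm (f x - g x) powr p"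
      using powr_convex_comb p t by auto
    finally have "ennreal (norm (f x) powr p) \<le> ennreal (t powr (1 - p) * norm (g x) powr p + (1 - t) powr (1 - p) * norm (f x - g x) powr p)"
      by (rule ennreal_leI)
    also have "\<dots> = ennreal (t powr (1 - p)) * ennreal (norm (g x) powr p) + ennreal ((1 - t) powr (1 - p)) * ennreal (norm (f x - g x) powr p)"
      by (simp add: ennreal_mult ennreal_plus)
    finally have "w x * ennreal (norm (f x) powr p) \<le> w x * (\<dots>)" by (rule mult_left_mono) simp
    then show "w x * ennreal (norm (f x) powr p) \<le> ennreal (t powr (1 - p)) * (w x * ennreal (norm (g x) powr p)) +
        ennreal ((1 - t) powr (1 - p)) * (w x * ennreal (norm (f x - g x) powr p))"
      by (simp add: distrib_left mult.left_commute)
  qed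
  also have "\<dots> = ennreal (t powr (1 - p)) * (\<integral>\<^sup>+x. w x * ennreal (norm (g x) powr p) \<partial>M) +
    ennreal ((1 - t) powr (1 - p)) * (\<integral>\<^sup>+x. w x * ennreal (norm (f x - g x) powr p) \<partial>M)"
    by (simp add: nn_integral_add nn_integral_cmult)
  finally show ?thesis .
qed

lemma nn_integral_powr_diff_le:
  fixes f g :: "'b \<Rightarrow> 'e::euclidean_space"
  assumes [measurable]: "f \<in> borel_measurable M" "g \<in> borel_measurable M"
    and p: "1 \<le> p"
  shows "(\<integral>\<^sup>+x. ennreal (norm (f x - g x) powr p) \<partial>M) \<le>
    ennreal (2 powr (p - 1)) * ((\<integral>\<^sup>+x. ennreal (norm (f x) powr p) \<partial>M) + (\<integral>\<^sup>+x. ennreal (norm (g x) powr p) \<partial>M))"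
  using nn_integral_powr_triangle[where t="1/2" and w="\<lambda>_. 1" and M=M and f="\<lambda>x. f x - g x" and g="f" and p=p] p
  by (simp add: powr_divide powr_diff powr_minus distrib_left)

lemma nn_integral_powr_tendsto:
  fixes h :: "nat \<Rightarrow> 'b \<Rightarrow> 'e::euclidean_space"
  assumes m[measurable]: "\<And>k. h k \<in> borel_measurable M" "g \<in> borel_measurable M" "w \<in> borel_measurable M"
    and p: "1 \<le> p"
    and lim: "(\<lambda>k. \<integral>\<^sup>+x. ennreal (norm (h k x - g x) powr p) \<partial>M) \<longlonglongrightarrow> 0"
    and fin: "(\<integral>\<^sup>+x. ennreal (norm (g x) powr p) \<partial>M) < \<infinity>"
    and w: "\<And>x. w x \<le> ennreal B"
  shows "(\<lambda>k. \<integral>\<^sup>+x. w x * ennreal (norm (h k x) powr p) \<partial>M) \<longlonglongrightarrow> (\<integral>\<^sup>+x. w x * ennreal (norm (g x) powr p) \<partial>M)"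
proof -
  define I where "I f = (\<integral>\<^sup>+x. w x * ennreal (norm (f x :: 'e) powr p) \<partial>M)" for f
  define D where "D k = I (\<lambda>x. h k x - g x)" for k
  have le: "I f \<le> ennreal B * (\<integral>\<^sup>+x. ennreal (norm (f x) powr p) \<partial>M)" if "f \<in> borel_measurable M" for f
    unfolding I_def using w that
    by (subst nn_integral_cmult[symmetric]) (auto intro!: nn_integral_mono mult_right_mono)
  have Ig: "I g < \<infinity>"
    by (rule le_less_trans[OF le]) (use fin in \<open>auto simp: ennreal_mult_less_top\<close>)
  have D: "D \<longlonglongrightarrow> 0"
  proof (rule tendsto_sandwich[of "\<lambda>_. 0"])
    show "\<forall>\<^sub>F k in sequentially. D k \<le> ennreal B * (\<integral>\<^sup>+x. ennreal (norm (h k x - g x) powr p) \<partial>M)"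
      unfolding D_def by (intro always_eventually allI le) measurable
    show "(\<lambda>k. ennreal B * (\<integral>\<^sup>+x. ennreal (norm (h k x - g x) powr p) \<partial>M)) \<longlonglongrightarrow> 0"
      using ennreal_tendsto_cmult[OF _ lim, of "ennreal B"] by simp
  qed auto
  have Dfin: "\<forall>\<^sub>F k in sequentially. D k < \<infinity>"
    using order_tendstoD(2)[OF D, of \<infinity>] by simp
  \<comment> \<open>Finitely many distances may be infinite. The passage to real numbers is made
    only for the tail from K on, and the shift is undone at the end.\<close>
  then obtain K where K: "\<And>k. k \<ge> K \<Longrightarrow> D k < \<infinity>" by (auto simp: eventually_sequentially)
  have up: "I (h k) \<le> ennreal (t powr (1 - p)) * I g + ennreal ((1 - t) powr (1 - p)) * D k" if "0 < t" "t < 1" for t k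
    unfolding I_def D_def using nn_integral_powr_triangle[OF m(1)[of k] m(2,3) p that] .
  have lo: "I g \<le> ennreal (t powr (1 - p)) * I (h k) + ennreal ((1 - t) powr (1 - p)) * D k" if "0 < t" "t < 1" for t k
    unfolding I_def D_def using nn_integral_powr_triangle[OF m(2) m(1)[of k] m(3) p that]
    by (simp add: norm_minus_commute)
  have Ih: "I (h k) < \<infinity>" if "k \<ge> K" for k
    by (rule le_less_trans[OF up[of "1/2"]]) (use Ig K[OF that] in \<open>auto simp: ennreal_mult_less_top\<close>)
  have real: "(\<lambda>k. enn2real (I (h (k + K)))) \<longlonglongrightarrow> enn2real (I g)"
  proof (rule tendsto_of_convex_bounds[where d="\<lambda>k. enn2real (D (k + K))" and p=p])
    show "(\<lambda>k. enn2real (D (k + K))) \<longlonglongrightarrow> 0"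
      using LIMSEQ_ignore_initial_segment[OF tendsto_enn2real[of D 0], of K] D by simp
    have *: "x \<le> ennreal a * y + ennreal b * z \<Longrightarrow> x < \<infinity> \<Longrightarrow> y < \<infinity> \<Longrightarrow> z < \<infinity> \<Longrightarrow> 0 \<le> a \<Longrightarrow> 0 \<le> b \<Longrightarrow> enn2real x \<le> a * enn2real y + b * enn2real z" for x y z a b
      by (cases x; cases y; cases z) (auto simp flip: ennreal_mult ennreal_plus)
    show "enn2real (I (h (k + K))) \<le> t powr (1 - p) * enn2real (I g) + (1 - t) powr (1 - p) * enn2real (D (k + K))"
      if "0 < t" "t < 1" for k t
      using up[OF that] Ig K Ih by (intro *) auto
    show "enn2real (I g) \<le> t powr (1 - p) * enn2real (I (h (k + K))) + (1 - t) powr (1 - p) * enn2real (D (k + K))"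
      if "0 < t" "t < 1" for k t
      using lo[OF that] Ig K Ih by (intro *) auto
  qed
  have "(\<lambda>k. ennreal (enn2real (I (h (k + K))))) \<longlonglongrightarrow> ennreal (enn2real (I g))"
    using real by (rule tendsto_ennrealI)
  moreover have "ennreal (enn2real (I (h (k + K)))) = I (h (k + K))" for k
    using Ih[of "k + K"] by (simp add: less_top)
  moreover have "ennreal (enn2real (I g)) = I g"
    using Ig by (simp add: less_top)
  ultimately have "(\<lambda>k. I (h (k + K))) \<longlonglongrightarrow> I g"
    by (simp only:)
  then show ?thesis unfolding I_def[symmetric] by (rule LIMSEQ_offset)
qed

text \<open>Young's inequality for g/A and h/B with A = a^(1/q) and B = b^(1/p), integrated. The
  numbers a and b are only upper bounds; if one of them is 0, the corresponding function vanishes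
  almost everywhere and the normalisation would divide by 0.\<close>

lemma Hoelder_inequality:
  fixes g h :: "'b \<Rightarrow> real"
  assumes [measurable]: "g \<in> borel_measurable M" "h \<in> borel_measurable M"
    and p: "1 < p" and nn: "0 \<le> a" "0 \<le> b"
    and g: "(\<integral>\<^sup>+x. ennreal (\<bar>g x\<bar> powr (p / (p - 1))) \<partial>M) \<le> ennreal a"
    and h: "(\<integral>\<^sup>+x. ennreal (\<bar>h x\<bar> powr p) \<partial>M) \<le> ennreal b"
  shows "(\<integral>\<^sup>+x. ennreal \<bar>g x * h x\<bar> \<partial>M) \<le> ennreal (a powr ((p - 1) / p) * b powr (1 / p))"
proof -
  define q where "q = p / (p - 1)"
  have q: "1 < q" "1 / q = (p - 1) / p" using p by (auto simp: q_def field_simps)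
  have pq: "1 / p + 1 / q = 1" using p by (simp add: q_def field_simps)
  have zero: "(\<integral>\<^sup>+x. ennreal \<bar>g x * h x\<bar> \<partial>M) = 0" if "AE x in M. g x = 0 \<or> h x = 0"
  proof -
    have "(\<integral>\<^sup>+x. ennreal \<bar>g x * h x\<bar> \<partial>M) = (\<integral>\<^sup>+x. 0 \<partial>M)"
      by (rule nn_integral_cong_AE) (use that in \<open>auto elim!: eventually_mono\<close>)
    then show ?thesis by simp
  qed
  consider "a = 0" | "b = 0" | "0 < a" "0 < b" using nn by linarith
  then show ?thesis
  proof cases
    case 1
    with g have "(\<integral>\<^sup>+x. ennreal (\<bar>g x\<bar> powr (p / (p - 1))) \<partial>M) = 0" by simp
    then have "AE x in M. ennreal (\<bar>g x\<bar> powr (p / (p - 1))) = 0"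
      by (subst (asm) nn_integral_0_iff_AE) auto
    then have "AE x in M. g x = 0 \<or> h x = 0" by eventually_elim (auto simp: ennreal_eq_0_iff powr_def split: if_splits)
    then show ?thesis using zero by simp
  next
    case 2
    with h have "(\<integral>\<^sup>+x. ennreal (\<bar>h x\<bar> powr p) \<partial>M) = 0" by simp
    then have "AE x in M. ennreal (\<bar>h x\<bar> powr p) = 0"
      by (subst (asm) nn_integral_0_iff_AE) auto
    then have "AE x in M. g x = 0 \<or> h x = 0" by eventually_elim (auto simp: ennreal_eq_0_iff powr_def split: if_splits)
    then show ?thesis using zero by simp
  next
    case 3
    define A where "A = a powr (1 / q)"
    define B where "B = b powr (1 / p)"
    have AB: "0 < A" "0 < B" using 3 by (auto simp: A_def B_def)
    have Aq: "A powr q = a" and Bp: "B powr p = b"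
      using 3 p q(1) by (auto simp: A_def B_def powr_powr)
    have "(\<integral>\<^sup>+x. ennreal \<bar>g x * h x\<bar> \<partial>M) \<le>
       (\<integral>\<^sup>+x. ennreal (A * B / (q * a)) * ennreal (\<bar>g x\<bar> powr q) + ennreal (A * B / (p * b)) * ennreal (\<bar>h x\<bar> powr p) \<partial>M)"
    proof (rule nn_integral_mono)
      fix x
      have "\<bar>g x\<bar> / A * (\<bar>h x\<bar> / B) \<le> (\<bar>g x\<bar> / A) powr q / q + (\<bar>h x\<bar> / B) powr p / p"
        using Youngs_inequality[of q p "\<bar>g x\<bar> / A" "\<bar>h x\<bar> / B"] p q pq AB by (simp add: add.commute)
      also have "\<dots> = \<bar>g x\<bar> powr q / (q * a) + \<bar>h x\<bar> powr p / (p * b)"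
        using AB Aq Bp by (simp add: powr_divide mult.commute)
      finally have "A * B * (\<bar>g x\<bar> / A * (\<bar>h x\<bar> / B)) \<le> A * B * (\<bar>g x\<bar> powr q / (q * a) + \<bar>h x\<bar> powr p / (p * b))"
        using AB by (intro mult_left_mono) auto
      then have "\<bar>g x * h x\<bar> \<le> A * B / (q * a) * \<bar>g x\<bar> powr q + A * B / (p * b) * \<bar>h x\<bar> powr p"
        using AB by (simp add: distrib_left abs_mult)
      then show "ennreal \<bar>g x * h x\<bar> \<le> ennreal (A * B / (q * a)) * ennreal (\<bar>g x\<bar> powr q) + ennreal (A * B / (p * b)) * ennreal (\<bar>h x\<bar> powr p)"
        using AB 3 p q by (simp flip: ennreal_mult ennreal_plus)
    qed
    also have "\<dots> = ennreal (A * B / (q * a)) * (\<integral>\<^sup>+x. ennreal (\<bar>g x\<bar> powr q) \<partial>M) + ennreal (A * B / (p * b)) * (\<integral>\<^sup>+x. ennreal (\<bar>h x\<bar> powr p) \<partial>M)"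
      by (simp add: nn_integral_add nn_integral_cmult)
    also have "\<dots> \<le> ennreal (A * B / (q * a)) * ennreal a + ennreal (A * B / (p * b)) * ennreal b"
      using g h by (intro add_mono mult_left_mono) (auto simp: q_def)
    also have "\<dots> = ennreal (A * B * (1 / p + 1 / q))"
      using AB 3 p q(1) by (simp flip: ennreal_mult ennreal_plus add: distrib_left)
    also have "\<dots> = ennreal (A * B)" using pq by simp
    finally show ?thesis using q by (simp add: A_def B_def)
  qed
qed

lemma integrable_inner_Lp:
  fixes g h :: "'b \<Rightarrow> 'e::euclidean_space"
  assumes [measurable]: "g \<in> borel_measurable M" "h \<in> borel_measurable M"
    and p: "1 < p"
    and g: "(\<integral>\<^sup>+x. ennreal (norm (g x) powr (p / (p - 1))) \<partial>M) < \<infinity>"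
    and h: "(\<integral>\<^sup>+x. ennreal (norm (h x) powr p) \<partial>M) < \<infinity>"
  shows "integrable M (\<lambda>x. g x \<bullet> h x)"
    and "\<bar>\<integral>x. g x \<bullet> h x \<partial>M\<bar> \<le> enn2real (\<integral>\<^sup>+x. ennreal (norm (g x) powr (p / (p - 1))) \<partial>M) powr ((p - 1) / p) *
        enn2real (\<integral>\<^sup>+x. ennreal (norm (h x) powr p) \<partial>M) powr (1 / p)" (is "_ \<le> ?R")
proof -
  have "(\<integral>\<^sup>+x. ennreal (norm (g x \<bullet> h x)) \<partial>M) \<le> (\<integral>\<^sup>+x. ennreal \<bar>norm (g x) * norm (h x)\<bar> \<partial>M)"
    by (intro nn_integral_mono ennreal_leI) (simp add: Cauchy_Schwarz_ineq2)
  also have "\<dots> \<le> ennreal ?R"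
    using g h p by (intro Hoelder_inequality) auto
  finally have le: "(\<integral>\<^sup>+x. ennreal (norm (g x \<bullet> h x)) \<partial>M) \<le> ennreal ?R" .
  show int: "integrable M (\<lambda>x. g x \<bullet> h x)"
    by (rule integrableI_bounded) (use le_less_trans[OF le] in auto)
  have "\<bar>\<integral>x. g x \<bullet> h x \<partial>M\<bar> \<le> (\<integral>x. norm (g x \<bullet> h x) \<partial>M)"
    using integral_norm_bound[of M "\<lambda>x. g x \<bullet> h x"] by simp
  moreover have "ennreal (\<integral>x. norm (g x \<bullet> h x) \<partial>M) \<le> ennreal ?R"
    using le int by (subst nn_integral_eq_integral[symmetric]) auto
  then have "(\<integral>x. norm (g x \<bullet> h x) \<partial>M) \<le> ?R"
    by (subst (asm) ennreal_le_iff) auto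
  ultimately show "\<bar>\<integral>x. g x \<bullet> h x \<partial>M\<bar> \<le> ?R" by linarith
qed

text \<open>The gradient of |b|^p / p, which maps L^p into L^q with q = p/(p-1). Since
  \<open>0 powr a = 0\<close> for every a, the value at 0 is 0 also when p < 2.\<close>

definition dual_vec :: "real \<Rightarrow> 'e::euclidean_space \<Rightarrow> 'e" where
  "dual_vec p b = norm b powr (p - 2) *\<^sub>R b"

lemma dual_vec_measurable [measurable]: "dual_vec p \<in> borel_measurable borel"
  unfolding dual_vec_def by measurable

lemma norm_dual_vec: "norm (dual_vec p b) = norm b powr (p - 1)"
proof (cases "b = 0")
  case False
  then have "norm b powr (p - 2) * norm b powr 1 = norm b powr (p - 1)" by (simp only: powr_add[symmetric]) simp
  then show ?thesis by (simp add: dual_vec_def)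
qed (simp add: dual_vec_def)

lemma norm_dual_vec_powr: "1 < p \<Longrightarrow> norm (dual_vec p b) powr (p / (p - 1)) = norm b powr p"
  by (simp add: norm_dual_vec powr_powr)

lemma dual_vec_inner: "dual_vec p b \<bullet> b = norm b powr p"
proof (cases "b = 0")
  case False
  then have "norm b powr (p - 2) * norm b powr 2 = norm b powr p" by (simp only: powr_add[symmetric]) simp
  then show ?thesis using False by (simp add: dual_vec_def dot_square_norm)
qed (simp add: dual_vec_def)

text \<open>The graph of |.|^p lies above its tangent plane at b. This comes from Cauchy-Schwarz and
  Young's inequality with exponents p/(p-1) and p, where equality holds at a = b.\<close>

lemma powr_ge_tangent:
  fixes a b :: "'e::euclidean_space"
  assumes "1 < p"
  shows "norm b powr p + p * (dual_vec p b \<bullet> (a - b)) \<le> norm a powr p"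
proof -
  have "dual_vec p b \<bullet> a \<le> norm b powr (p - 1) * norm a"
    using norm_cauchy_schwarz[of "dual_vec p b" a] by (simp add: norm_dual_vec)
  also have "\<dots> \<le> (norm b powr (p - 1)) powr (p / (p - 1)) / (p / (p - 1)) + norm a powr p / p"
    using assms by (intro Youngs_inequality) (auto simp: field_simps)
  also have "\<dots> = ((p - 1) * norm b powr p + norm a powr p) / p"
    using assms by (simp add: powr_powr add_divide_distrib)
  finally have "p * (dual_vec p b \<bullet> a) \<le> (p - 1) * norm b powr p + norm a powr p"
    using assms by (simp add: field_simps)
  then show ?thesis by (simp add: inner_diff_right dual_vec_inner algebra_simps)
qed

text \<open>The tangent inequality at g(x), evaluated at \<open>h k x\<close> and integrated against
  w; its linear term is the pairing with the fixed L^q function w \<open>dual_vec p (g x)\<close>,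
  so it tends to 0. An explicit null sequence c instead of a liminf lets the gradient part and the
  nonlocal part be added later.\<close>

lemma weak_lower_semicontinuous:
  fixes h :: "nat \<Rightarrow> 'b \<Rightarrow> 'e::euclidean_space"
  assumes [measurable]: "\<And>k. h k \<in> borel_measurable M" "g \<in> borel_measurable M" "w \<in> borel_measurable M"
    and p: "1 < p" and w: "\<And>x. 0 \<le> w x" "\<And>x. w x \<le> B"
    and g: "(\<integral>\<^sup>+x. ennreal (norm (g x) powr p) \<partial>M) < \<infinity>"
    and h: "\<And>k. (\<integral>\<^sup>+x. ennreal (norm (h k x) powr p) \<partial>M) < \<infinity>"
    and weak: "\<And>G. G \<in> borel_measurable M \<Longrightarrow> (\<integral>\<^sup>+x. ennreal (norm (G x) powr (p / (p - 1))) \<partial>M) < \<infinity> \<Longrightarrow>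
       (\<lambda>k. \<integral>x. G x \<bullet> h k x \<partial>M) \<longlonglongrightarrow> (\<integral>x. G x \<bullet> g x \<partial>M)"
  obtains c where "c \<longlonglongrightarrow> 0"
    "\<And>k. (\<integral>\<^sup>+x. ennreal (w x) * ennreal (norm (g x) powr p) \<partial>M) \<le> (\<integral>\<^sup>+x. ennreal (w x) * ennreal (norm (h k x) powr p) \<partial>M) + ennreal (c k)"
proof
  define G where "G x = w x *\<^sub>R dual_vec p (g x)" for x
  have [measurable]: "G \<in> borel_measurable M" unfolding G_def by measurable
  have Gfin: "(\<integral>\<^sup>+x. ennreal (norm (G x) powr (p / (p - 1))) \<partial>M) < \<infinity>"
  proof -
    have "(\<integral>\<^sup>+x. ennreal (norm (G x) powr (p / (p - 1))) \<partial>M) \<le> (\<integral>\<^sup>+x. ennreal (B powr (p / (p - 1))) * ennreal (norm (g x) powr p) \<partial>M)"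
    proof (rule nn_integral_mono)
      fix x
      have "norm (G x) powr (p / (p - 1)) = w x powr (p / (p - 1)) * norm (g x) powr p"
        using w p by (simp add: G_def powr_mult norm_dual_vec_powr)
      also have "\<dots> \<le> B powr (p / (p - 1)) * norm (g x) powr p"
        using w p by (intro mult_right_mono powr_mono2) auto
      finally show "ennreal (norm (G x) powr (p / (p - 1))) \<le> ennreal (B powr (p / (p - 1))) * ennreal (norm (g x) powr p)"
        by (simp flip: ennreal_mult add: ennreal_leI)
    qed
    also have "\<dots> < \<infinity>" using g by (simp add: nn_integral_cmult ennreal_mult_less_top)
    finally show ?thesis .
  qed
  \<comment> \<open>The absolute value makes c nonnegative, so that \<open>ennreal (c k)\<close>
    does not truncate it.\<close>
  define c where "c k = \<bar>p * ((\<integral>x. G x \<bullet> g x \<partial>M) - (\<integral>x. G x \<bullet> h k x \<partial>M))\<bar>" for k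
  have "(\<lambda>k. \<bar>p * ((\<integral>x. G x \<bullet> g x \<partial>M) - (\<integral>x. G x \<bullet> h k x \<partial>M))\<bar>) \<longlonglongrightarrow> \<bar>p * ((\<integral>x. G x \<bullet> g x \<partial>M) - (\<integral>x. G x \<bullet> g x \<partial>M))\<bar>"
    by (intro tendsto_intros weak Gfin) measurable
  then show "c \<longlonglongrightarrow> 0" unfolding c_def by simp
  fix k
  have fin: "(\<integral>\<^sup>+x. ennreal (w x) * ennreal (norm (f x) powr p) \<partial>M) < \<infinity>"
    if "(\<integral>\<^sup>+x. ennreal (norm (f x) powr p) \<partial>M) < \<infinity>" "f \<in> borel_measurable M" for f :: "'b \<Rightarrow> 'e"
  proof -
    have "(\<integral>\<^sup>+x. ennreal (w x) * ennreal (norm (f x) powr p) \<partial>M) \<le> (\<integral>\<^sup>+x. ennreal B * ennreal (norm (f x) powr p) \<partial>M)"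
      using w by (intro nn_integral_mono mult_right_mono ennreal_leI) auto
    also have "\<dots> < \<infinity>" using that by (simp add: nn_integral_cmult ennreal_mult_less_top)
    finally show ?thesis .
  qed
  have ig: "integrable M (\<lambda>x. w x * norm (g x) powr p)" and ih: "integrable M (\<lambda>x. w x * norm (h k x) powr p)"
    using fin[OF g] fin[OF h[of k]] w by (auto intro!: integrableI_bounded simp: abs_mult ennreal_mult)
  have iG: "integrable M (\<lambda>x. G x \<bullet> g x)" "integrable M (\<lambda>x. G x \<bullet> h k x)"
    by (auto intro!: integrable_inner_Lp[OF _ _ p] Gfin g h)
  have "(\<integral>x. w x * norm (g x) powr p + p * (G x \<bullet> h k x - G x \<bullet> g x) \<partial>M) \<le> (\<integral>x. w x * norm (h k x) powr p \<partial>M)"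
  proof (rule integral_mono)
    show "integrable M (\<lambda>x. w x * norm (g x) powr p + p * (G x \<bullet> h k x - G x \<bullet> g x))"
      using ig iG by auto
    show "integrable M (\<lambda>x. w x * norm (h k x) powr p)" by (rule ih)
    fix x
    have "w x * (norm (g x) powr p + p * (dual_vec p (g x) \<bullet> (h k x - g x))) \<le> w x * norm (h k x) powr p"
      using w powr_ge_tangent[OF p] by (intro mult_left_mono) auto
    then show "w x * norm (g x) powr p + p * (G x \<bullet> h k x - G x \<bullet> g x) \<le> w x * norm (h k x) powr p"
      by (simp add: G_def inner_diff_right algebra_simps)
  qed
  also have "(\<integral>x. w x * norm (g x) powr p + p * (G x \<bullet> h k x - G x \<bullet> g x) \<partial>M) =
     (\<integral>x. w x * norm (g x) powr p \<partial>M) + p * ((\<integral>x. G x \<bullet> h k x \<partial>M) - (\<integral>x. G x \<bullet> g x \<partial>M))"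
    using ig iG by simp
  finally have *: "(\<integral>x. w x * norm (g x) powr p \<partial>M) \<le> (\<integral>x. w x * norm (h k x) powr p \<partial>M) + c k"
    unfolding c_def by (auto simp: algebra_simps abs_if)
  have e: "(\<integral>\<^sup>+x. ennreal (w x) * ennreal (norm (f x) powr p) \<partial>M) = ennreal (\<integral>x. w x * norm (f x) powr p \<partial>M)"
    if "integrable M (\<lambda>x. w x * norm (f x) powr p)" for f :: "'b \<Rightarrow> 'e"
    using w that by (subst nn_integral_eq_integral[symmetric]) (auto simp: ennreal_mult)
  show "(\<integral>\<^sup>+x. ennreal (w x) * ennreal (norm (g x) powr p) \<partial>M) \<le> (\<integral>\<^sup>+x. ennreal (w x) * ennreal (norm (h k x) powr p) \<partial>M) + ennreal (c k)"
    unfolding e[OF ig] e[OF ih] using ennreal_leI[OF *] w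
    by (subst (asm) ennreal_plus) (auto simp: c_def intro!: integral_nonneg_AE)
qed

text \<open>
  A gliding hump: in \<open>G = \<Sum>j. \<plusminus>3\<^sup>-\<^sup>j g\<^sub>j\<close> the \<open>j\<close>-th sign keeps the pairing of the partial sum with
  \<open>h (\<kappa> j)\<close> above \<open>3\<^sup>-\<^sup>j N (\<kappa> j)\<close>, and the tail of the series can cancel only half of it.
\<close>

lemma Lp_weakly_bounded_imp_bounded:
  fixes h :: "nat \<Rightarrow> 'b \<Rightarrow> 'e::euclidean_space"
  assumes m[measurable]: "\<And>k. h k \<in> borel_measurable M"
    and p: "1 < p"
    and h: "\<And>k. (\<integral>\<^sup>+x. ennreal (norm (h k x) powr p) \<partial>M) < \<infinity>"
    and bdd: "\<And>G. G \<in> borel_measurable M \<Longrightarrow> (\<integral>\<^sup>+x. ennreal (norm (G x) powr (p / (p - 1))) \<partial>M) < \<infinity> \<Longrightarrow>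
       Bseq (\<lambda>k. \<integral>x. G x \<bullet> h k x \<partial>M)"
  obtains C where "\<And>k. (\<integral>\<^sup>+x. ennreal (norm (h k x) powr p) \<partial>M) \<le> ennreal C"
proof (rule ccontr)
  assume "\<not> thesis"
  with that have unb: "\<exists>k. ennreal C < (\<integral>\<^sup>+x. ennreal (norm (h k x) powr p) \<partial>M)" for C
    by (meson not_le)
  define q where "q = p / (p - 1)"
  have q: "1 < q" "(p - 1) * q = p" using p by (auto simp: q_def field_simps)
  define N where "N k = enn2real (\<integral>\<^sup>+x. ennreal (norm (h k x) powr p) \<partial>M) powr (1 / p)" for k
  have Np: "(\<integral>\<^sup>+x. ennreal (norm (h k x) powr p) \<partial>M) = ennreal (N k powr p)" for k
    using h[of k] p by (simp add: N_def powr_powr less_top)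
  \<comment> \<open>Growth 6^j against the weights 3^-j leaves 2^j, which no constant C can
    dominate.\<close>
  have "\<exists>k. 6 ^ j < N k" for j :: nat
  proof -
    obtain k where "ennreal ((6 ^ j) powr p) < ennreal (N k powr p)"
      using unb[of "(6 ^ j) powr p"] Np by auto
    then have "(6 ^ j) powr p < N k powr p" by (simp add: ennreal_less_iff)
    moreover have "N k powr p \<le> (6 ^ j) powr p" if "N k \<le> 6 ^ j"
      by (rule powr_mono2) (use p that in \<open>simp_all add: N_def\<close>)
    ultimately show ?thesis by (meson not_le)
  qed
  then obtain \<kappa> where \<kappa>: "\<And>j. 6 ^ j < N (\<kappa> j)" by metis
  have Npos: "0 < N (\<kappa> j)" for j using \<kappa>[of j] by (meson less_trans zero_less_numeral zero_less_power)
  \<comment> \<open>The extremal partner of \<open>h (\<kappa> j)\<close> in Hoelder's inequality: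
    its L^q norm is 1 and its pairing with \<open>h (\<kappa> j)\<close> is the full norm
    \<open>N (\<kappa> j)\<close>.\<close>
  define g where "g j x = N (\<kappa> j) powr (1 - p) *\<^sub>R dual_vec p (h (\<kappa> j) x)" for j x
  have [measurable]: "g j \<in> borel_measurable M" for j unfolding g_def by measurable
  have gq: "(\<integral>\<^sup>+x. ennreal (norm (g j x) powr q) \<partial>M) = 1" for j
  proof -
    have "norm (g j x) powr q = N (\<kappa> j) powr (- p) * norm (h (\<kappa> j) x) powr p" for x
    proof -
      have "(1 - p) * q = - p" using q by (simp add: algebra_simps)
      moreover have "norm (g j x) powr q = N (\<kappa> j) powr ((1 - p) * q) * norm (h (\<kappa> j) x) powr ((p - 1) * q)"
        unfolding g_def norm_scaleR norm_dual_vec by (simp add: powr_mult powr_powr)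
      ultimately show ?thesis by (simp only: q(2))
    qed
    then have "(\<integral>\<^sup>+x. ennreal (norm (g j x) powr q) \<partial>M) = ennreal (N (\<kappa> j) powr (- p)) * ennreal (N (\<kappa> j) powr p)"
      by (simp add: ennreal_mult nn_integral_cmult Np)
    also have "\<dots> = 1" using Npos[of j] by (simp flip: ennreal_mult powr_add)
    finally show ?thesis .
  qed
  have hol: "(\<integral>\<^sup>+x. ennreal (norm (g i x) * norm (h k x)) \<partial>M) \<le> ennreal (N k)" for i k
  proof -
    have N0: "0 \<le> N k" by (simp add: N_def)
    have "(\<integral>\<^sup>+x. ennreal \<bar>norm (g i x) * norm (h k x)\<bar> \<partial>M) \<le> ennreal (1 powr ((p - 1) / p) * (N k powr p) powr (1 / p))"
      by (rule Hoelder_inequality[OF _ _ p]) (use gq[of i] Np[of k] in \<open>simp_all add: q_def\<close>)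
    moreover have "1 powr ((p - 1) / p) * (N k powr p) powr (1 / p) = N k"
      unfolding powr_powr using p N0 by simp
    ultimately show ?thesis by simp
  qed
  have gint: "integrable M (\<lambda>x. g i x \<bullet> h k x)" for i k
    by (rule integrable_inner_Lp(1)[OF _ _ p]) (use gq[of i] h in \<open>auto simp: q_def\<close>)
  have gh: "(\<integral>x. g j x \<bullet> h (\<kappa> j) x \<partial>M) = N (\<kappa> j)" for j
  proof -
    have "(\<integral>x. g j x \<bullet> h (\<kappa> j) x \<partial>M) = (\<integral>x. N (\<kappa> j) powr (1 - p) * norm (h (\<kappa> j) x) powr p \<partial>M)"
      by (simp add: g_def dual_vec_inner)
    also have "\<dots> = N (\<kappa> j) powr (1 - p) * N (\<kappa> j) powr p"
      by (simp add: integral_eq_nn_integral Np)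
    also have "\<dots> = N (\<kappa> j)" using Npos[of j] by (simp flip: powr_add)
    finally show ?thesis .
  qed
  define S where "S = rec_nat (\<lambda>x. 0) (\<lambda>j s. if (1/3) ^ j * N (\<kappa> j) \<le> \<bar>\<integral>x. (s x + (1/3) ^ j *\<^sub>R g j x) \<bullet> h (\<kappa> j) x \<partial>M\<bar>
      then (\<lambda>x. s x + (1/3) ^ j *\<^sub>R g j x) else (\<lambda>x. s x - (1/3) ^ j *\<^sub>R g j x))"
  have S0: "S 0 = (\<lambda>x. 0)" by (simp add: S_def)
  have SS: "S (Suc j) = (if (1/3) ^ j * N (\<kappa> j) \<le> \<bar>\<integral>x. (S j x + (1/3) ^ j *\<^sub>R g j x) \<bullet> h (\<kappa> j) x \<partial>M\<bar>
      then (\<lambda>x. S j x + (1/3) ^ j *\<^sub>R g j x) else (\<lambda>x. S j x - (1/3) ^ j *\<^sub>R g j x))" for j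
    by (simp add: S_def)
  have Sm[measurable]: "S j \<in> borel_measurable M" for j
    by (induction j) (auto simp: S0 SS)
  have Sint: "integrable M (\<lambda>x. S j x \<bullet> h k x)" for j k
    by (induction j) (auto simp: S0 SS inner_add_left inner_diff_left gint)
  \<comment> \<open>If |a + b| < |b|, then |a - b| >= 2|b| - |a + b| > |b|, so one of the two signs
    always works; here b = 3^-j \<open>N (\<kappa> j)\<close> and a is the pairing of the earlier
    partial sum.\<close>
  have Sbig: "(1/3) ^ j * N (\<kappa> j) \<le> \<bar>\<integral>x. S (Suc j) x \<bullet> h (\<kappa> j) x \<partial>M\<bar>" for j
    using Npos[of j] by (auto simp: SS inner_add_left inner_diff_left Sint gint gh)
  define T where "T j x = S (Suc j) x - S j x" for j x
  have Tn: "norm (T j x) = (1/3) ^ j * norm (g j x)" for j x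
    by (simp add: T_def SS)
  have ST: "S j x = (\<Sum>i<j. T i x)" for j x
    by (simp add: T_def sum_lessThan_telescope[where f="\<lambda>i. S i x"] S0)
  \<comment> \<open>Each weight is split as 3^-i = 2^-i (2/3)^i. The factor (2/3)^i goes into Z,
    which then has finite integral, and 2^-i stays outside to make the series summable at every
    point where Z is finite. So z = Z^(1/q) is a pointwise majorant lying in L^q.\<close>
  define r where "r = (2/3) powr q"
  have r: "0 < r" "r < 1" using q powr_less_mono2[of q "2/3" 1] by (auto simp: r_def)
  define Z where "Z x = (\<Sum>i. ennreal (r ^ i) * ennreal (norm (g i x) powr q))" for x
  have [measurable]: "Z \<in> borel_measurable M" unfolding Z_def by measurable
  have Zint: "(\<integral>\<^sup>+x. Z x \<partial>M) < \<infinity>"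
  proof -
    have "(\<integral>\<^sup>+x. Z x \<partial>M) = (\<Sum>i. ennreal (r ^ i))"
      unfolding Z_def by (simp add: nn_integral_suminf nn_integral_cmult gq)
    also have "\<dots> = ennreal (\<Sum>i. r ^ i)" using r by (intro suminf_ennreal2) auto
    finally show ?thesis by simp
  qed
  have Zfin: "AE x in M. Z x < \<infinity>"
    using nn_integral_PInf_AE[of Z M] Zint by (auto simp: less_top)
  define z where "z x = enn2real (Z x) powr (1 / q)" for x
  have Tz: "norm (T i x) \<le> (1/2) ^ i * z x" if "Z x < \<infinity>" for i x
  proof -
    have "ennreal (r ^ i) * ennreal (norm (g i x) powr q) \<le> Z x"
      unfolding Z_def using sum_le_suminf[of "\<lambda>i. ennreal (r ^ i) * ennreal (norm (g i x) powr q)" "{i}"] by simp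
    also have "\<dots> = ennreal (enn2real (Z x))" using that by (simp add: less_top)
    finally have "r ^ i * norm (g i x) powr q \<le> enn2real (Z x)"
      using r by (simp flip: ennreal_mult)
    then have "(r ^ i * norm (g i x) powr q) powr (1 / q) \<le> z x"
      unfolding z_def using q r by (intro powr_mono2) auto
    moreover have "(r ^ i * norm (g i x) powr q) powr (1 / q) = (2/3) ^ i * norm (g i x)"
    proof -
      have "r ^ i = ((2/3) ^ i) powr q"
        unfolding r_def by (simp add: powr_powr mult.commute flip: powr_realpow)
      then show ?thesis using q by (simp add: powr_mult powr_powr)
    qed
    ultimately have "(1/2) ^ i * ((2/3) ^ i * norm (g i x)) \<le> (1/2) ^ i * z x" by simp
    then show ?thesis by (simp add: Tn power_mult_distrib[symmetric] mult.assoc[symmetric])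
  qed
  have Tsum: "summable (\<lambda>i. norm (T i x))" if "Z x < \<infinity>" for x
    by (rule summable_comparison_test'[of "\<lambda>i. (1/2) ^ i * z x" 0]) (use Tz[OF that] in \<open>auto intro!: summable_mult2\<close>)
  \<comment> \<open>As a pointwise \<open>lim\<close> of measurable functions G is measurable on the
    whole space; its value matters only where Z is finite, that is, almost everywhere.\<close>
  define G where "G x = lim (\<lambda>j. S j x)" for x
  have [measurable]: "G \<in> borel_measurable M" unfolding G_def by measurable
  have Gs: "G x = (\<Sum>i. T i x)" if "Z x < \<infinity>" for x
    using summable_LIMSEQ[OF summable_norm_cancel[OF Tsum[OF that]]] unfolding G_def ST by (rule limI)
  have Gz: "norm (G x) \<le> 2 * z x" if "Z x < \<infinity>" for x
  proof -
    have "norm (G x) \<le> (\<Sum>i. norm (T i x))" unfolding Gs[OF that] by (rule summable_norm[OF Tsum[OF that]])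
    also have "\<dots> \<le> (\<Sum>i. (1/2) ^ i * z x)"
      by (rule suminf_le) (use Tz[OF that] Tsum[OF that] in \<open>auto intro!: summable_mult2\<close>)
    also have "\<dots> = 2 * z x" by (subst suminf_mult2[symmetric]) (auto simp: suminf_geometric)
    finally show ?thesis .
  qed
  have Gfin: "(\<integral>\<^sup>+x. ennreal (norm (G x) powr q) \<partial>M) < \<infinity>"
  proof -
    have "(\<integral>\<^sup>+x. ennreal (norm (G x) powr q) \<partial>M) \<le> (\<integral>\<^sup>+x. ennreal (2 powr q) * Z x \<partial>M)"
      using Zfin
    proof (intro nn_integral_mono_AE, eventually_elim)
      case (elim x)
      then have fx: "Z x < \<infinity>" by simp
      have "norm (G x) powr q \<le> (2 * z x) powr q" using Gz[OF fx] q by (intro powr_mono2) auto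
      also have "\<dots> = 2 powr q * enn2real (Z x)" using q by (simp add: powr_mult z_def powr_powr)
      finally have "ennreal (norm (G x) powr q) \<le> ennreal (2 powr q) * ennreal (enn2real (Z x))"
        by (simp flip: ennreal_mult add: ennreal_leI)
      then show ?case using fx by (simp add: less_top)
    qed
    also have "\<dots> < \<infinity>" using Zint by (simp add: nn_integral_cmult ennreal_mult_less_top)
    finally show ?thesis .
  qed
  have Gint: "integrable M (\<lambda>x. G x \<bullet> h k x)" for k
    by (rule integrable_inner_Lp(1)[OF _ _ p]) (use Gfin h in \<open>auto simp: q_def\<close>)
  obtain C where C: "\<And>k. \<bar>\<integral>x. G x \<bullet> h k x \<partial>M\<bar> \<le> C"
    using bdd[of G] Gfin unfolding q_def Bseq_def by auto
  have "2 ^ j / 2 \<le> C" for j :: nat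
  proof -
    let ?R = "\<lambda>x. \<Sum>i. ennreal ((1/3) ^ (i + Suc j)) * ennreal (norm (g (i + Suc j) x) * norm (h (\<kappa> j) x))"
    have "(\<integral>\<^sup>+x. ennreal (norm (G x \<bullet> h (\<kappa> j) x - S (Suc j) x \<bullet> h (\<kappa> j) x)) \<partial>M) \<le> (\<integral>\<^sup>+x. ?R x \<partial>M)"
      using Zfin
    proof (intro nn_integral_mono_AE, eventually_elim)
      case (elim x)
      then have fx: "Z x < \<infinity>" by simp
      have su: "summable (\<lambda>i. norm (T (i + Suc j) x))"
        using Tsum[OF fx] by (subst summable_iff_shift)
      have "norm (G x - S (Suc j) x) = norm (\<Sum>i. T (i + Suc j) x)"
        unfolding Gs[OF fx] ST
        by (subst suminf_split_initial_segment[OF summable_norm_cancel[OF Tsum[OF fx]], of "Suc j"]) simp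
      also have "\<dots> \<le> (\<Sum>i. norm (T (i + Suc j) x))" by (rule summable_norm[OF su])
      finally have "norm (G x - S (Suc j) x) * norm (h (\<kappa> j) x) \<le> (\<Sum>i. norm (T (i + Suc j) x)) * norm (h (\<kappa> j) x)"
        by (rule mult_right_mono) simp
      also have "\<dots> = (\<Sum>i. norm (T (i + Suc j) x) * norm (h (\<kappa> j) x))"
        by (rule suminf_mult2[OF su])
      finally have "norm (G x \<bullet> h (\<kappa> j) x - S (Suc j) x \<bullet> h (\<kappa> j) x) \<le> (\<Sum>i. norm (T (i + Suc j) x) * norm (h (\<kappa> j) x))"
        using Cauchy_Schwarz_ineq2[of "G x - S (Suc j) x" "h (\<kappa> j) x"] by (simp add: inner_diff_left)
      then have "ennreal (norm (G x \<bullet> h (\<kappa> j) x - S (Suc j) x \<bullet> h (\<kappa> j) x)) \<le> ennreal (\<Sum>i. norm (T (i + Suc j) x) * norm (h (\<kappa> j) x))"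
        by (rule ennreal_leI)
      also have "\<dots> = (\<Sum>i. ennreal (norm (T (i + Suc j) x) * norm (h (\<kappa> j) x)))"
        by (rule suminf_ennreal2[symmetric]) (use su in \<open>auto intro!: summable_mult2\<close>)
      also have "\<dots> = ?R x" by (intro suminf_cong) (simp only: Tn mult.assoc, rule ennreal_mult, auto)
      finally show ?case .
    qed
    also have "\<dots> = (\<Sum>i. ennreal ((1/3) ^ (i + Suc j)) * (\<integral>\<^sup>+x. ennreal (norm (g (i + Suc j) x) * norm (h (\<kappa> j) x)) \<partial>M))"
      by (simp add: nn_integral_suminf nn_integral_cmult)
    also have "\<dots> \<le> (\<Sum>i. ennreal ((1/3) ^ (i + Suc j)) * ennreal (N (\<kappa> j)))"
      by (intro suminf_le mult_left_mono hol) auto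
    also have "\<dots> = (\<Sum>i. ennreal ((1/3) ^ i * ((1/3) ^ Suc j * N (\<kappa> j))))"
      using Npos[of j] by (intro suminf_cong) (simp add: power_add mult.assoc less_imp_le flip: ennreal_mult)
    also have "\<dots> = ennreal (\<Sum>i. (1/3) ^ i * ((1/3) ^ Suc j * N (\<kappa> j)))"
      using Npos[of j] by (intro suminf_ennreal2) (auto intro!: summable_mult2 simp: less_imp_le)
    also have "(\<Sum>i. (1/3) ^ i * ((1/3) ^ Suc j * N (\<kappa> j))) = (1/3) ^ j * N (\<kappa> j) / 2"
      by (subst suminf_mult2[symmetric]) (auto simp: suminf_geometric)
    finally have "(\<integral>\<^sup>+x. ennreal (norm (G x \<bullet> h (\<kappa> j) x - S (Suc j) x \<bullet> h (\<kappa> j) x)) \<partial>M) \<le> ennreal ((1/3) ^ j * N (\<kappa> j) / 2)" .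
    then have "(\<integral>x. norm (G x \<bullet> h (\<kappa> j) x - S (Suc j) x \<bullet> h (\<kappa> j) x) \<partial>M) \<le> (1/3) ^ j * N (\<kappa> j) / 2"
      using Npos[of j] Gint Sint by (subst (asm) nn_integral_eq_integral) (auto simp: ennreal_le_iff)
    moreover have "\<bar>\<integral>x. (G x \<bullet> h (\<kappa> j) x - S (Suc j) x \<bullet> h (\<kappa> j) x) \<partial>M\<bar> \<le> (\<integral>x. norm (G x \<bullet> h (\<kappa> j) x - S (Suc j) x \<bullet> h (\<kappa> j) x) \<partial>M)"
      using integral_norm_bound[of M "\<lambda>x. G x \<bullet> h (\<kappa> j) x - S (Suc j) x \<bullet> h (\<kappa> j) x"] by simp
    ultimately have "\<bar>(\<integral>x. G x \<bullet> h (\<kappa> j) x \<partial>M) - (\<integral>x. S (Suc j) x \<bullet> h (\<kappa> j) x \<partial>M)\<bar> \<le> (1/3) ^ j * N (\<kappa> j) / 2"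
      by (simp add: Gint Sint)
    then have "(1/3) ^ j * N (\<kappa> j) / 2 \<le> C" using Sbig[of j] C[of "\<kappa> j"] by linarith
    moreover have "(1/3) ^ j * 6 ^ j \<le> (1/3) ^ j * N (\<kappa> j)"
      using \<kappa>[of j] by (intro mult_left_mono) auto
    moreover have "(1/3) ^ j * 6 ^ j = (2::real) ^ j" by (simp flip: power_mult_distrib)
    ultimately show ?thesis by linarith
  qed
  moreover obtain j where "2 * C + 1 < 2 ^ j" using real_arch_pow[of 2 "2 * C + 1"] by auto
  ultimately show False by (smt (verit) field_sum_of_halves)
qed

section \<open>Weak-* compactness of bounded sequences of measures\<close>

text \<open>Let i be the first index where the digits differ. It contributes 3^-i, all later digits
  together at most half of that, so the sums differ by at least 3^-i / 2 >= 3^-(i+1) >= 3^-M. With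
  base 2 the tail could cancel the leading term completely.\<close>

lemma ternary_expansion_gap:
  fixes a b :: "nat \<Rightarrow> real"
  assumes a: "\<And>j. a j \<in> {0, 1}" and b: "\<And>j. b j \<in> {0, 1}"
    and j: "j < M" "a j \<noteq> b j"
  shows "(1/3) ^ M \<le> \<bar>(\<Sum>j. (1/3) ^ j * a j) - (\<Sum>j. (1/3) ^ j * b j)\<bar>"
proof -
  obtain i where i: "a i \<noteq> b i" "i \<le> j" "\<And>k. k < i \<Longrightarrow> a k = b k"
    using exists_least_iff[of "\<lambda>j. a j \<noteq> b j"] j(2) by (metis not_le_imp_less)
  define e where "e k = a k - b k" for k
  have e: "\<bar>e k\<bar> \<le> 1" for k using a[of k] b[of k] by (auto simp: e_def)
  have ei: "\<bar>e i\<bar> = 1" using i(1) a[of i] b[of i] by (auto simp: e_def)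
  have sm: "summable (\<lambda>k. (1/3) ^ k * c k)" if "\<And>k. \<bar>c k\<bar> \<le> 1" for c :: "nat \<Rightarrow> real"
    by (rule summable_comparison_test'[of "\<lambda>k. (1/3) ^ k" 0]) (use that in \<open>auto simp: abs_mult intro: mult_left_le\<close>)
  have "(\<Sum>j. (1/3) ^ j * a j) - (\<Sum>j. (1/3) ^ j * b j) = (\<Sum>j. (1/3) ^ j * e j)"
    using suminf_diff[OF sm[of a] sm[of b]] a b by (auto simp: e_def algebra_simps) (metis abs_one abs_zero insertE order.refl singletonD zero_le_one)
  also have "\<dots> = (\<Sum>k. (1/3) ^ (k + Suc i) * e (k + Suc i)) + (\<Sum>k<Suc i. (1/3) ^ k * e k)"
    by (rule suminf_split_initial_segment[OF sm[OF e]])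
  also have "(\<Sum>k<Suc i. (1/3) ^ k * e k) = (1/3) ^ i * e i"
    using i(3) by (simp add: e_def)
  finally have eq: "(\<Sum>j. (1/3) ^ j * a j) - (\<Sum>j. (1/3) ^ j * b j) = (\<Sum>k. (1/3) ^ (k + Suc i) * e (k + Suc i)) + (1/3) ^ i * e i" .
  have s1: "summable (\<lambda>k. (1/3) ^ k * ((1/3::real) ^ Suc i))" by (intro summable_mult2) simp
  have s2: "summable (\<lambda>k. \<bar>(1/3) ^ (k + Suc i) * e (k + Suc i)\<bar>)"
    by (rule summable_comparison_test'[OF s1, of 0]) (use e in \<open>simp add: abs_mult power_add mult_left_le\<close>)
  have "\<bar>\<Sum>k. (1/3) ^ (k + Suc i) * e (k + Suc i)\<bar> \<le> (\<Sum>k. \<bar>(1/3) ^ (k + Suc i) * e (k + Suc i)\<bar>)"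
    by (rule summable_rabs[OF s2])
  also have "\<dots> \<le> (\<Sum>k. (1/3) ^ k * ((1/3::real) ^ Suc i))"
    by (rule suminf_le[OF _ s2 s1]) (use e in \<open>simp add: abs_mult power_add mult_left_le\<close>)
  also have "\<dots> = (1/3) ^ i / 2"
    by (subst suminf_mult2[symmetric]) (auto simp: suminf_geometric)
  finally have tail: "\<bar>\<Sum>k. (1/3) ^ (k + Suc i) * e (k + Suc i)\<bar> \<le> (1/3) ^ i / 2" .
  have "(1/3) ^ i / 2 \<le> \<bar>(\<Sum>j. (1/3) ^ j * a j) - (\<Sum>j. (1/3) ^ j * b j)\<bar>"
  proof -
    have "\<bar>(1/3) ^ i * e i\<bar> = (1/3) ^ i" using ei by (simp add: abs_mult)
    then show ?thesis unfolding eq using tail by linarith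
  qed
  moreover have "(1/3::real) ^ M \<le> (1/3) ^ Suc i"
    using i(2) j(1) by (intro power_decreasing) auto
  moreover have "0 \<le> (1/3::real) ^ i" "(1/3::real) ^ Suc i = (1/3) ^ i / 3" by simp_all
  ultimately show ?thesis by linarith
qed

text \<open>
  The memberships of a point in a countable family of balls are stored as ternary digits. This
  reduces weak-* compactness on a compact set to Helly's selection theorem on the real line.
\<close>

lemma borel_encoding:
  fixes K :: "'a::euclidean_space set"
  assumes "compact K"
  obtains g :: "'a \<Rightarrow> real" where "g \<in> borel_measurable borel" "\<And>x. 0 \<le> g x" "\<And>x. g x \<le> 2"
    "\<And>e. 0 < e \<Longrightarrow> \<exists>d>0. \<forall>x\<in>K. \<forall>y\<in>K. \<bar>g x - g y\<bar> < d \<longrightarrow> dist x y < e"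
proof -
  obtain D :: "'a set" where D: "countable D" "\<And>X. open X \<Longrightarrow> X \<noteq> {} \<Longrightarrow> \<exists>d\<in>D. d \<in> X"
    by (rule countable_dense_setE) blast
  have "D \<noteq> {}" using D(2)[of UNIV] by auto
  define c where "c = from_nat_into D"
  have c: "\<exists>i. dist (c i) x < e" if "0 < e" for x e
    using D(2)[of "ball x e"] that from_nat_into_surj[OF D(1)] by (fastforce simp: c_def dist_commute)
  \<comment> \<open>The index j codes a pair: the number of a centre in the dense sequence and an m
    giving the radius 1/(m+1).\<close>
  define A where "A j = ball (c (fst (prod_decode j))) (1 / Suc (snd (prod_decode j)))" for j
  define g where "g x = (\<Sum>j. (1/3) ^ j * indicator (A j) x :: real)" for x
  have [measurable]: "A j \<in> sets borel" for j by (simp add: A_def)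
  have sm: "summable (\<lambda>j. (1/3) ^ j * indicator (A j) x :: real)" for x
    by (rule summable_comparison_test'[of "\<lambda>k. (1/3) ^ k" 0]) (auto simp: indicator_def)
  show thesis
  proof
    show "g \<in> borel_measurable borel" unfolding g_def by measurable
    show "0 \<le> g x" for x unfolding g_def by (intro suminf_nonneg sm) auto
    have "g x \<le> (\<Sum>j. (1/3) ^ j)" for x
      unfolding g_def by (intro suminf_le sm) (auto simp: indicator_def)
    then have "g x \<le> 3 / 2" for x by (simp add: suminf_geometric)
    then show "g x \<le> 2" for x by (rule order_trans) simp
    fix e :: real
    assume "0 < e"
    then obtain m :: nat where m: "1 / Suc m < e / 2"
      using reals_Archimedean[of "e / 2"] by (auto simp: inverse_eq_divide)
    have "K \<subseteq> (\<Union>i. ball (c i) (1 / Suc m))"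
      using c[of "1 / Suc m"] by (auto simp: mem_ball)
    then obtain I where I: "finite I" "K \<subseteq> (\<Union>i\<in>I. ball (c i) (1 / Suc m))"
      using compactE_image[OF assms, of UNIV "\<lambda>i. ball (c i) (1 / Suc m)"] by auto
    \<comment> \<open>M exceeds the indices of all balls in the finite cover. Codes closer than 3^-M
      agree in the digits below M, so both points lie in a common covering ball, of radius less than
      e/2. The inserted 0 keeps \<open>Max\<close> defined for an empty cover.\<close>
    define M where "M = Suc (Max (insert 0 ((\<lambda>i. prod_encode (i, m)) ` I)))"
    have M: "prod_encode (i, m) < M" if "i \<in> I" for i
      using that I(1) unfolding M_def by (simp add: less_Suc_eq_le)
    show "\<exists>d>0. \<forall>x\<in>K. \<forall>y\<in>K. \<bar>g x - g y\<bar> < d \<longrightarrow> dist x y < e"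
    proof (intro exI[of _ "(1/3) ^ M"] conjI ballI impI)
      fix x y
      assume x: "x \<in> K" and y: "y \<in> K" and d: "\<bar>g x - g y\<bar> < (1/3) ^ M"
      obtain i where i: "i \<in> I" "x \<in> ball (c i) (1 / Suc m)" using I(2) x by auto
      let ?j = "prod_encode (i, m)"
      have "indicator (A ?j) x = (indicator (A ?j) y :: real)"
        using ternary_expansion_gap[of "\<lambda>j. indicator (A j) x" "\<lambda>j. indicator (A j) y", OF _ _ M[OF i(1)]] d
        unfolding g_def by (force simp: indicator_def)
      then have "y \<in> ball (c i) (1 / Suc m)"
        using i(2) by (auto simp: A_def indicator_def split: if_splits)
      with i(2) have "dist x y < 1 / Suc m + 1 / Suc m"
        by (metis dist_triangle_less_add mem_ball dist_commute)
      then show "dist x y < e" using m by linarith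
    qed simp
  qed
qed

text \<open>The measures are pushed to the real line by the encoding, Helly's theorem is applied
  there, and the limit is pulled back. The encoding is merely Borel, but test functions are
  transported by its inverse on the image of K, and that inverse is uniformly continuous.\<close>

lemma prob_compact_convergent_subsequence:
  fixes M :: "nat \<Rightarrow> 'a::euclidean_space measure"
  assumes K: "compact K" and M: "\<And>k. prob_space (M k)" and sets_M: "\<And>k. sets (M k) = sets borel"
    and supp: "\<And>k. AE x in M k. x \<in> K"
  obtains r P where "strict_mono (r :: nat \<Rightarrow> nat)" "prob_space P" "sets P = sets borel"
    "\<And>f :: 'a \<Rightarrow> real. continuous_on UNIV f \<Longrightarrow> (\<lambda>k. \<integral>x. f x \<partial>M (r k)) \<longlonglongrightarrow> (\<integral>x. f x \<partial>P)"
proof -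
  obtain g :: "'a \<Rightarrow> real" where g[measurable]: "g \<in> borel_measurable borel" and g0: "\<And>x. 0 \<le> g x" and g2: "\<And>x. g x \<le> 2"
    and gap: "\<And>e. 0 < e \<Longrightarrow> \<exists>d>0. \<forall>x\<in>K. \<forall>y\<in>K. \<bar>g x - g y\<bar> < d \<longrightarrow> dist x y < e"
    using borel_encoding[OF K] by metis
  have gM[measurable]: "g \<in> borel_measurable (M k)" for k
    using g sets_M[of k] measurable_cong_sets by blast
  define D where "D k = distr (M k) borel g" for k
  have D: "real_distribution (D k)" for k
    unfolding D_def by (rule prob_space.real_distribution_distr[OF M]) measurable
  have tight: "tight D"
    unfolding tight_def
  proof (intro conjI allI impI D)
    fix \<epsilon> :: real assume "0 < \<epsilon>"
    have "measure (D k) {-1<..3} = 1" for k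
    proof -
      have "g -` {-1<..3} \<inter> space (M k) = space (M k)"
        using less_le_trans[OF _ g0, of "-1"] order_trans[OF g2, of 3] by auto
      then show ?thesis unfolding D_def using prob_space.prob_space[OF M[of k]]
        by (subst measure_distr) auto
    qed
    then show "\<exists>a b. a < b \<and> (\<forall>k. 1 - \<epsilon> < measure (D k) {a<..b})"
      using \<open>0 < \<epsilon>\<close> by (intro exI[of _ "-1"] exI[of _ 3]) auto
  qed
  obtain r N where r: "strict_mono r" and N: "real_distribution N" and conv: "weak_conv_m (D \<circ> id \<circ> r) N"
    using tight_imp_convergent_subsubsequence[OF tight, of id] by (auto simp: strict_mono_def)
  interpret N: real_distribution N by (rule N)
  have conv_int: "(\<lambda>k. \<integral>t. F t \<partial>D (r k)) \<longlonglongrightarrow> (\<integral>t. F t \<partial>N)"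
    if "continuous_on UNIV F" "\<And>t. norm (F t) \<le> B" for F :: "real \<Rightarrow> real" and B
  proof -
    have "(\<lambda>k. \<integral>t. F t \<partial>((D \<circ> id \<circ> r) k)) \<longlonglongrightarrow> (\<integral>t. F t \<partial>N)"
      by (rule weak_conv_imp_integral_bdd_continuous_conv[OF _ N conv _ that(2)])
        (use D that(1) in \<open>auto simp: continuous_on_eq_continuous_at\<close>)
    then show ?thesis by simp
  qed
  have inj: "inj_on g K"
  proof (rule inj_onI, rule ccontr)
    fix x y assume *: "x \<in> K" "y \<in> K" "g x = g y" "x \<noteq> y"
    then show False using gap[of "dist x y"] by force
  qed
  define X where "X = g ` K"
  \<comment> \<open>This is the gap property of the encoding read backwards. It also lets the
    inverse extend continuously to the closure of X, which may carry part of the limit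
    measure.\<close>
  have "uniformly_continuous_on X (inv_into K g)"
    unfolding uniformly_continuous_on_def X_def
  proof (intro allI impI)
    fix e :: real assume "0 < e"
    then obtain d where d: "0 < d" "\<And>x y. x \<in> K \<Longrightarrow> y \<in> K \<Longrightarrow> \<bar>g x - g y\<bar> < d \<Longrightarrow> dist x y < e"
      using gap by metis
    then show "\<exists>d>0. \<forall>x\<in>g ` K. \<forall>x'\<in>g ` K. dist x' x < d \<longrightarrow> dist (inv_into K g x') (inv_into K g x) < e"
      using inj by (intro exI[of _ d]) (auto simp: dist_real_def)
  qed
  then obtain h1 where h1: "uniformly_continuous_on (closure X) h1" "\<And>x. x \<in> X \<Longrightarrow> inv_into K g x = h1 x"
    by (rule uniformly_continuous_on_extension_on_closure) blast
  have h1c: "continuous_on (closure X) h1" using h1(1) by (rule uniformly_continuous_imp_continuous)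
  have h1g: "h1 (g x) = x" if "x \<in> K" for x
    using h1(2)[of "g x"] that inj by (simp add: X_def)
  have h1K: "h1 t \<in> K" if "t \<in> closure X" for t
  proof -
    have "h1 ` closure X \<subseteq> closure (h1 ` X)" by (rule image_closure_subset[OF h1c]) (auto simp: closure_subset)
    moreover have "h1 ` X \<subseteq> K" using h1g by (auto simp: X_def)
    ultimately show ?thesis using K that compact_imp_closed closure_minimal by blast
  qed
  define h where "h t = indicator (closure X) t *\<^sub>R h1 t" for t
  have [measurable]: "h \<in> borel_measurable borel"
    unfolding h_def by (rule borel_measurable_continuous_on_indicator[OF _ h1c]) auto
  have hN[measurable]: "h \<in> borel_measurable N"
    by (subst measurable_cong_sets[of _ borel]) auto
  have inX: "AE t in D k. t \<in> closure X" for k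
    unfolding D_def by (subst AE_distr_iff) (use supp[of k] closure_subset[of X] in \<open>auto simp: X_def elim!: eventually_mono\<close>)
  have NX: "AE t in N. t \<in> closure X"
  \<comment> \<open>The truncated distance to the closure of X has integral 0 under every
    \<open>D k\<close>, hence under the limit. For empty X that distance is 0 by convention and says
    nothing; this case contradicts total mass 1.\<close>
  proof (cases "X = {}")
    case True
    then have "AE x in M 0. False" using supp[of 0] by (simp add: X_def)
    then show ?thesis using prob_space.AE_False[OF M[of 0]] by simp
  next
    case False
    define F where "F t = min 1 (infdist t (closure X))" for t
    have cF: "continuous_on UNIV F" unfolding F_def by (intro continuous_intros)
    have [measurable]: "F \<in> borel_measurable borel" using cF by (rule borel_measurable_continuous_onI)
    have "(\<integral>t. F t \<partial>D k) = 0" for k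
    proof -
      have "AE t in D k. F t = 0" using inX[of k] by eventually_elim (auto simp: F_def)
      then show ?thesis by (rule integral_eq_zero_AE)
    qed
    then have "(\<integral>t. F t \<partial>N) = 0"
      using conv_int[OF cF, of 1] LIMSEQ_unique[of "\<lambda>k. 0::real" 0] by (auto simp: F_def infdist_nonneg)
    moreover have "integrable N F"
      by (rule N.integrable_const_bound[of _ 1]) (auto simp: F_def infdist_nonneg)
    ultimately have "AE t in N. F t = 0"
      by (subst (asm) integral_nonneg_eq_0_iff_AE) (auto simp: F_def infdist_nonneg)
    then show ?thesis
    proof eventually_elim
      case (elim t)
      then have "infdist t (closure X) = 0" by (auto simp: F_def min_def split: if_splits)
      then show ?case using False in_closure_iff_infdist_zero[of "closure X" t] by simp
    qed
  qed
  show thesis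
  proof
    show "strict_mono r" by (rule r)
    show "prob_space (distr N borel h)" by (rule N.prob_space_distr) measurable
    show "sets (distr N borel h) = sets borel" by simp
    fix f :: "'a \<Rightarrow> real"
    assume f: "continuous_on UNIV f"
    have [measurable]: "f \<in> borel_measurable borel" using f by (rule borel_measurable_continuous_onI)
    have "bounded (f ` K)"
      using K f by (intro compact_imp_bounded compact_continuous_image continuous_on_subset[OF f]) auto
    then obtain B where B: "0 < B" "\<And>x. x \<in> K \<Longrightarrow> norm (f x) \<le> B" by (auto simp: bounded_pos)
    have "continuous_on (closure X) (f \<circ> h1)"
      using h1c f by (intro continuous_on_compose) (auto intro: continuous_on_subset)
    \<comment> \<open>Tietze's theorem turns the transported test function, defined only on the
      closure of X, into a bounded continuous function on the line, as weak convergence there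
      requires.\<close>
    then obtain F where F: "continuous_on UNIV F" "\<And>t. t \<in> closure X \<Longrightarrow> F t = f (h1 t)" "\<And>t. norm (F t) \<le> B"
      by (rule Tietze[of "closure X" "f \<circ> h1" UNIV B]) (use B h1K in auto)
    have [measurable]: "F \<in> borel_measurable borel" using F(1) by (rule borel_measurable_continuous_onI)
    have "(\<integral>x. f x \<partial>M k) = (\<integral>t. F t \<partial>D k)" for k
    proof -
      have "(\<integral>t. F t \<partial>D k) = (\<integral>x. F (g x) \<partial>M k)" unfolding D_def by (rule integral_distr) measurable
      also have "\<dots> = (\<integral>x. f x \<partial>M k)"
      proof (rule integral_cong_AE)
        show "AE x in M k. F (g x) = f x"
          using supp[of k] by eventually_elim (use F(2) h1g closure_subset[of X] in \<open>auto simp: X_def\<close>)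
        show "f \<in> borel_measurable (M k)" by (subst measurable_cong_sets[OF sets_M refl]) measurable
        show "(\<lambda>x. F (g x)) \<in> borel_measurable (M k)" by measurable
      qed
      finally show ?thesis by simp
    qed
    moreover have "(\<integral>x. f x \<partial>distr N borel h) = (\<integral>t. F t \<partial>N)"
    proof -
      have "(\<integral>x. f x \<partial>distr N borel h) = (\<integral>t. f (h t) \<partial>N)" by (rule integral_distr) measurable
      also have "\<dots> = (\<integral>t. F t \<partial>N)"
      proof (rule integral_cong_AE)
        show "(\<lambda>t. f (h t)) \<in> borel_measurable N" by measurable
        show "AE t in N. f (h t) = F t" using NX by eventually_elim (simp add: F(2) h_def)
      qed measurable
      finally show ?thesis .
    qed
    ultimately show "(\<lambda>k. \<integral>x. f x \<partial>M (r k)) \<longlonglongrightarrow> (\<integral>x. f x \<partial>distr N borel h)"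
      using conv_int[OF F(1) F(3)] by simp
  qed
qed

text \<open>Inside the ball this is f composed with the inverse of x -> x/(1+|x|). When y approaches
  the unit sphere from inside, the argument of f runs to infinity, where f tends to 0, and 0 is the
  value on and outside the sphere.\<close>

lemma continuous_on_compactification:
  fixes f :: "'a::euclidean_space \<Rightarrow> real"
  assumes f: "continuous_on UNIV f" and lim: "(f \<longlongrightarrow> 0) at_infinity"
  shows "continuous_on UNIV (\<lambda>y. if norm y < 1 then f (y /\<^sub>R (1 - norm y)) else 0)" (is "continuous_on _ ?F")
  unfolding continuous_on_eq_continuous_at[OF open_UNIV]
proof
  fix y :: 'a
  show "isCont ?F y"
  proof (cases "norm y < 1")
    case True
    have c: "isCont (\<lambda>y. f (y /\<^sub>R (1 - norm y))) y"
      by (rule isCont_o2[where f="\<lambda>y. y /\<^sub>R (1 - norm y)" and g=f])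
        (use True f in \<open>auto intro!: continuous_intros simp: continuous_on_eq_continuous_at\<close>)
    have "\<forall>\<^sub>F z in nhds y. z \<in> ball 0 1"
      using True by (intro eventually_nhds_in_open) auto
    then have "\<forall>\<^sub>F z in nhds y. ?F z = f (z /\<^sub>R (1 - norm z))"
      by (auto elim!: eventually_mono)
    from isCont_cong[OF this] c show ?thesis by simp
  next
    case False
    have "(?F \<longlongrightarrow> 0) (at y)"
    proof (rule tendstoI)
      fix e :: real assume "0 < e"
      with lim obtain R where R: "\<And>x. R \<le> norm x \<Longrightarrow> \<bar>f x\<bar> < e"
        by (auto simp: tendsto_iff eventually_at_infinity dist_real_def)
      \<comment> \<open>The condition |z| > T/(1+T) with |z| < 1 gives |z|/(1-|z|) > T, so f is
        small there. Taking T at least 1 keeps it positive even if R is negative.\<close>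
      define T where "T = max R 1"
      have T: "0 < T" "\<And>x. T \<le> norm x \<Longrightarrow> \<bar>f x\<bar> < e" using R by (auto simp: T_def)
      have "T / (1 + T) < 1" using T(1) by simp
      then have "T / (1 + T) < norm y" using False by linarith
      then have "y \<in> {z. T / (1 + T) < norm z}" by simp
      then have "\<forall>\<^sub>F z in at y. z \<in> {z. T / (1 + T) < norm z}"
        by (intro eventually_at_in_open') (auto intro!: open_Collect_less continuous_intros)
      then show "\<forall>\<^sub>F z in at y. dist (?F z) 0 < e"
      proof eventually_elim
        case (elim z)
        have "\<bar>f (z /\<^sub>R (1 - norm z))\<bar> < e" if "norm z < 1"
        proof (rule T(2))
          have "T * (1 - norm z) \<le> norm z" using elim T by (simp add: field_simps)
          then show "T \<le> norm (z /\<^sub>R (1 - norm z))" using that by (simp add: field_simps)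
        qed
        then show ?case using \<open>0 < e\<close> by (simp add: dist_real_def)
      qed
    qed
    then show ?thesis using False by (simp add: isCont_def)
  qed
qed

lemma vanishing_at_infinity_bounded:
  fixes f :: "'a::euclidean_space \<Rightarrow> real"
  assumes f: "continuous_on UNIV f" "(f \<longlongrightarrow> 0) at_infinity"
  obtains B where "0 < B" "\<And>x. \<bar>f x\<bar> \<le> B"
proof -
  obtain R where R: "\<And>x. R \<le> norm x \<Longrightarrow> \<bar>f x\<bar> < 1"
    using tendstoD[OF f(2), of 1] by (auto simp: eventually_at_infinity dist_real_def)
  have "bounded (f ` cball 0 R)"
    by (intro compact_imp_bounded compact_continuous_image continuous_on_subset[OF f(1)]) auto
  then obtain B where B: "\<And>x. norm x \<le> R \<Longrightarrow> \<bar>f x\<bar> \<le> B" by (fastforce simp: bounded_iff)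
  have "\<bar>f x\<bar> \<le> max B 1" for x using B[of x] R[of x] by (cases "norm x \<le> R") auto
  then show thesis by (intro that[of "max B 1"]) auto
qed

text \<open>
  \<open>x \<mapsto> x / (1 + |x|)\<close> maps the space into the closed unit ball; mass that escapes to infinity ends up
  on the unit sphere, where the extended test functions vanish.
\<close>

lemma weak_star_compactness:
  fixes \<mu> :: "nat \<Rightarrow> 'a::euclidean_space measure"
  assumes sets_\<mu>: "\<And>k. sets (\<mu> k) = sets borel" and bdd: "\<And>k. emeasure (\<mu> k) UNIV \<le> ennreal C"
  obtains r \<omega> where "strict_mono (r :: nat \<Rightarrow> nat)" "finite_radon \<omega>" "weak_star_converges (\<lambda>k. \<mu> (r k)) \<omega>"
proof -
  have fin: "finite_measure (\<mu> k)" for k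
    by (rule finite_measureI) (use bdd[of k] sets_eq_imp_space_eq[OF sets_\<mu>[of k]] in \<open>auto simp: top_unique\<close>)
  define m where "m k = measure (\<mu> k) UNIV" for k
  have em: "emeasure (\<mu> k) UNIV = ennreal (m k)" for k
    unfolding m_def using finite_measure.emeasure_eq_measure[OF fin] by simp
  have m: "0 \<le> m k" "m k \<le> max C 0" for k
    using bdd[of k] unfolding em by (auto simp: m_def ennreal_le_iff2)
  have "bounded (range m)" using m by (auto simp: bounded_iff intro!: exI[of _ "max C 0"])
  then obtain r0 :: "nat \<Rightarrow> nat" and l where r0: "strict_mono r0" and l: "(m \<circ> r0) \<longlonglongrightarrow> l"
    using bounded_imp_convergent_subsequence by blast
  have l0: "0 \<le> l" by (rule LIMSEQ_le_const[OF l]) (use m in auto)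
  have meas: "f \<in> borel_measurable (\<mu> k)" if "continuous_on UNIV f" for f :: "'a \<Rightarrow> real" and k
    using borel_measurable_continuous_onI[OF that] by (subst measurable_cong_sets[OF sets_\<mu> refl])
  show thesis
  \<comment> \<open>Masses that tend to 0 cannot be normalised to probability measures; in that case
    the null measure is the limit.\<close>
  proof (cases "l = 0")
    case True
    have "weak_star_converges (\<lambda>k. \<mu> (r0 k)) (null_measure borel)"
      unfolding weak_star_converges_def
    proof (intro allI impI)
      fix f :: "'a \<Rightarrow> real"
      assume f: "continuous_on UNIV f \<and> (f \<longlongrightarrow> 0) at_infinity"
      then obtain B where B: "0 < B" "\<And>x. \<bar>f x\<bar> \<le> B" using vanishing_at_infinity_bounded by metis
      have "norm (\<integral>x. f x \<partial>\<mu> k) \<le> B * m k" for k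
      proof -
        have "norm (\<integral>x. f x \<partial>\<mu> k) \<le> (\<integral>x. norm (f x) \<partial>\<mu> k)" by (rule integral_norm_bound)
        also have "\<dots> \<le> (\<integral>x. B \<partial>\<mu> k)"
          by (intro integral_mono finite_measure.integrable_const_bound[OF fin, of _ B])
            (use B f meas in \<open>auto intro!: finite_measure.integrable_const fin\<close>)
        also have "\<dots> = B * m k"
          using sets_eq_imp_space_eq[OF sets_\<mu>[of k]] by (simp add: m_def)
        finally show ?thesis .
      qed
      moreover have "(\<lambda>k. B * m (r0 k)) \<longlonglongrightarrow> B * 0"
        using l True by (intro tendsto_mult tendsto_const) (simp add: comp_def)
      ultimately have "(\<lambda>k. \<integral>x. f x \<partial>\<mu> (r0 k)) \<longlonglongrightarrow> 0"
        using Lim_null_comparison[of "\<lambda>k. \<integral>x. f x \<partial>\<mu> (r0 k)" "\<lambda>k. B * m (r0 k)"] by simp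
      then show "(\<lambda>k. \<integral>x. f x \<partial>\<mu> (r0 k)) \<longlonglongrightarrow> (\<integral>x. f x \<partial>null_measure borel)" by simp
    qed
    moreover have "finite_radon (null_measure borel :: 'a measure)"
      by (auto simp: finite_radon_def intro!: finite_measureI)
    ultimately show ?thesis using that r0 by blast
  next
    case False
    with l0 have lpos: "0 < l" by simp
    have "\<forall>\<^sub>F k in sequentially. 0 < (m \<circ> r0) k" by (rule order_tendstoD(1)[OF l lpos])
    then obtain k0 where k0: "\<And>k. k \<ge> k0 \<Longrightarrow> 0 < m (r0 k)" by (auto simp: eventually_sequentially)
    define n where "n k = r0 (k + k0)" for k
    have n: "strict_mono n" using r0 by (auto simp: n_def strict_mono_def)
    have mn: "0 < m (n k)" for k using k0 by (simp add: n_def)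
    have ln: "(\<lambda>k. m (n k)) \<longlonglongrightarrow> l"
      unfolding n_def using LIMSEQ_ignore_initial_segment[OF l, of k0] by (simp add: comp_def)
    define \<phi> where "\<phi> x = x /\<^sub>R (1 + norm x)" for x :: 'a
    define \<psi> where "\<psi> y = y /\<^sub>R (1 - norm y)" for y :: 'a
    have [measurable]: "\<phi> \<in> borel_measurable borel" "\<psi> \<in> borel_measurable borel"
      unfolding \<phi>_def \<psi>_def by measurable
    have pos: "0 < 1 + norm x" for x :: 'a by (smt (verit) norm_ge_zero)
    have n\<phi>: "norm (\<phi> x) = norm x / (1 + norm x)" for x
      using pos[of x] by (simp add: \<phi>_def divide_inverse mult.commute)
    have n\<phi>1: "norm (\<phi> x) < 1" for x using pos[of x] by (simp add: n\<phi>)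
    have \<psi>\<phi>: "\<psi> (\<phi> x) = x" for x
    proof -
      have "1 - norm (\<phi> x) = inverse (1 + norm x)" using pos[of x] by (simp add: n\<phi> field_simps)
      then have "\<psi> (\<phi> x) = (1 + norm x) *\<^sub>R \<phi> x" unfolding \<psi>_def by simp
      then show ?thesis using pos[of x] by (simp add: \<phi>_def)
    qed
    define N where "N k = distr (density (\<mu> (n k)) (\<lambda>_. ennreal (1 / m (n k)))) borel \<phi>" for k
    have \<phi>m[measurable]: "\<phi> \<in> measurable (\<mu> k) borel" for k by (subst measurable_cong_sets[OF sets_\<mu> refl]) measurable
    have sp: "space (\<mu> k) = UNIV" for k using sets_eq_imp_space_eq[OF sets_\<mu>[of k]] by simp
    have pN: "prob_space (N k)" for k
      unfolding N_def
    proof (rule prob_space.prob_space_distr)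
      show "prob_space (density (\<mu> (n k)) (\<lambda>_. ennreal (1 / m (n k))))"
        by (rule prob_spaceI) (use mn[of k] sp[of "n k"] sets_\<mu>[of "n k"] in \<open>simp add: emeasure_density em flip: ennreal_mult\<close>)
    qed simp
    have sN: "AE y in N k. y \<in> cball 0 1" for k
      unfolding N_def by (subst AE_distr_iff) (auto simp: n\<phi>1 less_imp_le)
    obtain r P where r: "strict_mono r" and P: "prob_space P" "sets P = sets borel"
      and conv: "\<And>f :: 'a \<Rightarrow> real. continuous_on UNIV f \<Longrightarrow> (\<lambda>k. \<integral>x. f x \<partial>N (r k)) \<longlonglongrightarrow> (\<integral>x. f x \<partial>P)"
      using prob_compact_convergent_subsequence[of "cball 0 1" N] pN sN by (auto simp: N_def)
    interpret P: prob_space P by (rule P(1))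
    note [measurable_cong] = P(2)
    \<comment> \<open>Restriction to the open ball discards the mass that escaped to the sphere, the
      factor l undoes the normalisation, and \<psi> carries the rest back to the whole
      space.\<close>
    define \<omega> where "\<omega> = distr (density P (\<lambda>y. ennreal (l * indicator (ball 0 1) y))) borel \<psi>"
    have fin_\<omega>: "finite_radon \<omega>"
      unfolding finite_radon_def
    proof
      show "sets \<omega> = sets borel" by (simp add: \<omega>_def)
      show "finite_measure \<omega>"
        unfolding \<omega>_def
      proof (rule finite_measure.finite_measure_distr)
        have "(\<integral>\<^sup>+y. ennreal (l * indicator (ball 0 1) y) \<partial>P) \<le> (\<integral>\<^sup>+y. ennreal l \<partial>P)"
          using l0 by (intro nn_integral_mono) (auto simp: indicator_def)
        also have "\<dots> < \<infinity>" by (simp add: P.emeasure_space_1)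
        finally show "finite_measure (density P (\<lambda>y. ennreal (l * indicator (ball 0 1) y)))"
          by (intro finite_measureI, subst emeasure_density) (measurable, auto simp: less_top cong: nn_integral_cong)
      qed simp
    qed
    have "weak_star_converges (\<lambda>k. \<mu> ((n \<circ> r) k)) \<omega>"
      unfolding weak_star_converges_def
    proof (intro allI impI)
      fix f :: "'a \<Rightarrow> real"
      assume f: "continuous_on UNIV f \<and> (f \<longlongrightarrow> 0) at_infinity"
      have [measurable]: "f \<in> borel_measurable borel" using f by (auto intro: borel_measurable_continuous_onI)
      have [measurable]: "f \<in> borel_measurable (\<mu> k)" for k using f meas by blast
      define F where "F y = (if norm y < 1 then f (\<psi> y) else 0)" for y
      have cF: "continuous_on UNIV F"
        unfolding F_def \<psi>_def using f by (intro continuous_on_compactification) auto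
      have [measurable]: "F \<in> borel_measurable borel" using cF by (rule borel_measurable_continuous_onI)
      have 1: "(\<integral>x. f x \<partial>\<mu> (n k)) = m (n k) * (\<integral>y. F y \<partial>N k)" for k
      proof -
        have "(\<integral>y. F y \<partial>N k) = (\<integral>x. F (\<phi> x) \<partial>density (\<mu> (n k)) (\<lambda>_. ennreal (1 / m (n k))))"
          unfolding N_def by (rule integral_distr) auto
        also have "\<dots> = (\<integral>x. (1 / m (n k)) *\<^sub>R F (\<phi> x) \<partial>\<mu> (n k))"
          by (rule integral_density) (use mn[of k] in auto)
        also have "\<dots> = 1 / m (n k) * (\<integral>x. f x \<partial>\<mu> (n k))"
          by (simp add: F_def n\<phi>1 \<psi>\<phi>)
        finally show ?thesis using mn[of k] by simp
      qed
      have 2: "(\<integral>x. f x \<partial>\<omega>) = l * (\<integral>y. F y \<partial>P)"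
      proof -
        have "(\<integral>x. f x \<partial>\<omega>) = (\<integral>y. f (\<psi> y) \<partial>density P (\<lambda>y. ennreal (l * indicator (ball 0 1) y)))"
          unfolding \<omega>_def by (rule integral_distr) auto
        also have "\<dots> = (\<integral>y. (l * indicator (ball 0 1) y) *\<^sub>R f (\<psi> y) \<partial>P)"
          by (rule integral_density) (measurable, use l0 in auto)
        also have "\<dots> = (\<integral>y. l * F y \<partial>P)"
          by (intro Bochner_Integration.integral_cong) (auto simp: F_def indicator_def)
        finally show ?thesis by simp
      qed
      have "(\<lambda>k. m (n (r k)) * (\<integral>y. F y \<partial>N (r k))) \<longlonglongrightarrow> l * (\<integral>y. F y \<partial>P)"
        using LIMSEQ_subseq_LIMSEQ[OF ln r] conv[OF cF] by (intro tendsto_mult) (auto simp: comp_def)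
      then show "(\<lambda>k. \<integral>x. f x \<partial>\<mu> ((n \<circ> r) k)) \<longlonglongrightarrow> (\<integral>x. f x \<partial>\<omega>)"
        by (simp add: 1 2)
    qed
    then show ?thesis using that[of "n \<circ> r" \<omega>] strict_mono_o[OF n r] fin_\<omega> by simp
  qed
qed

section \<open>Test functions and weak gradients\<close>

lemma Ck_Suc_imp_Ck: "Ck (Suc k) f \<Longrightarrow> Ck k f"
proof (induction k arbitrary: f)
  case 0
  then show ?case
    by (auto simp: continuous_on_eq_continuous_at differentiable_imp_continuous_within)
next
  case (Suc k)
  then show ?case unfolding Ck.simps(2)[of "Suc k" f] Ck.simps(2)[of "k" f] by blast
qed

lemma Ck_const: "Ck k (\<lambda>x. c)"
  by (induction k arbitrary: c) auto

lemma Ck_add: "Ck k f \<Longrightarrow> Ck k g \<Longrightarrow> Ck k (\<lambda>x. f x + g x)"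
proof (induction k arbitrary: f g)
  case (Suc k)
  have "frechet_derivative (\<lambda>x. f x + g x) (at x) = (\<lambda>h. frechet_derivative f (at x) h + frechet_derivative g (at x) h)" for x
    by (rule frechet_derivative_at[symmetric])
      (use Suc.prems in \<open>auto intro!: derivative_intros simp: frechet_derivative_works[symmetric]\<close>)
  then show ?case using Suc by auto
qed (auto intro: continuous_intros)

lemma Ck_mult: "Ck k f \<Longrightarrow> Ck k g \<Longrightarrow> Ck k (\<lambda>x. f x * g x)"
proof (induction k arbitrary: f g)
  case (Suc k)
  have "frechet_derivative (\<lambda>x. f x * g x) (at x) = (\<lambda>h. f x * frechet_derivative g (at x) h + frechet_derivative f (at x) h * g x)" for x
    by (rule frechet_derivative_at[symmetric])
      (use Suc.prems in \<open>auto intro!: has_derivative_mult simp: frechet_derivative_works[symmetric]\<close>)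
  then show ?case
    using Suc Ck_Suc_imp_Ck[OF Suc.prems(1)] Ck_Suc_imp_Ck[OF Suc.prems(2)] by (auto intro!: Ck_add)
qed (auto intro: continuous_intros)

lemma Ck_prod: "finite I \<Longrightarrow> (\<And>i. i \<in> I \<Longrightarrow> Ck k (f i)) \<Longrightarrow> Ck k (\<lambda>x. \<Prod>i\<in>I. f i x)"
  by (induction I rule: finite_induct) (auto intro: Ck_mult Ck_const)

text \<open>The classical function exp(-c/t), flat at 0, multiplied by t^-m. With the extra power
  the family is closed under differentiation up to linear combinations, so smoothness follows by
  induction. The parameter c is sent to 0 later, when the functions approach the indicator of t >
  0.\<close>

definition flat_exp :: "real \<Rightarrow> nat \<Rightarrow> real \<Rightarrow> real" where
  "flat_exp c m t = (if 0 < t then (1 / t) ^ m * exp (- (c / t)) else 0)"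

text \<open>With s = c/t the function is a constant multiple of s^m / exp(s), and s tends to
  infinity as t decreases to 0. From the left it vanishes identically.\<close>

lemma flat_exp_tendsto_0:
  assumes "0 < c"
  shows "((\<lambda>t. flat_exp c m t) \<longlongrightarrow> 0) (at 0)"
proof -
  have "((\<lambda>t. (c / t) ^ m / exp (c / t)) \<longlongrightarrow> 0) (at_right 0)"
    by (rule filterlim_compose[OF tendsto_power_div_exp_0])
      (use filterlim_tendsto_pos_mult_at_top[OF tendsto_const assms filterlim_inverse_at_top_right] in \<open>simp add: divide_inverse\<close>)
  then have "((\<lambda>t. (1 / c ^ m) * ((c / t) ^ m / exp (c / t))) \<longlongrightarrow> (1 / c ^ m) * 0) (at_right 0)"
    by (rule tendsto_mult_left)
  moreover have "\<forall>\<^sub>F t in at_right 0. (1 / c ^ m) * ((c / t) ^ m / exp (c / t)) = flat_exp c m t"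
    using eventually_at_right_less[of "0::real"]
    by eventually_elim (use assms in \<open>simp add: flat_exp_def power_divide exp_minus divide_inverse power_mult_distrib\<close>)
  ultimately have 1: "((\<lambda>t. flat_exp c m t) \<longlongrightarrow> 0) (at_right 0)"
    using Lim_transform_eventually by fastforce
  have "\<forall>\<^sub>F t in at_left 0. 0 = flat_exp c m t"
    using eventually_at_left_real[of "-1" "0::real"] by (auto elim!: eventually_mono simp: flat_exp_def)
  then have 2: "((\<lambda>t. flat_exp c m t) \<longlongrightarrow> 0) (at_left 0)"
    using Lim_transform_eventually[OF tendsto_const] by blast
  show ?thesis using 1 2 by (simp add: filterlim_split_at)
qed

lemma flat_exp_has_derivative:
  assumes "0 < c"
  shows "(flat_exp c m has_real_derivative (c * flat_exp c (m + 2) t - m * flat_exp c (m + 1) t)) (at t)"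
proof -
  consider "t < 0" | "t = 0" | "0 < t" by linarith
  then show ?thesis
  proof cases
    case 1
    have "((\<lambda>_. 0) has_real_derivative 0) (at t)" by simp
    then have "(flat_exp c m has_real_derivative 0) (at t)"
      by (rule has_field_derivative_transform_within_open[where S="{..<0}"]) (use 1 in \<open>auto simp: flat_exp_def\<close>)
    then show ?thesis using 1 by (simp add: flat_exp_def)
  next
    \<comment> \<open>At 0 the difference quotient of \<open>flat_exp c m\<close> is exactly
      \<open>flat_exp c (m + 1)\<close>, whose limit was just computed.\<close>
    case 2
    have "\<forall>\<^sub>F t in at 0. flat_exp c (m + 1) t = (flat_exp c m t - flat_exp c m 0) / (t - 0)"
      by (rule eventually_mono[OF eventually_at_ball'[of 1]]) (auto simp: flat_exp_def)
    then have "((\<lambda>t. (flat_exp c m t - flat_exp c m 0) / (t - 0)) \<longlongrightarrow> 0) (at 0)"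
      by (rule Lim_transform_eventually[OF flat_exp_tendsto_0[OF assms]])
    then show ?thesis using 2 by (simp add: has_field_derivative_iff) (simp add: flat_exp_def)
  next
    case 3
    have "((\<lambda>t. (1 / t) ^ m * exp (- (c / t))) has_real_derivative (c * flat_exp c (m + 2) t - m * flat_exp c (m + 1) t)) (at t)"
    proof (cases m)
      case 0
      show ?thesis unfolding 0
        by (rule derivative_eq_intros refl | use 3 in \<open>simp add: flat_exp_def field_simps power2_eq_square\<close>)+
    next
      case (Suc n)
      show ?thesis unfolding Suc
        by (rule derivative_eq_intros refl | use 3 in \<open>simp add: flat_exp_def field_simps power2_eq_square\<close>)+
    qed
    then show ?thesis
      by (rule has_field_derivative_transform_within_open[where S="{0<..}"]) (use 3 in \<open>auto simp: flat_exp_def\<close>)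
  qed
qed

lemma Ck_flat_exp:
  fixes b :: "'a::euclidean_space"
  assumes "0 < c"
  shows "Ck k (\<lambda>x. flat_exp c m (x \<bullet> b + d))"
proof (induction k arbitrary: m)
  case 0
  have c: "continuous_on UNIV (flat_exp c m)"
    using flat_exp_has_derivative[OF assms] DERIV_isCont by (blast intro: continuous_at_imp_continuous_on)
  show ?case
    unfolding Ck.simps(1)
    by (rule continuous_on_compose2[OF c]) (auto intro!: continuous_intros)
next
  case (Suc k)
  have D: "((\<lambda>x. flat_exp c m (x \<bullet> b + d)) has_derivative
    (\<lambda>h. (c * flat_exp c (m + 2) (x \<bullet> b + d) - m * flat_exp c (m + 1) (x \<bullet> b + d)) * (h \<bullet> b))) (at x)" for x
  proof -
    have "((\<lambda>x. x \<bullet> b + d) has_derivative (\<lambda>h. h \<bullet> b)) (at x)"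
      by (auto intro!: derivative_eq_intros)
    from has_derivative_compose[OF this has_field_derivative_imp_has_derivative[OF flat_exp_has_derivative[OF assms]]]
    show ?thesis by (simp add: mult.commute)
  qed
  have fd: "frechet_derivative (\<lambda>x. flat_exp c m (x \<bullet> b + d)) (at x) =
    (\<lambda>h. (c * flat_exp c (m + 2) (x \<bullet> b + d) - m * flat_exp c (m + 1) (x \<bullet> b + d)) * (h \<bullet> b))" for x
    by (rule frechet_derivative_at[OF D, symmetric])
  have "Ck k (\<lambda>x. (c * flat_exp c (m + 2) (x \<bullet> b + d) + (- m) * flat_exp c (m + 1) (x \<bullet> b + d)) * (i \<bullet> b))" for i
    by (intro Ck_mult Ck_add Ck_const Suc.IH)
  then show ?case using D by (auto simp: fd differentiable_def)
qed

text \<open>One flat factor for each face of the box gives a smooth function supported in the closed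
  box without any convolution. The arguments have the form \<open>x \<bullet> b + d\<close>, with
  \<open>- i\<close> for the upper faces, so that one smoothness lemma serves both kinds of
  face.\<close>

definition box_bump :: "real \<Rightarrow> 'a::euclidean_space \<Rightarrow> 'a \<Rightarrow> 'a \<Rightarrow> real" where
  "box_bump c a b x = (\<Prod>i\<in>Basis. flat_exp c 0 (x \<bullet> i + - (a \<bullet> i)) * flat_exp c 0 (x \<bullet> (- i) + b \<bullet> i))"

lemma box_bump_eq_0: "x \<notin> box a b \<Longrightarrow> box_bump c a b x = 0"
  by (auto simp: box_bump_def mem_box flat_exp_def)

lemma box_bump_test_function:
  assumes "0 < c"
  shows "box_bump c a b \<in> test_functions UNIV"
proof -
  have sub: "closure {x. box_bump c a b x \<noteq> 0} \<subseteq> cbox a b"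
    using box_bump_eq_0[of _ a b c] box_subset_cbox[of a b] by (intro closure_minimal) auto
  have "compact (closure {x. box_bump c a b x \<noteq> 0})"
    by (rule compact_closure[THEN iffD2], rule bounded_subset[OF bounded_cbox[of a b]],
      rule order_trans[OF closure_subset sub])
  moreover have "Ck k (box_bump c a b)" for k
    unfolding box_bump_def by (intro Ck_prod Ck_mult Ck_flat_exp assms) auto
  ultimately show ?thesis by (auto simp: test_functions_def)
qed

lemma flat_exp_le_1: "0 < c \<Longrightarrow> 0 \<le> flat_exp c 0 t \<and> flat_exp c 0 t \<le> 1"
  by (auto simp: flat_exp_def)

lemma box_bump_bounds: "0 < c \<Longrightarrow> 0 \<le> box_bump c a b x \<and> box_bump c a b x \<le> 1"
  unfolding box_bump_def using flat_exp_le_1[of c]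
  by (intro conjI prod_nonneg prod_le_1 mult_nonneg_nonneg mult_le_one) blast+

lemma box_bump_tendsto: "(\<lambda>n. box_bump (1 / Suc n) a b x) \<longlonglongrightarrow> indicator (box a b) x"
proof (cases "x \<in> box a b")
  case True
  have e: "(\<lambda>n. flat_exp (1 / Suc n) 0 t) \<longlonglongrightarrow> 1" if "0 < t" for t
  proof -
    have "(\<lambda>n. 1 / real (Suc n) / t) \<longlonglongrightarrow> 0 / t"
      by (rule tendsto_divide[OF _ tendsto_const]) (use LIMSEQ_inverse_real_of_nat that in \<open>auto simp: inverse_eq_divide\<close>)
    then have "(\<lambda>n. exp (- (1 / real (Suc n) / t))) \<longlonglongrightarrow> exp (- (0 / t))"
      by (rule tendsto_exp[OF tendsto_minus])
    then show ?thesis using that by (simp add: flat_exp_def)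
  qed
  have "(\<lambda>n. box_bump (1 / Suc n) a b x) \<longlonglongrightarrow> (\<Prod>i\<in>(Basis::'a set). 1 * 1)"
    unfolding box_bump_def by (intro tendsto_prod tendsto_mult e) (use True in \<open>auto simp: mem_box\<close>)
  then show ?thesis using True by simp
qed (simp add: box_bump_eq_0)

section \<open>Integration by parts and classical gradients of test functions\<close>

lemma test_functionD:
  assumes "\<phi> \<in> test_functions \<Omega>"
  shows "(\<phi> has_derivative frechet_derivative \<phi> (at x)) (at x)" "continuous_on UNIV \<phi>"
    "\<And>i. i \<in> Basis \<Longrightarrow> continuous_on UNIV (\<lambda>x. frechet_derivative \<phi> (at x) i)"
    "\<phi> \<in> test_functions UNIV" "\<And>x. x \<notin> \<Omega> \<Longrightarrow> \<phi> x = 0"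
proof -
  have C: "Ck k \<phi>" for k using assms by (auto simp: test_functions_def)
  show "(\<phi> has_derivative frechet_derivative \<phi> (at x)) (at x)"
    using C[of "Suc 0"] by (auto simp: frechet_derivative_works[symmetric])
  show "continuous_on UNIV \<phi>" using C[of 0] by simp
  show "i \<in> Basis \<Longrightarrow> continuous_on UNIV (\<lambda>x. frechet_derivative \<phi> (at x) i)" for i
    using C[of "Suc 0"] by simp
  show "\<phi> \<in> test_functions UNIV" using assms by (auto simp: test_functions_def)
  show "\<phi> x = 0" if "x \<notin> \<Omega>" for x
    using assms closure_subset[of "{x. \<phi> x \<noteq> 0}"] that by (auto simp: test_functions_def)
qed

lemma test_function_support:
  assumes "\<phi> \<in> test_functions \<Omega>"
  obtains R where "0 < R" "\<And>x. R \<le> norm x \<Longrightarrow> \<phi> x = 0"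
proof -
  have "bounded {x. \<phi> x \<noteq> 0}"
    using assms compact_imp_bounded bounded_subset[OF _ closure_subset] by (auto simp: test_functions_def)
  then obtain R where "0 < R" "\<And>x. \<phi> x \<noteq> 0 \<Longrightarrow> norm x \<le> R" by (auto simp: bounded_pos)
  then show thesis by (intro that[of "R + 1"]) force+
qed

lemma derivative_eq_0_outside:
  fixes F :: "'a::euclidean_space \<Rightarrow> real"
  assumes "(F has_derivative F') (at x)" "\<And>y. R \<le> norm y \<Longrightarrow> F y = 0" "R < norm x"
  shows "F' = (\<lambda>h. 0)"
proof -
  have "((\<lambda>_. 0::real) has_derivative (\<lambda>h. 0)) (at x)" by simp
  then have "(F has_derivative (\<lambda>h. 0)) (at x)"
    by (rule has_derivative_transform_within_open[where s="{y. R < norm y}"])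
      (use assms in \<open>auto intro!: open_Collect_less continuous_intros\<close>)
  then show ?thesis using assms(1) has_derivative_unique by blast
qed

lemma continuous_bounded_support:
  fixes f :: "'a::euclidean_space \<Rightarrow> real"
  assumes f: "continuous_on UNIV f" and R: "\<And>x. R < norm x \<Longrightarrow> f x = 0"
  obtains B where "0 < B" "\<And>x. \<bar>f x\<bar> \<le> B"
proof -
  have "bounded (f ` cball 0 R)"
    by (intro compact_imp_bounded compact_continuous_image continuous_on_subset[OF f]) auto
  then obtain B where B: "0 < B" "\<And>x. norm x \<le> R \<Longrightarrow> \<bar>f x\<bar> \<le> B" by (auto simp: bounded_pos)
  have "\<bar>f x\<bar> \<le> B" for x using B R[of x] by (cases "norm x \<le> R") auto
  then show ?thesis using B(1) that by blast
qed

lemma integrable_continuous_bounded_support: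
  fixes f :: "'a::euclidean_space \<Rightarrow> real"
  assumes f: "continuous_on UNIV f" and R: "\<And>x. R < norm x \<Longrightarrow> f x = 0"
  shows "integrable lborel f"
proof -
  have "integrable lborel (\<lambda>x. indicator (cball 0 R) x *\<^sub>R f x)"
    by (intro borel_integrable_compact continuous_on_subset[OF f]) auto
  moreover have "indicator (cball 0 R) x *\<^sub>R f x = f x" for x
    using R[of x] by (auto simp: indicator_def)
  ultimately show ?thesis by (simp only:)
qed

text \<open>The integral of F(x + t i) - F(x) is 0 by translation invariance. The difference
  quotients are bounded by the mean value theorem, live on a fixed ball, and converge to the
  derivative. All integrations by parts below rest on this fact.\<close>

lemma integral_directional_derivative:
  fixes F :: "'a::euclidean_space \<Rightarrow> real"
  assumes D: "\<And>x. (F has_derivative F' x) (at x)" and R: "\<And>x. R \<le> norm x \<Longrightarrow> F x = 0"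
    and c: "continuous_on UNIV (\<lambda>x. F' x i)"
  shows "integrable lborel (\<lambda>x. F' x i)" "(\<integral>x. F' x i \<partial>lborel) = 0"
proof -
  have cF: "continuous_on UNIV F"
    using D has_derivative_continuous by (fastforce simp: continuous_on_eq_continuous_at)
  have [measurable]: "F \<in> borel_measurable borel" using cF by (rule borel_measurable_continuous_onI)
  have F0: "F' x i = 0" if "R < norm x" for x
    using derivative_eq_0_outside[OF D R that] by simp
  show "integrable lborel (\<lambda>x. F' x i)" by (rule integrable_continuous_bounded_support[OF c F0])
  obtain B where B: "0 < B" "\<And>x. \<bar>F' x i\<bar> \<le> B" by (rule continuous_bounded_support[OF c F0]) blast+
  have iF: "integrable lborel F" by (rule integrable_continuous_bounded_support[OF cF R, of R]) auto
  have L: "((\<lambda>s. F (x + s *\<^sub>R i)) has_real_derivative F' (x + s *\<^sub>R i) i) (at s)" for x s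
  proof -
    have "((\<lambda>s. x + s *\<^sub>R i) has_derivative (\<lambda>h. h *\<^sub>R i)) (at s)" by (auto intro!: derivative_eq_intros)
    from has_derivative_compose[OF this D]
    have "((\<lambda>s. F (x + s *\<^sub>R i)) has_derivative (\<lambda>h. F' (x + s *\<^sub>R i) (h *\<^sub>R i))) (at s)" .
    moreover have "F' (x + s *\<^sub>R i) (h *\<^sub>R i) = F' (x + s *\<^sub>R i) i * h" for h
      using has_derivative_bounded_linear[OF D] by (simp add: linear_simps)
    ultimately show ?thesis by (simp add: has_field_derivative_def)
  qed
  define t where "t n = 1 / real (Suc n)" for n
  have t: "0 < t n" "t n \<le> 1" for n by (auto simp: t_def)
  have t0: "t \<longlonglongrightarrow> 0" unfolding t_def using LIMSEQ_inverse_real_of_nat by (simp add: inverse_eq_divide)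
  define q where "q n x = (F (x + t n *\<^sub>R i) - F x) / t n" for n x
  have [measurable]: "q n \<in> borel_measurable borel" for n unfolding q_def by measurable
  have qB: "\<bar>q n x\<bar> \<le> B" for n x
  proof -
    obtain z where "F (x + t n *\<^sub>R i) - F (x + 0 *\<^sub>R i) = (t n - 0) * F' (x + z *\<^sub>R i) i"
      using MVT2[OF t(1)[of n], of "\<lambda>s. F (x + s *\<^sub>R i)" "\<lambda>s. F' (x + s *\<^sub>R i) i"] L by blast
    then have "q n x = F' (x + z *\<^sub>R i) i" using t[of n] by (simp add: q_def)
    then show ?thesis using B(2) by simp
  qed
  have qs: "q n x = 0" if "R + norm i < norm x" for n x
  proof -
    have "norm (t n *\<^sub>R i) \<le> norm i" using t[of n] by (simp add: mult_left_le_one_le)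
    then have "R \<le> norm (x + t n *\<^sub>R i)" "R \<le> norm x"
      using that norm_triangle_ineq4[of "x + t n *\<^sub>R i" "t n *\<^sub>R i"] norm_ge_zero[of i]
      by (simp_all del: norm_ge_zero)
    then show ?thesis using R by (simp add: q_def)
  qed
  have "(\<lambda>n. \<integral>x. q n x \<partial>lborel) \<longlonglongrightarrow> (\<integral>x. F' x i \<partial>lborel)"
  proof (rule integral_dominated_convergence[where w="\<lambda>x. B * indicator (cball 0 (R + norm i)) x"])
    show "integrable lborel (\<lambda>x. B * indicator (cball 0 (R + norm i)) x :: real)"
      by (intro integrable_mult_right integrable_real_indicator emeasure_lborel_cball_finite) simp
    show "(\<lambda>x. F' x i) \<in> borel_measurable lborel" using borel_measurable_continuous_onI[OF c] by simp
    show "AE x in lborel. (\<lambda>n. q n x) \<longlonglongrightarrow> F' x i"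
    proof (rule AE_I2)
      fix x
      have "((\<lambda>h. (F (x + h *\<^sub>R i) - F x) / h) \<longlongrightarrow> F' x i) (at 0)"
        using L[of x 0] by (simp add: DERIV_def)
      moreover have "filterlim t (at 0) sequentially"
        using t0 t(1) by (auto simp: filterlim_at intro!: always_eventually) (metis less_irrefl)
      ultimately show "(\<lambda>n. q n x) \<longlonglongrightarrow> F' x i"
        unfolding q_def by (rule filterlim_compose)
    qed
    show "AE x in lborel. norm (q n x) \<le> B * indicator (cball 0 (R + norm i)) x" for n
      using qB[of n] qs[of _ n] by (intro AE_I2) (auto simp: indicator_def)
  qed simp
  moreover have "(\<integral>x. q n x \<partial>lborel) = 0" for n
  proof -
    have sh: "integrable lborel (\<lambda>x. F (t n *\<^sub>R i + x))" "(\<integral>x. F (t n *\<^sub>R i + x) \<partial>lborel) = (\<integral>x. F x \<partial>lborel)"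
      using lborel_distr_plus[of "t n *\<^sub>R i"] iF integrable_distr_eq[of "(+) (t n *\<^sub>R i)" lborel borel F]
        integral_distr[of "(+) (t n *\<^sub>R i)" lborel borel F] by auto
    then show ?thesis using iF by (simp add: q_def add.commute)
  qed
  ultimately show "(\<integral>x. F' x i \<partial>lborel) = 0" using LIMSEQ_unique[of "\<lambda>n. 0::real" 0] by simp
qed

definition grad :: "('a::euclidean_space \<Rightarrow> real) \<Rightarrow> 'a \<Rightarrow> 'a" where
  "grad \<phi> x = (\<Sum>i\<in>Basis. frechet_derivative \<phi> (at x) i *\<^sub>R i)"

lemma grad_inner_Basis: "i \<in> Basis \<Longrightarrow> grad \<phi> x \<bullet> i = frechet_derivative \<phi> (at x) i"
  by (simp add: grad_def inner_sum_left inner_Basis if_distrib cong: if_cong)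

lemma grad_inner:
  assumes "(\<phi> has_derivative frechet_derivative \<phi> (at x)) (at x)"
  shows "frechet_derivative \<phi> (at x) h = grad \<phi> x \<bullet> h"
proof -
  interpret linear "frechet_derivative \<phi> (at x)"
    using assms has_derivative_linear by blast
  have "frechet_derivative \<phi> (at x) (\<Sum>i\<in>Basis. (h \<bullet> i) *\<^sub>R i) = grad \<phi> x \<bullet> h"
    by (simp add: sum scaleR grad_def inner_sum_left inner_commute[of h] mult.commute del: euclidean_representation)
  then show ?thesis by (simp add: euclidean_representation)
qed

lemma continuous_grad: "\<phi> \<in> test_functions \<Omega> \<Longrightarrow> continuous_on UNIV (grad \<phi>)"
  unfolding grad_def by (intro continuous_intros test_functionD(3))

lemma locally_integrable_continuous:
  fixes f :: "'a::euclidean_space \<Rightarrow> 'b::euclidean_space"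
  assumes "continuous_on UNIV f"
  shows "locally_integrable f"
  unfolding locally_integrable_def set_integrable_def
  using borel_measurable_continuous_onI[OF assms]
  by (auto intro!: borel_integrable_compact continuous_on_subset[OF assms])

lemma integrable_mult_bounded_support:
  fixes f :: "'a::euclidean_space \<Rightarrow> 'b::euclidean_space"
  assumes f: "locally_integrable f" and \<phi>: "continuous_on UNIV \<phi>" and R: "\<And>x. R < norm x \<Longrightarrow> \<phi> x = 0"
  shows "integrable lborel (\<lambda>x. (\<phi> x :: real) *\<^sub>R f x)"
proof -
  obtain B where B: "0 < B" "\<And>x. \<bar>\<phi> x\<bar> \<le> B" by (rule continuous_bounded_support[OF \<phi> R]) blast+
  have [measurable]: "\<phi> \<in> borel_measurable borel" using \<phi> by (rule borel_measurable_continuous_onI)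
  have [measurable]: "f \<in> borel_measurable borel" using f by (simp add: locally_integrable_def)
  have "integrable lborel (\<lambda>x. indicator (cball 0 R) x *\<^sub>R f x)"
    using f by (auto simp: locally_integrable_def set_integrable_def)
  then have "integrable lborel (\<lambda>x. B *\<^sub>R (indicator (cball 0 R) x *\<^sub>R f x))" by (rule integrable_scaleR_right)
  then show ?thesis
  proof (rule Bochner_Integration.integrable_bound)
    show "AE x in lborel. norm (\<phi> x *\<^sub>R f x) \<le> norm (B *\<^sub>R indicator (cball 0 R) x *\<^sub>R f x)"
      using R B by (intro AE_I2) (auto simp: indicator_def intro!: mult_right_mono)
  qed simp
qed

text \<open>The product of two test functions has compact support, so its partial derivatives
  integrate to 0; the product rule does the rest.\<close>

lemma is_weak_gradient_grad:
  assumes "\<phi> \<in> test_functions \<Omega>"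
  shows "is_weak_gradient \<phi> (grad \<phi>)"
  unfolding is_weak_gradient_def
proof (intro conjI ballI)
  note \<phi> = test_functionD[OF assms]
  show "locally_integrable \<phi>" by (rule locally_integrable_continuous[OF \<phi>(2)])
  show "locally_integrable (grad \<phi>)" by (rule locally_integrable_continuous[OF continuous_grad[OF assms]])
  fix \<psi> :: "'a \<Rightarrow> real" and i :: 'a
  assume "\<psi> \<in> test_functions UNIV" and i: "i \<in> Basis"
  note \<psi> = test_functionD[OF this(1)]
  obtain R where R: "0 < R" "\<And>x. R \<le> norm x \<Longrightarrow> \<phi> x = 0" by (rule test_function_support[OF assms]) blast
  have D: "((\<lambda>x. \<phi> x * \<psi> x) has_derivative (\<lambda>h. \<phi> x * frechet_derivative \<psi> (at x) h + frechet_derivative \<phi> (at x) h * \<psi> x)) (at x)" for x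
    by (rule has_derivative_mult[OF \<phi>(1) \<psi>(1)])
  have c1: "continuous_on UNIV (\<lambda>x. \<phi> x * frechet_derivative \<psi> (at x) i)"
    and c2: "continuous_on UNIV (\<lambda>x. frechet_derivative \<phi> (at x) i * \<psi> x)"
    by (intro continuous_intros \<phi> \<psi> i)+
  have i1: "integrable lborel (\<lambda>x. \<phi> x * frechet_derivative \<psi> (at x) i)"
    by (rule integrable_continuous_bounded_support[OF c1, of R]) (use R in auto)
  have i2: "integrable lborel (\<lambda>x. frechet_derivative \<phi> (at x) i * \<psi> x)"
    by (rule integrable_continuous_bounded_support[OF c2, of R])
      (use derivative_eq_0_outside[OF \<phi>(1) R(2)] in auto)
  have "(\<integral>x. \<phi> x * frechet_derivative \<psi> (at x) i + frechet_derivative \<phi> (at x) i * \<psi> x \<partial>lborel) = 0"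
    by (rule integral_directional_derivative(2)[OF D, of R]) (use R c1 c2 in \<open>auto intro!: continuous_intros\<close>)
  then show "(\<integral>x. \<phi> x * frechet_derivative \<psi> (at x) i \<partial>lborel) = - (\<integral>x. (grad \<phi> x \<bullet> i) * \<psi> x \<partial>lborel)"
    using i1 i2 by (simp add: grad_inner_Basis[OF i])
qed

section \<open>Linearity and uniqueness of the weak gradient\<close>

lemma locally_integrable_add:
  fixes f g :: "'a::euclidean_space \<Rightarrow> 'b::euclidean_space"
  shows "locally_integrable f \<Longrightarrow> locally_integrable g \<Longrightarrow> locally_integrable (\<lambda>x. f x + g x)"
  unfolding locally_integrable_def by (auto intro: set_integral_add)

lemma locally_integrable_scaleR:
  fixes f :: "'a::euclidean_space \<Rightarrow> 'b::euclidean_space"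
  shows "locally_integrable f \<Longrightarrow> locally_integrable (\<lambda>x. c *\<^sub>R f x)"
  unfolding locally_integrable_def set_integrable_def scaleR_left_commute[of _ c]
  by (auto simp del: scaleR_scaleR)

lemma locally_integrable_inner:
  fixes f :: "'a::euclidean_space \<Rightarrow> 'b::euclidean_space"
  assumes "locally_integrable f"
  shows "locally_integrable (\<lambda>x. f x \<bullet> c)"
proof -
  have "integrable lborel (\<lambda>x. indicator K x *\<^sub>R (f x \<bullet> c))" if "compact K" for K
    using assms that integrable_inner_left[of c lborel "\<lambda>x. indicator K x *\<^sub>R f x"]
    by (auto simp: locally_integrable_def set_integrable_def)
  then show ?thesis using assms by (auto simp: locally_integrable_def set_integrable_def)
qed

lemma test_function_integrable:
  assumes "locally_integrable f" "\<phi> \<in> test_functions \<Omega>"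
  shows "integrable lborel (\<lambda>x. f x * \<phi> x :: real)"
    "i \<in> Basis \<Longrightarrow> integrable lborel (\<lambda>x. f x * frechet_derivative \<phi> (at x) i)"
proof -
  note \<phi> = test_functionD[OF assms(2)]
  obtain R where R: "0 < R" "\<And>x. R \<le> norm x \<Longrightarrow> \<phi> x = 0" by (rule test_function_support[OF assms(2)]) blast
  show "integrable lborel (\<lambda>x. f x * \<phi> x)"
    using integrable_mult_bounded_support[OF assms(1) \<phi>(2), of R] R by (simp add: mult.commute)
  show "i \<in> Basis \<Longrightarrow> integrable lborel (\<lambda>x. f x * frechet_derivative \<phi> (at x) i)"
    using integrable_mult_bounded_support[OF assms(1) \<phi>(3), of i R] derivative_eq_0_outside[OF \<phi>(1) R(2)]
    by (simp add: mult.commute)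
qed

lemma is_weak_gradient_add:
  assumes u: "is_weak_gradient u g" and w: "is_weak_gradient w h"
  shows "is_weak_gradient (\<lambda>x. u x + w x) (\<lambda>x. g x + h x)"
proof -
  have li: "locally_integrable u" "locally_integrable g" "locally_integrable w" "locally_integrable h"
    using assms by (auto simp: is_weak_gradient_def)
  show ?thesis
    unfolding is_weak_gradient_def
  proof (intro conjI ballI)
    fix \<phi> :: "'a \<Rightarrow> real" and i :: 'a
    assume \<phi>: "\<phi> \<in> test_functions UNIV" and i: "i \<in> Basis"
    show "(\<integral>x. (u x + w x) * frechet_derivative \<phi> (at x) i \<partial>lborel) = - (\<integral>x. ((g x + h x) \<bullet> i) * \<phi> x \<partial>lborel)"
      using assms \<phi> i test_function_integrable(2)[OF li(1) \<phi> i] test_function_integrable(2)[OF li(3) \<phi> i]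
        test_function_integrable(1)[OF locally_integrable_inner[OF li(2)] \<phi>, of i]
        test_function_integrable(1)[OF locally_integrable_inner[OF li(4)] \<phi>, of i]
      by (simp add: is_weak_gradient_def distrib_right inner_add_left)
  qed (auto intro: locally_integrable_add li)
qed

lemma is_weak_gradient_cmult:
  assumes u: "is_weak_gradient u g"
  shows "is_weak_gradient (\<lambda>x. c * u x) (\<lambda>x. c *\<^sub>R g x)"
  using assms locally_integrable_scaleR[of u c] locally_integrable_scaleR[of g c]
  by (auto simp: is_weak_gradient_def mult.assoc)

text \<open>Since \<open>ennreal\<close> truncates at 0, the densities \<open>ennreal (g x)\<close>
  and \<open>ennreal (- g x)\<close> are the positive and negative parts of g. They give equal
  finite mass to every box, an intersection-stable generator, so the two measures coincide and both
  parts agree almost everywhere, which forces g = 0.\<close>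

lemma AE_zero_of_box_integrals:
  fixes g :: "'a::euclidean_space \<Rightarrow> real"
  assumes g: "locally_integrable g" and z: "\<And>a b. (\<integral>x. indicator (box a b) x * g x \<partial>lborel) = 0"
  shows "AE x in lborel. g x = 0"
proof -
  have [measurable]: "g \<in> borel_measurable borel" using g by (simp add: locally_integrable_def)
  have ib: "integrable lborel (\<lambda>x. indicator (box a b) x * g x)" for a b
  proof -
    have "integrable lborel (\<lambda>x. indicator (cbox a b) x * g x)"
      using g by (auto simp: locally_integrable_def set_integrable_def)
    then show ?thesis
      by (rule Bochner_Integration.integrable_bound) (use box_subset_cbox[of a b] in \<open>auto simp: indicator_def intro!: AE_I2\<close>)
  qed
  have eq: "emeasure (density lborel (\<lambda>x. ennreal (g x))) (box a b) = emeasure (density lborel (\<lambda>x. ennreal (- g x))) (box a b)" for a b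
  proof -
    define P where "P x = max 0 (indicator (box a b) x * g x)" for x
    define N where "N x = max 0 (- (indicator (box a b) x * g x))" for x
    have i: "integrable lborel P" "integrable lborel N" unfolding P_def N_def using ib by auto
    have "P x - N x = indicator (box a b) x * g x" for x by (simp add: P_def N_def)
    then have "(\<integral>x. P x - N x \<partial>lborel) = 0" using z[of a b] by simp
    then have e: "(\<integral>x. P x \<partial>lborel) = (\<integral>x. N x \<partial>lborel)" using i by simp
    have "(\<integral>\<^sup>+x. ennreal (P x) \<partial>lborel) = (\<integral>\<^sup>+x. ennreal (N x) \<partial>lborel)"
    proof -
      have "(\<integral>\<^sup>+x. ennreal (P x) \<partial>lborel) = ennreal (\<integral>x. P x \<partial>lborel)"
        by (rule nn_integral_eq_integral[OF i(1)]) (simp add: P_def)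
      moreover have "(\<integral>\<^sup>+x. ennreal (N x) \<partial>lborel) = ennreal (\<integral>x. N x \<partial>lborel)"
        by (rule nn_integral_eq_integral[OF i(2)]) (simp add: N_def)
      ultimately show ?thesis using e by simp
    qed
    moreover have "ennreal (P x) = ennreal (g x) * indicator (box a b) x" "ennreal (N x) = ennreal (- g x) * indicator (box a b) x" for x
      by (auto simp: P_def N_def indicator_def max_def ennreal_neg)
    ultimately show ?thesis by (simp add: emeasure_density)
  qed
  have "density lborel (\<lambda>x. ennreal (g x)) = density lborel (\<lambda>x. ennreal (- g x))"
  proof (rule measure_eqI_generator_eq[where E="range (\<lambda>(a, b). box a b)" and \<Omega>=UNIV and A="\<lambda>n. box (- (real n *\<^sub>R One)) (real n *\<^sub>R One)"])
    show "Int_stable (range (\<lambda>(a, b). box a b :: 'a set))"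
      by (auto simp: Int_stable_def box_Int_box)
    show "(\<Union>i. box (- (real i *\<^sub>R One)) (real i *\<^sub>R One)) = (UNIV :: 'a set)"
      by (rule UN_box_eq_UNIV)
    show "emeasure (density lborel (\<lambda>x. ennreal (g x))) (box (- (real n *\<^sub>R One)) (real n *\<^sub>R One)) \<noteq> \<infinity>" for n
    proof -
      have "emeasure (density lborel (\<lambda>x. ennreal (g x))) (box (- (real n *\<^sub>R One)) (real n *\<^sub>R One)) \<le>
         (\<integral>\<^sup>+x. ennreal (norm (indicator (box (- (real n *\<^sub>R One)) (real n *\<^sub>R One)) x * g x)) \<partial>lborel)"
        by (subst emeasure_density) (auto intro!: nn_integral_mono simp: indicator_def ennreal_leI)
      also have "\<dots> < \<infinity>" using ib by (simp add: integrable_iff_bounded)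
      finally show ?thesis by simp
    qed
  qed (auto simp: eq borel_eq_box)
  then have "AE x in lborel. ennreal (g x) = ennreal (- g x)"
    by (subst (asm) sigma_finite_measure.density_unique_iff[OF sigma_finite_lborel]) auto
  then show ?thesis
    by eventually_elim (metis ennreal_eq_0_iff ennreal_neg le_cases neg_0_le_iff_le neg_le_0_iff_le order_antisym)
qed

text \<open>The bumps tend pointwise to the indicator of a box as their parameter tends to 0, and
  they stay below the indicator of the closed box, on which g is integrable. Dominated convergence
  reduces the claim to integrals over boxes.\<close>

lemma fundamental_lemma_variations:
  fixes g :: "'a::euclidean_space \<Rightarrow> real"
  assumes g: "locally_integrable g" and z: "\<And>\<phi>. \<phi> \<in> test_functions UNIV \<Longrightarrow> (\<integral>x. g x * \<phi> x \<partial>lborel) = 0"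
  shows "AE x in lborel. g x = 0"
proof (rule AE_zero_of_box_integrals[OF g])
  fix a b :: 'a
  have [measurable]: "g \<in> borel_measurable borel" using g by (simp add: locally_integrable_def)
  have "(\<lambda>n. \<integral>x. g x * box_bump (1 / Suc n) a b x \<partial>lborel) \<longlonglongrightarrow> (\<integral>x. g x * indicator (box a b) x \<partial>lborel)"
  proof (rule integral_dominated_convergence[where w="\<lambda>x. \<bar>indicator (cbox a b) x * g x\<bar>"])
    show "integrable lborel (\<lambda>x. \<bar>indicator (cbox a b) x * g x\<bar>)"
      using g by (auto simp: locally_integrable_def set_integrable_def)
    show "AE x in lborel. (\<lambda>n. g x * box_bump (1 / Suc n) a b x) \<longlonglongrightarrow> g x * indicator (box a b) x"
      by (intro AE_I2 tendsto_mult tendsto_const box_bump_tendsto)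
    show "AE x in lborel. norm (g x * box_bump (1 / Suc n) a b x) \<le> \<bar>indicator (cbox a b) x * g x\<bar>" for n
    proof (rule AE_I2)
      fix x
      have "\<bar>box_bump (1 / Suc n) a b x\<bar> \<le> indicator (cbox a b) x"
        using box_bump_bounds[of "1 / Suc n" a b x] box_bump_eq_0[of x a b "1 / Suc n"] box_subset_cbox[of a b]
        by (cases "x \<in> box a b") (auto simp: indicator_def)
      from mult_left_mono[OF this, of "\<bar>g x\<bar>"]
      show "norm (g x * box_bump (1 / Suc n) a b x) \<le> \<bar>indicator (cbox a b) x * g x\<bar>"
        by (simp add: abs_mult mult.commute)
    qed
    show "(\<lambda>x. g x * box_bump (1 / Suc n) a b x) \<in> borel_measurable lborel" for n
      using borel_measurable_continuous_onI[OF test_functionD(2)[OF box_bump_test_function[of "1 / Suc n" a b]]] by simp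
  qed simp
  then show "(\<integral>x. indicator (box a b) x * g x \<partial>lborel) = 0"
    using z[OF box_bump_test_function] LIMSEQ_unique[of "\<lambda>n. 0::real" 0] by (simp add: mult.commute)
qed

lemma weak_gradient_unique:
  assumes g: "is_weak_gradient u g" and h: "is_weak_gradient u h"
  shows "AE x in lborel. g x = h x"
proof -
  have li: "locally_integrable g" "locally_integrable h" using assms by (auto simp: is_weak_gradient_def)
  have "AE x in lborel. (g x + (-1) *\<^sub>R h x) \<bullet> i = 0" if i: "i \<in> Basis" for i
  proof (rule fundamental_lemma_variations)
    show "locally_integrable (\<lambda>x. (g x + (-1) *\<^sub>R h x) \<bullet> i)"
      by (intro locally_integrable_inner locally_integrable_add locally_integrable_scaleR li)
    fix \<phi> :: "'a \<Rightarrow> real"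
    assume \<phi>: "\<phi> \<in> test_functions UNIV"
    have "(\<integral>x. (g x \<bullet> i) * \<phi> x \<partial>lborel) = (\<integral>x. (h x \<bullet> i) * \<phi> x \<partial>lborel)"
      using assms \<phi> i by (simp add: is_weak_gradient_def)
    then show "(\<integral>x. ((g x + (-1) *\<^sub>R h x) \<bullet> i) * \<phi> x \<partial>lborel) = 0"
      using test_function_integrable(1)[OF locally_integrable_inner[OF li(1)] \<phi>, of i]
        test_function_integrable(1)[OF locally_integrable_inner[OF li(2)] \<phi>, of i]
      by (simp add: inner_diff_left left_diff_distrib)
  qed
  then have "AE x in lborel. \<forall>i\<in>Basis. (g x + (-1) *\<^sub>R h x) \<bullet> i = 0"
    by (subst AE_finite_all) auto
  then show ?thesis
    by eventually_elim (auto simp: euclidean_eq_iff[where 'a='a] inner_diff_left)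
qed

lemma is_weak_gradient_weak_grad: "\<exists>g. is_weak_gradient u g \<Longrightarrow> is_weak_gradient u (weak_grad u)"
  unfolding weak_grad_def by (erule someI_ex)

text \<open>Makes the Hilbert choice in \<open>weak_grad\<close> usable: every concrete weak
  gradient computes it almost everywhere. In particular \<open>weak_grad\<close> is linear only up
  to null sets.\<close>

lemma weak_grad_eq: "is_weak_gradient u g \<Longrightarrow> AE x in lborel. weak_grad u x = g x"
  using weak_gradient_unique is_weak_gradient_weak_grad by blast

section \<open>The localized Hardy inequality\<close>

lemma has_derivative_abs_powr:
  fixes p :: real
  assumes p: "1 < p"
  shows "((\<lambda>y::real. \<bar>y\<bar> powr p) has_real_derivative p * \<bar>y\<bar> powr (p - 1) * sgn y) (at y)"
proof -
  consider "y < 0" | "y = 0" | "0 < y" by linarith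
  then show ?thesis
  proof cases
    case 1
    have "((\<lambda>y. (- y) powr p) has_real_derivative p * \<bar>y\<bar> powr (p - 1) * sgn y) (at y)"
      using 1 by (auto intro!: derivative_eq_intros simp: powr_diff)
    then show ?thesis
      by (rule has_field_derivative_transform_within_open[where S="{..<0}"]) (use 1 in auto)
  next
    \<comment> \<open>At 0 the quotient |h|^p / h has absolute value |h|^(p-1), which tends to 0
      because p > 1.\<close>
    case 2
    have "((\<lambda>h::real. \<bar>h\<bar> powr (p - 1)) \<longlongrightarrow> 0) (at 0)"
      using p by (auto intro!: tendsto_eq_intros)
    moreover have ev: "\<forall>\<^sub>F h::real in at 0. \<bar>(\<bar>h\<bar> powr p - \<bar>0\<bar> powr p) / (h - 0)\<bar> = \<bar>h\<bar> powr (p - 1)"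
      by (rule eventually_mono[OF eventually_at_ball'[of 1]]) (auto simp: powr_diff)
    ultimately have "((\<lambda>h::real. \<bar>(\<bar>h\<bar> powr p - \<bar>0\<bar> powr p) / (h - 0)\<bar>) \<longlongrightarrow> 0) (at 0)"
      using tendsto_cong[OF ev] by simp
    then show ?thesis using 2 by (simp add: has_field_derivative_iff flip: tendsto_rabs_zero_iff[of "\<lambda>y. \<bar>y\<bar> powr p / y"])
  next
    case 3
    have "((\<lambda>y. y powr p) has_real_derivative p * \<bar>y\<bar> powr (p - 1) * sgn y) (at y)"
      using 3 by (auto intro!: derivative_eq_intros simp: powr_diff)
    then show ?thesis
      by (rule has_field_derivative_transform_within_open[where S="{0<..}"]) (use 3 in auto)
  qed
qed

lemma continuous_on_abs_powr_sgn:
  fixes p :: real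
  assumes p: "1 < p"
  shows "continuous_on UNIV (\<lambda>y::real. \<bar>y\<bar> powr (p - 1) * sgn y)"
proof -
  have "continuous_on UNIV (\<lambda>y::real. max 0 y powr (p - 1) - max 0 (- y) powr (p - 1))"
    using p by (intro continuous_intros continuous_on_powr') auto
  moreover have "max 0 y powr (p - 1) - max 0 (- y) powr (p - 1) = \<bar>y\<bar> powr (p - 1) * sgn y" for y :: real
    by (auto simp: max_def sgn_if)
  ultimately show ?thesis by simp
qed

text \<open>The integrand is the divergence of the field x -> G(x) x: each coordinate function
  \<open>(x \<bullet> i) * G x\<close> has a partial derivative with integral 0, and these are
  summed over the basis.\<close>

lemma radial_divergence_integral:
  fixes G :: "'a::euclidean_space \<Rightarrow> real"
  assumes D: "\<And>x. (G has_derivative G' x) (at x)" and R: "\<And>x. R \<le> norm x \<Longrightarrow> G x = 0"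
    and c: "\<And>i. i \<in> Basis \<Longrightarrow> continuous_on UNIV (\<lambda>x. G' x i)"
  shows "integrable lborel (\<lambda>x. DIM('a) * G x + G' x x)"
    "(\<integral>x. DIM('a) * G x + G' x x \<partial>lborel) = 0"
proof -
  have cG: "continuous_on UNIV G"
    using D has_derivative_continuous by (fastforce simp: continuous_on_eq_continuous_at)
  have D': "((\<lambda>x. (x \<bullet> i) * G x) has_derivative (\<lambda>h. (x \<bullet> i) * G' x h + (h \<bullet> i) * G x)) (at x)" for x i
    by (rule has_derivative_mult[OF _ D]) (auto intro!: derivative_eq_intros)
  have c': "continuous_on UNIV (\<lambda>x. (x \<bullet> i) * G' x i + (i \<bullet> i) * G x)" if "i \<in> Basis" for i
    by (intro continuous_intros c that cG)
  have R': "(x \<bullet> i) * G x = 0" if "R \<le> norm x" for x i using R[OF that] by simp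
  note I = integral_directional_derivative[OF D' R' c']
  have eq: "(\<Sum>i\<in>(Basis::'a set). (x \<bullet> i) * G' x i + (i \<bullet> i) * G x) = DIM('a) * G x + G' x x" for x
  proof -
    interpret linear "G' x" using D has_derivative_linear by blast
    have "G' x (\<Sum>i\<in>Basis. (x \<bullet> i) *\<^sub>R i) = (\<Sum>i\<in>Basis. (x \<bullet> i) * G' x i)"
      by (simp add: sum scaleR del: euclidean_representation)
    then show ?thesis by (simp add: euclidean_representation sum.distrib)
  qed
  have "integrable lborel (\<lambda>x. \<Sum>i\<in>Basis. (x \<bullet> i) * G' x i + (i \<bullet> i) * G x)"
    by (intro Bochner_Integration.integrable_sum I(1))
  then show "integrable lborel (\<lambda>x. DIM('a) * G x + G' x x)" by (simp only: eq)
  have "(\<integral>x. (\<Sum>i\<in>Basis. (x \<bullet> i) * G' x i + (i \<bullet> i) * G x) \<partial>lborel) = 0"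
    by (subst Bochner_Integration.integral_sum) (auto simp: I simp del: inner_same_Basis)
  then show "(\<integral>x. DIM('a) * G x + G' x x \<partial>lborel) = 0" by (simp only: eq)
qed

text \<open>Young's inequality for the factors l^(1/q) a^(p-1) and l^(-1/q) b with q = p/(p-1). The
  powers of l cancel in the product and give l and l^(1-p) on the right.\<close>

lemma Youngs_inequality_weighted:
  fixes a b l p :: real
  assumes p: "1 < p" and "0 \<le> a" "0 \<le> b" and l: "0 < l"
  shows "p * (a powr (p - 1) * b) \<le> (p - 1) * l * a powr p + l powr (1 - p) * b powr p"
proof -
  define q where "q = p / (p - 1)"
  have q: "1 < q" "1 / q + 1 / p = 1" "(p - 1) * q = p" using p by (auto simp: q_def field_simps)
  define A where "A = l powr (1 / q) * a powr (p - 1)"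
  define B where "B = l powr (- (1 / q)) * b"
  have AB: "A * B = a powr (p - 1) * b" using l by (simp add: A_def B_def powr_minus)
  have Aq: "A powr q = l * a powr p"
    using l q by (simp add: A_def powr_mult powr_powr)
  have "- (1 / q) * p = 1 - p" using p by (simp add: q_def)
  then have Bp: "B powr p = l powr (1 - p) * b powr p"
    using l by (simp add: B_def powr_mult powr_powr)
  have "A * B \<le> A powr q / q + B powr p / p"
    using q p assms by (intro Youngs_inequality) (auto simp: A_def B_def)
  then have "p * (a powr (p - 1) * b) \<le> p * (l * a powr p / q + l powr (1 - p) * b powr p / p)"
    unfolding AB Aq Bp using p by (intro mult_left_mono) auto
  also have "\<dots> = (p - 1) * l * a powr p + l powr (1 - p) * b powr p"
    using p by (simp add: q_def field_simps)
  finally show ?thesis .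
qed

text \<open>The singular weight |x|^-p, regularised to (|x|^2 + e)^(-p/2). It is differentiable at
  the origin, so the divergence identity holds on the whole space, it is bounded for fixed e, and it
  stays below |x|^-p. Differentiation raises the exponent from p to p + 2.\<close>

definition hardy_weight :: "real \<Rightarrow> real \<Rightarrow> 'a::euclidean_space \<Rightarrow> real" where
  "hardy_weight p e x = ((norm x)\<^sup>2 + e) powr (- p / 2)"

lemma hardy_weight_continuous: "0 < e \<Longrightarrow> continuous_on UNIV (hardy_weight p e)"
  unfolding hardy_weight_def
  by (intro continuous_intros ballI) (smt (verit) zero_le_power2)

lemma hardy_weight_has_derivative:
  assumes "0 < e"
  shows "(hardy_weight p e has_derivative (\<lambda>h. - p * (x \<bullet> h) * hardy_weight (p + 2) e x)) (at x)"
proof -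
  have pos: "0 < (norm x)\<^sup>2 + e" using assms by (simp add: add_nonneg_pos)
  have "((\<lambda>x. x \<bullet> x + e) has_derivative (\<lambda>h. 2 * (x \<bullet> h))) (at x)"
    by (auto intro!: derivative_eq_intros simp: inner_commute)
  moreover have "((\<lambda>t. t powr (- p / 2)) has_real_derivative (- p / 2) * ((norm x)\<^sup>2 + e) powr (- p / 2 - 1)) (at (x \<bullet> x + e))"
    using pos by (auto intro!: derivative_eq_intros simp: power2_norm_eq_inner)
  ultimately have "((\<lambda>x. (x \<bullet> x + e) powr (- p / 2)) has_derivative
      (\<lambda>h. (- p / 2) * ((norm x)\<^sup>2 + e) powr (- p / 2 - 1) * (2 * (x \<bullet> h)))) (at x)"
    by (rule has_derivative_compose[OF _ has_field_derivative_imp_has_derivative])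
  moreover have e: "- (p + 2) / 2 = - p / 2 - 1" by (simp add: field_simps)
  ultimately show ?thesis unfolding hardy_weight_def e
    by (simp add: power2_norm_eq_inner mult.assoc mult.left_commute mult.commute)
qed

lemma hardy_weight_pos: "0 < e \<Longrightarrow> 0 < hardy_weight p e x"
  by (simp add: hardy_weight_def add_nonneg_eq_0_iff)

lemma hardy_weight_le: "0 < e \<Longrightarrow> 0 < p \<Longrightarrow> hardy_weight p e x \<le> e powr (- p / 2)"
  unfolding hardy_weight_def by (intro powr_mono2') auto

lemma norm_powr_eq: "x \<noteq> 0 \<Longrightarrow> ((norm x)\<^sup>2) powr (- p / 2) = 1 / norm x powr p"
  by (simp add: powr_powr powr_minus inverse_eq_divide flip: powr_numeral)

lemma hardy_weight_le_norm: "0 < e \<Longrightarrow> 0 < p \<Longrightarrow> x \<noteq> 0 \<Longrightarrow> hardy_weight p e x \<le> 1 / norm x powr p"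
  unfolding hardy_weight_def norm_powr_eq[symmetric] by (intro powr_mono2') auto

lemma hardy_weight_tendsto:
  assumes "x \<noteq> 0"
  shows "(\<lambda>n. hardy_weight p (1 / Suc n) x) \<longlonglongrightarrow> 1 / norm x powr p"
proof -
  have "(\<lambda>n. (norm x)\<^sup>2 + 1 / Suc n) \<longlonglongrightarrow> (norm x)\<^sup>2 + 0"
    using LIMSEQ_inverse_real_of_nat by (intro tendsto_add tendsto_const) (simp add: inverse_eq_divide)
  then have "(\<lambda>n. ((norm x)\<^sup>2 + 1 / Suc n) powr (- p / 2)) \<longlonglongrightarrow> ((norm x)\<^sup>2 + 0) powr (- p / 2)"
    by (rule tendsto_powr[OF _ tendsto_const]) (use assms in auto)
  then show ?thesis using norm_powr_eq[OF assms, of p] unfolding hardy_weight_def by simp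
qed

text \<open>
  The right-hand side is the divergence of \<open>x \<mapsto> W(x) \<eta>(x) |\<phi>(x)|\<^sup>p x\<close>, with \<open>h = \<eta>(x)\<close>, \<open>d = x \<cdot> \<nabla>\<eta>(x)\<close>,
  \<open>y = \<phi>(x)\<close> and \<open>g = \<nabla>\<phi>(x)\<close>; it integrates to 0. The weight \<open>l\<close> in Young's inequality is the one
  that yields the sharp constant \<open>l\<^sup>p\<close>.
\<close>

lemma hardy_pointwise:
  fixes g x :: "'a::euclidean_space"
  assumes p: "1 < p" and N: "p < N" and e: "0 < e" and h: "0 \<le> h" and d: "\<bar>d\<bar> \<le> z"
  defines "l \<equiv> (N - p) / p" and "W \<equiv> hardy_weight p e x" and "V \<equiv> hardy_weight (p + 2) e x"
  shows "l * (h * W * \<bar>y\<bar> powr p) - l powr (1 - p) * (h * norm g powr p) - z * W * \<bar>y\<bar> powr p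
    \<le> N * (W * (h * \<bar>y\<bar> powr p)) + (W * (h * (p * \<bar>y\<bar> powr (p - 1) * sgn y * (g \<bullet> x)) + d * \<bar>y\<bar> powr p) +
       (- p * (x \<bullet> x) * V) * (h * \<bar>y\<bar> powr p))"
proof -
  define m where "m = (norm x)\<^sup>2 + e"
  have m: "0 < m" using e by (simp add: m_def add_nonneg_pos)
  \<comment> \<open>The p-th root of W. Splitting W as w times w^(p-1) spends one factor w on |x|,
    where w |x| <= 1, and leaves (w |y|)^(p-1) |g| for Young's inequality.\<close>
  define w where "w = m powr (- 1 / 2)"
  have w: "0 < w" using m by (simp add: w_def)
  have l: "0 < l" using p N by (simp add: l_def)
  have Ww: "W = w powr p" using m by (simp add: W_def w_def hardy_weight_def m_def powr_powr)
  have WV: "W = m * V"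
  proof -
    have "m powr 1 * m powr (- (p + 2) / 2) = m powr (- p / 2)"
      unfolding powr_add[symmetric] by (simp add: field_simps)
    then show ?thesis using m by (simp add: W_def V_def hardy_weight_def m_def)
  qed
  have V: "0 \<le> V" by (simp add: V_def hardy_weight_def)
  have W: "0 \<le> W" by (simp add: W_def hardy_weight_def)
  \<comment> \<open>Since W = (|x|^2 + e) V, the regularisation errs in the favourable direction:
    the derivative of the weight costs at most p W.\<close>
  have xV: "(x \<bullet> x) * V \<le> W"
    unfolding WV using e V by (intro mult_right_mono) (auto simp: m_def power2_norm_eq_inner)
  have wx: "w * norm x \<le> 1"
  proof -
    have "m powr (- 1 / 2) * m powr (- 1 / 2) = m powr (- 1)" unfolding powr_add[symmetric] by simp
    then have "w\<^sup>2 = 1 / m" using m by (simp add: w_def power2_eq_square powr_minus_divide)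
    then have "(w * norm x)\<^sup>2 \<le> 1" using m e by (simp add: power_mult_distrib m_def)
    then show ?thesis using power2_le_imp_le[of "w * norm x" 1] by simp
  qed
  define Y where "Y = \<bar>y\<bar> powr p"
  have Y: "0 \<le> Y" by (simp add: Y_def)
  define Q where "Q = W * (h * (p * \<bar>y\<bar> powr (p - 1) * sgn y * (g \<bullet> x)))"
  have "\<bar>Q\<bar> = p * h * (W * \<bar>y\<bar> powr (p - 1) * \<bar>sgn y\<bar> * \<bar>g \<bullet> x\<bar>)"
    using W h p by (simp add: Q_def abs_mult)
  also have "\<dots> \<le> p * h * (W * \<bar>y\<bar> powr (p - 1) * 1 * (norm g * norm x))"
    using W h p by (intro mult_left_mono mult_mono Cauchy_Schwarz_ineq2) (auto simp: sgn_if)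
  also have "\<dots> = p * h * ((w * norm x) * ((w * \<bar>y\<bar>) powr (p - 1) * norm g))"
  proof -
    have "w powr p = w powr 1 * w powr (p - 1)" unfolding powr_add[symmetric] by simp
    then show ?thesis using w by (simp add: Ww powr_mult)
  qed
  also have "\<dots> \<le> p * h * (1 * ((w * \<bar>y\<bar>) powr (p - 1) * norm g))"
    using wx h p by (intro mult_left_mono mult_right_mono) auto
  also have "\<dots> = h * (p * ((w * \<bar>y\<bar>) powr (p - 1) * norm g))" by simp
  also have "\<dots> \<le> h * ((p - 1) * l * (w * \<bar>y\<bar>) powr p + l powr (1 - p) * norm g powr p)"
    using Youngs_inequality_weighted[OF p, of "w * \<bar>y\<bar>" "norm g" l] w l h by (intro mult_left_mono) auto
  also have "(w * \<bar>y\<bar>) powr p = W * Y" using w by (simp add: powr_mult Ww Y_def)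
  finally have Q: "- Q \<le> h * ((p - 1) * l * (W * Y) + l powr (1 - p) * norm g powr p)" by linarith
  have d2: "- (W * (d * Y)) \<le> z * W * Y"
  proof -
    have "(- d) * (W * Y) \<le> z * (W * Y)" using d W Y by (intro mult_right_mono) auto
    then show ?thesis by (simp add: mult.commute mult.left_commute mult.assoc)
  qed
  have v2: "p * ((x \<bullet> x) * V) * (h * Y) \<le> p * W * (h * Y)"
    using xV p h Y by (intro mult_right_mono mult_left_mono) auto
  \<comment> \<open>The budget of the dimension N: p pays for the derivative of the weight, (p-1) l
    for the first term of Young's inequality, and the remaining l is the left-hand side of the
    claim.\<close>
  have "N - p = p * l" using p by (simp add: l_def)
  then have Nl: "N * (W * (h * Y)) = p * W * (h * Y) + (p - 1) * l * (h * (W * Y)) + l * (h * (W * Y))"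
    by (simp add: algebra_simps)
  show ?thesis
    using Q d2 v2 Nl unfolding Q_def[symmetric] Y_def[symmetric] distrib_left[of W]
    by (simp add: algebra_simps)
qed

text \<open>The pointwise estimate integrated: the divergence on its right side disappears, and all
  integrands are continuous with bounded support. \<xi> only has to dominate |x . grad \<eta>|, so
  that the error term has a continuous weight.\<close>

lemma hardy_test_function:
  fixes \<phi> \<eta> \<xi> :: "'a::euclidean_space \<Rightarrow> real" and p :: real
  assumes p: "1 < p" "p < DIM('a)" and \<phi>: "\<phi> \<in> test_functions \<Omega>" and e: "0 < e"
    and \<eta>: "\<And>x. (\<eta> has_derivative \<eta>' x) (at x)" "\<And>x. 0 \<le> \<eta> x"
    and c\<eta>: "\<And>i. i \<in> Basis \<Longrightarrow> continuous_on UNIV (\<lambda>x. \<eta>' x i)"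
    and \<xi>: "continuous_on UNIV \<xi>" "\<And>x. \<bar>\<eta>' x x\<bar> \<le> \<xi> x"
  shows "ennreal (((DIM('a) - p) / p) powr p) * (\<integral>\<^sup>+x. ennreal (\<eta> x * hardy_weight p e x) * ennreal (norm (\<phi> x) powr p) \<partial>lborel) \<le>
    (\<integral>\<^sup>+x. ennreal (\<eta> x) * ennreal (norm (grad \<phi> x) powr p) \<partial>lborel) +
    ennreal (((DIM('a) - p) / p) powr (p - 1)) * (\<integral>\<^sup>+x. ennreal (\<xi> x * hardy_weight p e x) * ennreal (norm (\<phi> x) powr p) \<partial>lborel)"
proof -
  note td = test_functionD[OF \<phi>]
  obtain R where R: "0 < R" "\<And>x. R \<le> norm x \<Longrightarrow> \<phi> x = 0" by (rule test_function_support[OF \<phi>]) blast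
  define l where "l = (DIM('a) - p) / p"
  have l: "0 < l" using p by (simp add: l_def)
  define W where "W = (hardy_weight p e :: 'a \<Rightarrow> real)"
  define V where "V = (hardy_weight (p + 2) e :: 'a \<Rightarrow> real)"
  have W0: "0 \<le> W x" for x by (simp add: W_def hardy_weight_def)
  have cW: "continuous_on UNIV W" "continuous_on UNIV V"
    unfolding W_def V_def using e by (auto intro: hardy_weight_continuous)
  have c\<eta>0: "continuous_on UNIV \<eta>"
    using \<eta>(1) has_derivative_continuous by (fastforce simp: continuous_on_eq_continuous_at)
  have \<xi>0: "0 \<le> \<xi> x" for x using \<xi>(2)[of x] by linarith
  have cP: "continuous_on UNIV (\<lambda>x. \<bar>\<phi> x\<bar> powr p)"
    using p by (intro continuous_on_powr' continuous_intros td(2)) auto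
  have cS: "continuous_on UNIV (\<lambda>x. \<bar>\<phi> x\<bar> powr (p - 1) * sgn (\<phi> x))"
    by (rule continuous_on_compose2[OF continuous_on_abs_powr_sgn[OF p(1)] td(2)]) auto
  define G where "G x = W x * (\<eta> x * \<bar>\<phi> x\<bar> powr p)" for x
  define G' where "G' x h = W x * (\<eta> x * (p * \<bar>\<phi> x\<bar> powr (p - 1) * sgn (\<phi> x) * (grad \<phi> x \<bullet> h)) + \<eta>' x h * \<bar>\<phi> x\<bar> powr p) +
       (- p * (x \<bullet> h) * V x) * (\<eta> x * \<bar>\<phi> x\<bar> powr p)" for x h
  have DG: "(G has_derivative G' x) (at x)" for x
  proof -
    have "((\<lambda>x. \<bar>\<phi> x\<bar> powr p) has_derivative (\<lambda>h. p * \<bar>\<phi> x\<bar> powr (p - 1) * sgn (\<phi> x) * (grad \<phi> x \<bullet> h))) (at x)"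
      using has_derivative_compose[OF td(1) has_field_derivative_imp_has_derivative[OF has_derivative_abs_powr[OF p(1)]], of x]
      by (simp add: grad_inner[OF td(1)])
    from has_derivative_mult[OF hardy_weight_has_derivative[OF e] has_derivative_mult[OF \<eta>(1) this]]
    show ?thesis unfolding G_def G'_def W_def V_def .
  qed
  have cG': "continuous_on UNIV (\<lambda>x. G' x i)" if "i \<in> Basis" for i
  proof -
    have "continuous_on UNIV (\<lambda>x. W x * (\<eta> x * (p * (\<bar>\<phi> x\<bar> powr (p - 1) * sgn (\<phi> x)) * (grad \<phi> x \<bullet> i)) + \<eta>' x i * \<bar>\<phi> x\<bar> powr p) +
       (- p * (x \<bullet> i) * V x) * (\<eta> x * \<bar>\<phi> x\<bar> powr p))"
      by (intro continuous_intros cW c\<eta>0 cS cP c\<eta> that continuous_grad[OF \<phi>])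
    then show ?thesis by (simp add: G'_def mult.assoc)
  qed
  have G0: "G x = 0" if "R \<le> norm x" for x using R(2)[OF that] p by (simp add: G_def)
  note I = radial_divergence_integral[OF DG G0 cG']
  have grad0: "grad \<phi> x = 0" if "R < norm x" for x
    using derivative_eq_0_outside[OF td(1) R(2) that] by (simp add: grad_def)
  define f1 where "f1 x = \<eta> x * W x * \<bar>\<phi> x\<bar> powr p" for x
  define f2 where "f2 x = \<eta> x * norm (grad \<phi> x) powr p" for x
  define f3 where "f3 x = \<xi> x * W x * \<bar>\<phi> x\<bar> powr p" for x
  have nn: "0 \<le> f1 x" "0 \<le> f2 x" "0 \<le> f3 x" for x using \<eta>(2) W0 \<xi>0 by (auto simp: f1_def f2_def f3_def)
  have i1: "integrable lborel f1" unfolding f1_def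
    by (rule integrable_continuous_bounded_support[of _ R]) (use R p in \<open>auto intro!: continuous_intros cW c\<eta>0 cP\<close>)
  have i2: "integrable lborel f2" unfolding f2_def
    by (rule integrable_continuous_bounded_support[of _ R]) (use grad0 p in \<open>auto intro!: continuous_on_mult[OF c\<eta>0] continuous_on_powr' continuous_on_norm continuous_grad[OF \<phi>]\<close>)
  have i3: "integrable lborel f3" unfolding f3_def
    by (rule integrable_continuous_bounded_support[of _ R]) (use R p in \<open>auto intro!: continuous_intros cW \<xi>(1) cP\<close>)
  have "(\<integral>x. l * f1 x - l powr (1 - p) * f2 x - f3 x \<partial>lborel) \<le> (\<integral>x. DIM('a) * G x + G' x x \<partial>lborel)"
  proof (rule integral_mono)
    show "integrable lborel (\<lambda>x. l * f1 x - l powr (1 - p) * f2 x - f3 x)" using i1 i2 i3 by auto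
    show "integrable lborel (\<lambda>x. DIM('a) * G x + G' x x)" by (rule I(1))
    show "l * f1 x - l powr (1 - p) * f2 x - f3 x \<le> DIM('a) * G x + G' x x" for x
      unfolding f1_def f2_def f3_def G_def G'_def l_def W_def V_def
      by (rule hardy_pointwise[OF p(1) p(2) e \<eta>(2) \<xi>(2)])
  qed
  then have le: "l * (\<integral>x. f1 x \<partial>lborel) \<le> l powr (1 - p) * (\<integral>x. f2 x \<partial>lborel) + (\<integral>x. f3 x \<partial>lborel)"
    using i1 i2 i3 I(2) by simp
  \<comment> \<open>Multiplication by l^(p-1) normalises the gradient term and turns l into the
    sharp constant l^p; the cutoff error acquires the factor l^(p-1).\<close>
  have "l powr (p - 1) * (l * (\<integral>x. f1 x \<partial>lborel)) \<le> l powr (p - 1) * (l powr (1 - p) * (\<integral>x. f2 x \<partial>lborel) + (\<integral>x. f3 x \<partial>lborel))"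
    by (rule mult_left_mono[OF le]) simp
  moreover have "l powr (p - 1) * l = l powr p" "l powr (p - 1) * l powr (1 - p) = 1"
    using l powr_add[of l "p - 1" 1] powr_add[of l "p - 1" "1 - p"] by auto
  ultimately have fin: "l powr p * (\<integral>x. f1 x \<partial>lborel) \<le> (\<integral>x. f2 x \<partial>lborel) + l powr (p - 1) * (\<integral>x. f3 x \<partial>lborel)"
    by (metis distrib_left mult.assoc mult_1)
  have e1: "(\<integral>\<^sup>+x. ennreal (\<eta> x * hardy_weight p e x) * ennreal (norm (\<phi> x) powr p) \<partial>lborel) = ennreal (\<integral>x. f1 x \<partial>lborel)"
    using nn by (subst nn_integral_eq_integral[OF i1, symmetric]) (auto simp: f1_def W_def ennreal_mult'' intro!: nn_integral_cong)
  have e2: "(\<integral>\<^sup>+x. ennreal (\<eta> x) * ennreal (norm (grad \<phi> x) powr p) \<partial>lborel) = ennreal (\<integral>x. f2 x \<partial>lborel)"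
    using nn by (subst nn_integral_eq_integral[OF i2, symmetric]) (auto simp: f2_def W_def ennreal_mult' \<eta>(2) intro!: nn_integral_cong)
  have e3: "(\<integral>\<^sup>+x. ennreal (\<xi> x * hardy_weight p e x) * ennreal (norm (\<phi> x) powr p) \<partial>lborel) = ennreal (\<integral>x. f3 x \<partial>lborel)"
    using nn by (subst nn_integral_eq_integral[OF i3, symmetric]) (auto simp: f3_def W_def ennreal_mult'' intro!: nn_integral_cong)
  show ?thesis
    unfolding e1 e2 e3 l_def[symmetric] using ennreal_leI[OF fin] nn
    by (simp add: ennreal_mult' ennreal_plus integral_nonneg_AE)
qed

text \<open>Two limits in a fixed order. For fixed e all weights are bounded, so the L^p convergence
  of the approximants and of their gradients suffices. Afterwards e tends to 0: Fatou's lemma on the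
  left, while on the right the regularised weight is at most |x|^-p.\<close>

lemma hardy_localized:
  fixes u \<eta> \<xi> :: "'a::euclidean_space \<Rightarrow> real" and p :: real
  assumes p: "1 < p" "p < DIM('a)"
    and [measurable]: "u \<in> borel_measurable borel" "g \<in> borel_measurable borel"
    and \<phi>: "\<And>n. \<phi> n \<in> test_functions \<Omega>"
    and lim: "(\<lambda>n. \<integral>\<^sup>+x. ennreal (norm (\<phi> n x - u x) powr p) \<partial>lborel) \<longlonglongrightarrow> 0"
    and limg: "(\<lambda>n. \<integral>\<^sup>+x. ennreal (norm (grad (\<phi> n) x - g x) powr p) \<partial>lborel) \<longlonglongrightarrow> 0"
    and fin: "(\<integral>\<^sup>+x. ennreal (norm (u x) powr p) \<partial>lborel) < \<infinity>" "(\<integral>\<^sup>+x. ennreal (norm (g x) powr p) \<partial>lborel) < \<infinity>"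
    and \<eta>: "\<And>x. (\<eta> has_derivative \<eta>' x) (at x)" "\<And>x. 0 \<le> \<eta> x" "\<And>x. \<eta> x \<le> B"
    and c\<eta>: "\<And>i. i \<in> Basis \<Longrightarrow> continuous_on UNIV (\<lambda>x. \<eta>' x i)"
    and \<xi>: "continuous_on UNIV \<xi>" "\<And>x. \<bar>\<eta>' x x\<bar> \<le> \<xi> x" "\<And>x. \<xi> x \<le> B"
  shows "ennreal (C_H TYPE('a) p) * (\<integral>\<^sup>+x. ennreal (\<eta> x) * ennreal (\<bar>u x\<bar> powr p / norm x powr p) \<partial>lborel) \<le>
    (\<integral>\<^sup>+x. ennreal (\<eta> x) * ennreal (norm (g x) powr p) \<partial>lborel) +
    ennreal (((DIM('a) - p) / p) powr (p - 1)) * (\<integral>\<^sup>+x. ennreal (\<xi> x) * ennreal (\<bar>u x\<bar> powr p / norm x powr p) \<partial>lborel)"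
    (is "?C * ?L \<le> ?G + ?c * ?X")
proof -
  have c\<eta>0: "continuous_on UNIV \<eta>"
    using \<eta>(1) has_derivative_continuous by (fastforce simp: continuous_on_eq_continuous_at)
  have \<xi>0: "0 \<le> \<xi> x" for x using \<xi>(2)[of x] by linarith
  have [measurable]: "\<eta> \<in> borel_measurable borel" "\<xi> \<in> borel_measurable borel"
    using c\<eta>0 \<xi>(1) borel_measurable_continuous_onI by blast+
  have [measurable]: "\<phi> n \<in> borel_measurable borel" "grad (\<phi> n) \<in> borel_measurable borel" for n
    using test_functionD(2)[OF \<phi>] continuous_grad[OF \<phi>] borel_measurable_continuous_onI by blast+
  have [measurable]: "hardy_weight p e \<in> borel_measurable borel" for e unfolding hardy_weight_def by measurable
  have step: "?C * (\<integral>\<^sup>+x. ennreal (\<eta> x * hardy_weight p e x) * ennreal (norm (u x) powr p) \<partial>lborel) \<le> ?G + ?c * ?X"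
    if e: "0 < e" for e
  proof -
    have w: "ennreal (f x * hardy_weight p e x) \<le> ennreal (B * e powr (- p / 2))" if "0 \<le> f x" "f x \<le> B" for f and x :: 'a
      using that hardy_weight_le[OF e, of p x] hardy_weight_pos[OF e, of p x] p by (intro ennreal_leI mult_mono) auto
    have 1: "(\<lambda>n. ?C * (\<integral>\<^sup>+x. ennreal (\<eta> x * hardy_weight p e x) * ennreal (norm (\<phi> n x) powr p) \<partial>lborel)) \<longlonglongrightarrow>
       ?C * (\<integral>\<^sup>+x. ennreal (\<eta> x * hardy_weight p e x) * ennreal (norm (u x) powr p) \<partial>lborel)"
      by (intro ennreal_tendsto_cmult nn_integral_powr_tendsto[where B="B * e powr (- p / 2)"] w)
        (use p lim fin \<eta> in auto)
    have 2: "(\<lambda>n. \<integral>\<^sup>+x. ennreal (\<eta> x) * ennreal (norm (grad (\<phi> n) x) powr p) \<partial>lborel) \<longlonglongrightarrow> ?G"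
      by (intro nn_integral_powr_tendsto[where B=B]) (use p limg fin \<eta> in \<open>auto intro: ennreal_leI\<close>)
    have 3: "(\<lambda>n. ?c * (\<integral>\<^sup>+x. ennreal (\<xi> x * hardy_weight p e x) * ennreal (norm (\<phi> n x) powr p) \<partial>lborel)) \<longlonglongrightarrow>
       ?c * (\<integral>\<^sup>+x. ennreal (\<xi> x * hardy_weight p e x) * ennreal (norm (u x) powr p) \<partial>lborel)"
      by (intro ennreal_tendsto_cmult nn_integral_powr_tendsto[where B="B * e powr (- p / 2)"] w)
        (use p lim fin \<xi> \<xi>0 in auto)
    have "?C * (\<integral>\<^sup>+x. ennreal (\<eta> x * hardy_weight p e x) * ennreal (norm (u x) powr p) \<partial>lborel) \<le>
      ?G + ?c * (\<integral>\<^sup>+x. ennreal (\<xi> x * hardy_weight p e x) * ennreal (norm (u x) powr p) \<partial>lborel)"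
      by (rule LIMSEQ_le[OF 1 tendsto_add[OF 2 3]])
        (use hardy_test_function[OF p \<phi> e \<eta>(1,2) c\<eta> \<xi>(1,2)] in \<open>auto simp: C_H_def\<close>)
    also have "\<dots> \<le> ?G + ?c * ?X"
    proof (intro add_left_mono mult_left_mono nn_integral_mono_AE)
      show "AE x in lborel. ennreal (\<xi> x * hardy_weight p e x) * ennreal (norm (u x) powr p) \<le> ennreal (\<xi> x) * ennreal (\<bar>u x\<bar> powr p / norm x powr p)"
        using AE_lborel_singleton[of "0::'a"]
      proof eventually_elim
        case (elim x)
        have "\<xi> x * (hardy_weight p e x * norm (u x) powr p) \<le> \<xi> x * (1 / norm x powr p * \<bar>u x\<bar> powr p)"
        proof (intro mult_left_mono \<xi>0)
          show "hardy_weight p e x * norm (u x) powr p \<le> 1 / norm x powr p * \<bar>u x\<bar> powr p"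
            unfolding real_norm_def using hardy_weight_le_norm[OF e _ elim, of p] p by (intro mult_right_mono) auto
        qed
        then show ?case
          using \<xi>0[of x] hardy_weight_pos[OF e, of p x]
          by (simp add: ennreal_mult[symmetric] ennreal_leI mult.assoc)
      qed
    qed simp
    finally show ?thesis .
  qed
  have "?C * ?L = (\<integral>\<^sup>+x. ?C * (ennreal (\<eta> x) * ennreal (\<bar>u x\<bar> powr p / norm x powr p)) \<partial>lborel)"
    by (rule nn_integral_cmult[symmetric]) measurable
  also have "\<dots> \<le> (\<integral>\<^sup>+x. liminf (\<lambda>n. ?C * (ennreal (\<eta> x * hardy_weight p (1 / Suc n) x) * ennreal (norm (u x) powr p))) \<partial>lborel)"
  proof (intro nn_integral_mono_AE)
    show "AE x in lborel. ?C * (ennreal (\<eta> x) * ennreal (\<bar>u x\<bar> powr p / norm x powr p))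
       \<le> liminf (\<lambda>n. ?C * (ennreal (\<eta> x * hardy_weight p (1 / Suc n) x) * ennreal (norm (u x) powr p)))"
      using AE_lborel_singleton[of "0::'a"]
    proof eventually_elim
      case (elim x)
      have "(\<lambda>n. ennreal (\<eta> x * hardy_weight p (1 / Suc n) x * norm (u x) powr p)) \<longlonglongrightarrow> ennreal (\<eta> x * (1 / norm x powr p) * norm (u x) powr p)"
        by (intro tendsto_ennrealI tendsto_mult hardy_weight_tendsto elim tendsto_const)
      then have "(\<lambda>n. ennreal (\<eta> x * hardy_weight p (1 / Suc n) x) * ennreal (norm (u x) powr p)) \<longlonglongrightarrow> ennreal (\<eta> x) * ennreal (\<bar>u x\<bar> powr p / norm x powr p)"
        using \<eta>(2)[of x] by (simp add: ennreal_mult'' ennreal_mult'[symmetric])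
      then have "(\<lambda>n. ?C * (ennreal (\<eta> x * hardy_weight p (1 / Suc n) x) * ennreal (norm (u x) powr p))) \<longlonglongrightarrow> ?C * (ennreal (\<eta> x) * ennreal (\<bar>u x\<bar> powr p / norm x powr p))"
        by (intro ennreal_tendsto_cmult) auto
      from lim_imp_Liminf[OF _ this] show ?case by simp
    qed
  qed
  also have "\<dots> \<le> liminf (\<lambda>n. \<integral>\<^sup>+x. ?C * (ennreal (\<eta> x * hardy_weight p (1 / Suc n) x) * ennreal (norm (u x) powr p)) \<partial>lborel)"
    by (intro nn_integral_liminf) measurable
  also have "\<dots> \<le> ?G + ?c * ?X"
  proof (rule order_trans[OF Liminf_le_Limsup Limsup_bounded])
    show "\<forall>\<^sub>F n in sequentially. (\<integral>\<^sup>+x. ?C * (ennreal (\<eta> x * hardy_weight p (1 / Suc n) x) * ennreal (norm (u x) powr p)) \<partial>lborel) \<le> ?G + ?c * ?X"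
    proof (intro always_eventually allI)
      fix n
      show "(\<integral>\<^sup>+x. ?C * (ennreal (\<eta> x * hardy_weight p (1 / Suc n) x) * ennreal (norm (u x) powr p)) \<partial>lborel) \<le> ?G + ?c * ?X"
        using step[of "1 / Suc n"] by (subst nn_integral_cmult) auto
    qed
  qed simp
  finally show ?thesis .
qed

section \<open>Bounded functionals and compactness on \<open>X(\<Omega>)\<close>\<close>

text \<open>Linear in u, and with an exponent such that the p-th power is the Gagliardo integrand;
  the seminorm thus becomes an L^p norm over the product space. On the diagonal the value is
  0.\<close>

definition diff_quotient :: "real \<Rightarrow> real \<Rightarrow> ('a::euclidean_space \<Rightarrow> real) \<Rightarrow> 'a \<times> 'a \<Rightarrow> real" where
  "diff_quotient p s u z = (u (fst z) - u (snd z)) / norm (fst z - snd z) powr ((real DIM('a) + p * s) / p)"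

lemma diff_quotient_measurable [measurable]:
  fixes u :: "'a::euclidean_space \<Rightarrow> real"
  assumes [measurable]: "u \<in> borel_measurable borel"
  shows "diff_quotient p s u \<in> borel_measurable (lborel \<Otimes>\<^sub>M lborel)"
  unfolding diff_quotient_def by measurable

lemma norm_diff_quotient_powr:
  fixes u :: "'a::euclidean_space \<Rightarrow> real"
  assumes "0 < p"
  shows "norm (diff_quotient p s u z) powr p = \<bar>u (fst z) - u (snd z)\<bar> powr p / norm (fst z - snd z) powr (real DIM('a) + p * s)"
  using assms by (simp add: diff_quotient_def abs_mult powr_divide powr_powr)

lemma frac_density_measurable [measurable]:
  fixes u :: "'a::euclidean_space \<Rightarrow> real"
  assumes [measurable]: "u \<in> borel_measurable borel"
  shows "frac_density p s u \<in> borel_measurable borel"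
  unfolding frac_density_def by measurable

lemma frac_density_diff_quotient:
  fixes u :: "'a::euclidean_space \<Rightarrow> real"
  assumes "0 < p"
  shows "frac_density p s u x = (\<integral>\<^sup>+y. ennreal (norm (diff_quotient p s u (x, y)) powr p) \<partial>lborel)"
  using assms by (simp add: frac_density_def norm_diff_quotient_powr del: real_norm_def)

lemma weighted_gagliardo:
  fixes u :: "'a::euclidean_space \<Rightarrow> real"
  assumes "0 < p" and [measurable]: "u \<in> borel_measurable borel" "f \<in> borel_measurable borel"
  shows "(\<integral>\<^sup>+z. f (fst z) * ennreal (norm (diff_quotient p s u z) powr p) \<partial>(lborel \<Otimes>\<^sub>M lborel)) =
    (\<integral>\<^sup>+x. f x * frac_density p s u x \<partial>lborel)"
proof -
  have "(\<integral>\<^sup>+z. f (fst z) * ennreal (norm (diff_quotient p s u z) powr p) \<partial>(lborel \<Otimes>\<^sub>M lborel)) =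
    (\<integral>\<^sup>+x. \<integral>\<^sup>+y. f x * ennreal (norm (diff_quotient p s u (x, y)) powr p) \<partial>lborel \<partial>lborel)"
    by (subst lborel.nn_integral_fst[symmetric]) (auto simp del: real_norm_def)
  also have "\<dots> = (\<integral>\<^sup>+x. f x * frac_density p s u x \<partial>lborel)"
    by (simp add: frac_density_diff_quotient assms(1) nn_integral_cmult del: real_norm_def)
  finally show ?thesis .
qed

lemma gagliardo_diff_quotient:
  fixes u :: "'a::euclidean_space \<Rightarrow> real"
  assumes "0 < p" "u \<in> borel_measurable borel"
  shows "(\<integral>\<^sup>+z. ennreal (norm (diff_quotient p s u z) powr p) \<partial>(lborel \<Otimes>\<^sub>M lborel)) = gagliardo p s u"
  using weighted_gagliardo[OF assms, of "\<lambda>_. 1"] by (simp add: gagliardo_def)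

lemma gagliardo_diff_le:
  fixes u v :: "'a::euclidean_space \<Rightarrow> real"
  assumes p: "1 \<le> p" and [measurable]: "u \<in> borel_measurable borel" "v \<in> borel_measurable borel"
  shows "gagliardo p s (\<lambda>x. u x - v x) \<le> ennreal (2 powr (p - 1)) * (gagliardo p s u + gagliardo p s v)"
proof -
  have "diff_quotient p s (\<lambda>x. u x - v x) z = diff_quotient p s u z - diff_quotient p s v z" for z
    by (simp add: diff_quotient_def diff_divide_distrib[symmetric])
  then show ?thesis
    using nn_integral_powr_diff_le[of "diff_quotient p s u" "lborel \<Otimes>\<^sub>M lborel" "diff_quotient p s v" p] p
    by (simp add: gagliardo_diff_quotient[symmetric])
qed

section \<open>Elements of X(\<Omega>), bounded functionals and the Poincare inequality\<close>

lemma X_spaceD: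
  assumes "u \<in> X_space p s \<Omega>"
  shows "u \<in> borel_measurable borel" "is_weak_gradient u (weak_grad u)"
    "weak_grad u \<in> borel_measurable borel" "locally_integrable u"
    "AE x in lborel. x \<notin> \<Omega> \<longrightarrow> u x = 0" "X_energy p s u < \<infinity>"
    "(\<integral>\<^sup>+x. ennreal (norm (weak_grad u x) powr p) \<partial>lborel) < \<infinity>" "gagliardo p s u < \<infinity>"
proof -
  show w: "is_weak_gradient u (weak_grad u)"
    using assms is_weak_gradient_weak_grad by (auto simp: X_space_def)
  then show "weak_grad u \<in> borel_measurable borel" "locally_integrable u"
    by (auto simp: is_weak_gradient_def locally_integrable_def)
  show "u \<in> borel_measurable borel" "AE x in lborel. x \<notin> \<Omega> \<longrightarrow> u x = 0" and e: "X_energy p s u < \<infinity>"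
    using assms by (auto simp: X_space_def)
  from e show "(\<integral>\<^sup>+x. ennreal (norm (weak_grad u x) powr p) \<partial>lborel) < \<infinity>" "gagliardo p s u < \<infinity>"
    by (auto simp: X_energy_def)
qed

text \<open>Common core of three kinds of functionals, with T the weak gradient, the difference
  quotient or the identity: Hoelder's inequality gives the bound. Linearity of T is required only
  almost everywhere because \<open>weak_grad\<close> is a chosen representative.\<close>

lemma X_functional:
  fixes T :: "('a::euclidean_space \<Rightarrow> real) \<Rightarrow> 'b \<Rightarrow> 'e::euclidean_space"
  assumes p: "1 < p" and K: "0 \<le> K"
    and T[measurable]: "\<And>v. v \<in> X_space p s \<Omega> \<Longrightarrow> T v \<in> borel_measurable M"
    and bound: "\<And>v. v \<in> X_space p s \<Omega> \<Longrightarrow> (\<integral>\<^sup>+x. ennreal (norm (T v x) powr p) \<partial>M) \<le> ennreal K * X_energy p s v"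
    and add: "\<And>v w. v \<in> X_space p s \<Omega> \<Longrightarrow> w \<in> X_space p s \<Omega> \<Longrightarrow>
      T (\<lambda>x. v x + w x) \<in> borel_measurable M \<and> (AE x in M. T (\<lambda>x. v x + w x) x = T v x + T w x)"
    and cmult: "\<And>c v. v \<in> X_space p s \<Omega> \<Longrightarrow>
      T (\<lambda>x. c * v x) \<in> borel_measurable M \<and> (AE x in M. T (\<lambda>x. c * v x) x = c *\<^sub>R T v x)"
    and G[measurable]: "G \<in> borel_measurable M" and Gq: "(\<integral>\<^sup>+x. ennreal (norm (G x) powr (p / (p - 1))) \<partial>M) < \<infinity>"
  shows "(\<lambda>v. \<integral>x. G x \<bullet> T v x \<partial>M) \<in> X_dual p s \<Omega>"
proof -
  have fin: "(\<integral>\<^sup>+x. ennreal (norm (T v x) powr p) \<partial>M) < \<infinity>" if "v \<in> X_space p s \<Omega>" for v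
    by (rule le_less_trans[OF bound[OF that]]) (use X_spaceD(6)[OF that] in \<open>auto simp: ennreal_mult_less_top\<close>)
  have int: "integrable M (\<lambda>x. G x \<bullet> T v x)" if "v \<in> X_space p s \<Omega>" for v
    by (rule integrable_inner_Lp(1)[OF G T[OF that] p Gq fin[OF that]])
  show ?thesis
    unfolding X_dual_def
  proof (intro CollectI conjI ballI allI exI)
    fix v w assume v: "v \<in> X_space p s \<Omega>" and w: "w \<in> X_space p s \<Omega>"
    have "(\<integral>x. G x \<bullet> T (\<lambda>x. v x + w x) x \<partial>M) = (\<integral>x. G x \<bullet> T v x + G x \<bullet> T w x \<partial>M)"
      using add[OF v w] T[OF v] T[OF w] by (intro integral_cong_AE) (auto simp: inner_add_right elim!: eventually_mono)
    then show "(\<integral>x. G x \<bullet> T (\<lambda>x. v x + w x) x \<partial>M) = (\<integral>x. G x \<bullet> T v x \<partial>M) + (\<integral>x. G x \<bullet> T w x \<partial>M)"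
      using int[OF v] int[OF w] by simp
  next
    fix c v assume v: "v \<in> X_space p s \<Omega>"
    have "(\<integral>x. G x \<bullet> T (\<lambda>x. c * v x) x \<partial>M) = (\<integral>x. c * (G x \<bullet> T v x) \<partial>M)"
      using cmult[OF v, of c] T[OF v] by (intro integral_cong_AE) (auto elim!: eventually_mono)
    then show "(\<integral>x. G x \<bullet> T (\<lambda>x. c * v x) x \<partial>M) = c * (\<integral>x. G x \<bullet> T v x \<partial>M)" by simp
  next
    fix v assume v: "v \<in> X_space p s \<Omega>"
    define A where "A = enn2real (\<integral>\<^sup>+x. ennreal (norm (G x) powr (p / (p - 1))) \<partial>M) powr ((p - 1) / p)"
    have "\<bar>\<integral>x. G x \<bullet> T v x \<partial>M\<bar> \<le> A * enn2real (\<integral>\<^sup>+x. ennreal (norm (T v x) powr p) \<partial>M) powr (1 / p)"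
      unfolding A_def by (rule integrable_inner_Lp(2)[OF G T[OF v] p Gq fin[OF v]])
    also have "\<dots> \<le> A * (K * enn2real (X_energy p s v)) powr (1 / p)"
    proof (intro mult_left_mono powr_mono2)
      have "enn2real (\<integral>\<^sup>+x. ennreal (norm (T v x) powr p) \<partial>M) \<le> enn2real (ennreal K * X_energy p s v)"
        using bound[OF v] X_spaceD(6)[OF v] by (intro enn2real_mono) (auto simp: ennreal_mult_less_top)
      then show "enn2real (\<integral>\<^sup>+x. ennreal (norm (T v x) powr p) \<partial>M) \<le> K * enn2real (X_energy p s v)"
        using K by (simp add: enn2real_mult)
    qed (use p in \<open>auto simp: A_def\<close>)
    also have "\<dots> = (A * K powr (1 / p)) * X_norm p s v"
      using K by (simp add: X_norm_def powr_mult)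
    finally show "\<bar>\<integral>x. G x \<bullet> T v x \<partial>M\<bar> \<le> (enn2real (\<integral>\<^sup>+x. ennreal (norm (G x) powr (p / (p - 1))) \<partial>M) powr ((p - 1) / p) * K powr (1 / p)) * X_norm p s v"
      unfolding A_def .
  qed
qed

lemma X_functional_weak_grad:
  fixes G :: "'a::euclidean_space \<Rightarrow> 'a"
  assumes "1 < p" "G \<in> borel_measurable borel" "(\<integral>\<^sup>+x. ennreal (norm (G x) powr (p / (p - 1))) \<partial>lborel) < \<infinity>"
  shows "(\<lambda>v. \<integral>x. G x \<bullet> weak_grad v x \<partial>lborel) \<in> X_dual p s \<Omega>"
proof (rule X_functional[where K=1])
  fix v w :: "'a \<Rightarrow> real" and c :: real
  assume v: "v \<in> X_space p s \<Omega>"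
  show "weak_grad v \<in> borel_measurable lborel" using X_spaceD(3)[OF v] by simp
  show "(\<integral>\<^sup>+x. ennreal (norm (weak_grad v x) powr p) \<partial>lborel) \<le> ennreal 1 * X_energy p s v"
    by (simp add: X_energy_def)
  have m: "weak_grad f \<in> borel_measurable lborel" if "is_weak_gradient f g" for f g
    using is_weak_gradient_weak_grad[of f] that by (auto simp: is_weak_gradient_def locally_integrable_def)
  show "weak_grad (\<lambda>x. c * v x) \<in> borel_measurable lborel \<and> (AE x in lborel. weak_grad (\<lambda>x. c * v x) x = c *\<^sub>R weak_grad v x)"
    using is_weak_gradient_cmult[OF X_spaceD(2)[OF v], of c] m weak_grad_eq by blast
  assume w: "w \<in> X_space p s \<Omega>"
  show "weak_grad (\<lambda>x. v x + w x) \<in> borel_measurable lborel \<and> (AE x in lborel. weak_grad (\<lambda>x. v x + w x) x = weak_grad v x + weak_grad w x)"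
    using is_weak_gradient_add[OF X_spaceD(2)[OF v] X_spaceD(2)[OF w]] m weak_grad_eq by blast
qed (use assms in auto)

lemma X_functional_diff_quotient:
  fixes G :: "'a::euclidean_space \<times> 'a \<Rightarrow> real"
  assumes p: "1 < p" and "G \<in> borel_measurable (lborel \<Otimes>\<^sub>M lborel)"
    "(\<integral>\<^sup>+x. ennreal (norm (G x) powr (p / (p - 1))) \<partial>(lborel \<Otimes>\<^sub>M lborel)) < \<infinity>"
  shows "(\<lambda>v. \<integral>x. G x \<bullet> diff_quotient p s v x \<partial>(lborel \<Otimes>\<^sub>M lborel)) \<in> X_dual p s \<Omega>"
proof (rule X_functional[where K=1])
  fix v w :: "'a \<Rightarrow> real" and c :: real
  assume v: "v \<in> X_space p s \<Omega>"
  note [measurable] = X_spaceD(1)[OF v]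
  show "diff_quotient p s v \<in> borel_measurable (lborel \<Otimes>\<^sub>M lborel)" by measurable
  show "(\<integral>\<^sup>+x. ennreal (norm (diff_quotient p s v x) powr p) \<partial>(lborel \<Otimes>\<^sub>M lborel)) \<le> ennreal 1 * X_energy p s v"
    using p X_spaceD(1)[OF v] by (subst gagliardo_diff_quotient) (auto simp: X_energy_def)
  show "diff_quotient p s (\<lambda>x. c * v x) \<in> borel_measurable (lborel \<Otimes>\<^sub>M lborel) \<and>
    (AE x in (lborel \<Otimes>\<^sub>M lborel). diff_quotient p s (\<lambda>x. c * v x) x = c *\<^sub>R diff_quotient p s v x)"
    by (auto simp: diff_quotient_def right_diff_distrib[symmetric])
  assume w: "w \<in> X_space p s \<Omega>"
  note [measurable] = X_spaceD(1)[OF w]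
  show "diff_quotient p s (\<lambda>x. v x + w x) \<in> borel_measurable (lborel \<Otimes>\<^sub>M lborel) \<and>
    (AE x in (lborel \<Otimes>\<^sub>M lborel). diff_quotient p s (\<lambda>x. v x + w x) x = diff_quotient p s v x + diff_quotient p s w x)"
    by (auto simp: diff_quotient_def add_divide_distrib[symmetric])
qed (use assms in auto)

text \<open>For x in \<Omega> only those y are kept that lie in a ball S disjoint from \<Omega>.
  There u(y) = 0 and |x - y| is bounded, so the Gagliardo density at x is at least a fixed multiple
  of |u(x)|^p.\<close>

lemma gagliardo_Poincare:
  fixes \<Omega> :: "'a::euclidean_space set" and p s :: real
  assumes p: "0 < p" and s: "0 < s" and \<Omega>: "bounded \<Omega>"
  obtains K where "0 < K" "\<And>u. u \<in> borel_measurable borel \<Longrightarrow> (AE x in lborel. x \<notin> \<Omega> \<longrightarrow> u x = 0) \<Longrightarrow>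
    (\<integral>\<^sup>+x. ennreal (\<bar>u x\<bar> powr p) \<partial>lborel) \<le> ennreal K * gagliardo p s u"
proof -
  obtain R where R: "0 < R" "\<And>x. x \<in> \<Omega> \<Longrightarrow> norm x \<le> R" using \<Omega> by (auto simp: bounded_pos)
  obtain b :: 'a where b: "b \<in> Basis" using nonempty_Basis by blast
  \<comment> \<open>Centre at distance 3R and radius R put S between the radii 2R and 4R: disjoint
    from \<Omega>, whose points have norm at most R, and within distance 5R of each of them.\<close>
  define S where "S = ball ((3 * R) *\<^sub>R b) R"
  have Sn: "2 * R < norm y \<and> norm y < 4 * R" if "y \<in> S" for y
  proof -
    have "norm ((3 * R) *\<^sub>R b) = 3 * R" using b R by simp
    then show ?thesis
      using that norm_triangle_ineq2[of "(3 * R) *\<^sub>R b" y] norm_triangle_ineq2[of y "(3 * R) *\<^sub>R b"]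
      by (auto simp: S_def dist_norm norm_minus_commute)
  qed
  define D where "D = real DIM('a) + p * s"
  have D: "0 < D" using p s by (simp add: D_def add_pos_pos)
  define m where "m = measure lborel S"
  have m: "0 < m" "emeasure lborel S = ennreal m"
    using R content_ball_pos[of R] emeasure_lborel_ball_finite[of "(3 * R) *\<^sub>R b" R]
    by (auto simp: m_def S_def emeasure_eq_ennreal_measure less_top)
  define k where "k = m / (5 * R) powr D"
  have k: "0 < k" using m R by (simp add: k_def)
  show thesis
  proof (rule that[of "1 / k"])
    show "0 < 1 / k" using k by simp
    fix u :: "'a \<Rightarrow> real"
    assume [measurable]: "u \<in> borel_measurable borel" and z: "AE x in lborel. x \<notin> \<Omega> \<longrightarrow> u x = 0"
    have le: "AE x in lborel. ennreal (\<bar>u x\<bar> powr p) * ennreal k \<le> frac_density p s u x"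
      using z
    proof eventually_elim
      case (elim x)
      show ?case
      proof (cases "x \<in> \<Omega>")
        case True
        have "ennreal (\<bar>u x\<bar> powr p) * ennreal k = (\<integral>\<^sup>+y. ennreal (\<bar>u x\<bar> powr p / (5 * R) powr D) * indicator S y \<partial>lborel)"
          using m by (subst nn_integral_cmult_indicator) (auto simp: S_def k_def ennreal_mult[symmetric])
        also have "\<dots> \<le> frac_density p s u x"
          unfolding frac_density_def
        proof (rule nn_integral_mono_AE, use z in eventually_elim)
          case (elim y)
          show ?case
          proof (cases "y \<in> S")
            case inS: True
            then have "y \<notin> \<Omega>" using Sn[OF inS] R(2)[of y] R(1) by force
            then have uy: "u y = 0" using elim by simp
            have "norm (x - y) \<le> 5 * R"
              using norm_triangle_ineq4[of x y] R(2)[OF True] Sn[OF inS] by linarith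
            moreover have "0 < norm (x - y)" using \<open>y \<notin> \<Omega>\<close> True by auto
            ultimately have "\<bar>u x\<bar> powr p / (5 * R) powr D \<le> \<bar>u x\<bar> powr p / norm (x - y) powr D"
              using D by (intro divide_left_mono powr_mono2 mult_pos_pos) auto
            then show ?thesis using uy inS by (simp add: D_def ennreal_leI)
          qed simp
        qed
        finally show ?thesis .
      next
        case False
        then show ?thesis using elim by simp
      qed
    qed
    have "(\<integral>\<^sup>+x. ennreal (\<bar>u x\<bar> powr p) \<partial>lborel) = (\<integral>\<^sup>+x. ennreal (1 / k) * (ennreal (\<bar>u x\<bar> powr p) * ennreal k) \<partial>lborel)"
      using k by (simp add: ennreal_mult[symmetric])
    also have "\<dots> \<le> (\<integral>\<^sup>+x. ennreal (1 / k) * frac_density p s u x \<partial>lborel)"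
      by (intro nn_integral_mono_AE) (use le in \<open>eventually_elim, auto intro: mult_left_mono\<close>)
    also have "\<dots> = ennreal (1 / k) * gagliardo p s u"
      unfolding gagliardo_def by (rule nn_integral_cmult) measurable
    finally show "(\<integral>\<^sup>+x. ennreal (\<bar>u x\<bar> powr p) \<partial>lborel) \<le> ennreal (1 / k) * gagliardo p s u" .
  qed
qed

text \<open>The approximating test functions in the definition of \<open>X_space\<close> converge in
  energy. This gives L^p convergence of the gradients directly and L^p convergence of the functions
  through the Poincare inequality.\<close>

lemma X_hardy:
  fixes u \<eta> \<xi> :: "'a::euclidean_space \<Rightarrow> real" and p :: real
  assumes p: "1 < p" "p < DIM('a)" and s: "0 < s" and \<Omega>: "bounded \<Omega>" and u: "u \<in> X_space p s \<Omega>"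
    and \<eta>: "\<And>x. (\<eta> has_derivative \<eta>' x) (at x)" "\<And>x. 0 \<le> \<eta> x" "\<And>x. \<eta> x \<le> B"
    and c\<eta>: "\<And>i. i \<in> Basis \<Longrightarrow> continuous_on UNIV (\<lambda>x. \<eta>' x i)"
    and \<xi>: "continuous_on UNIV \<xi>" "\<And>x. \<bar>\<eta>' x x\<bar> \<le> \<xi> x" "\<And>x. \<xi> x \<le> B"
  shows "ennreal (C_H TYPE('a) p) * (\<integral>\<^sup>+x. ennreal (\<eta> x) * ennreal (\<bar>u x\<bar> powr p / norm x powr p) \<partial>lborel) \<le>
    (\<integral>\<^sup>+x. ennreal (\<eta> x) * ennreal (norm (weak_grad u x) powr p) \<partial>lborel) +
    ennreal (((DIM('a) - p) / p) powr (p - 1)) * (\<integral>\<^sup>+x. ennreal (\<xi> x) * ennreal (\<bar>u x\<bar> powr p / norm x powr p) \<partial>lborel)"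
proof -
  note X = X_spaceD[OF u]
  note [measurable] = X(1,3)
  obtain \<phi> where \<phi>: "\<And>n. \<phi> n \<in> test_functions \<Omega>" and lim: "(\<lambda>n. X_energy p s (\<lambda>x. \<phi> n x - u x)) \<longlonglongrightarrow> 0"
    using u by (auto simp: X_space_def)
  have [measurable]: "\<phi> n \<in> borel_measurable borel" for n
    using test_functionD(2)[OF \<phi>] borel_measurable_continuous_onI by blast
  obtain K where K: "0 < K" "\<And>u. u \<in> borel_measurable borel \<Longrightarrow> (AE x in lborel. x \<notin> \<Omega> \<longrightarrow> u x = 0) \<Longrightarrow>
    (\<integral>\<^sup>+x. ennreal (\<bar>u x\<bar> powr p) \<partial>lborel) \<le> ennreal K * gagliardo p s u"
    by (rule gagliardo_Poincare[OF _ s \<Omega>, of p]) (use p in auto)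
  show ?thesis
  proof (rule hardy_localized[OF p X(1,3) \<phi> _ _ _ X(7) \<eta> c\<eta> \<xi>])
    show "(\<integral>\<^sup>+x. ennreal (norm (u x) powr p) \<partial>lborel) < \<infinity>"
      using le_less_trans[OF K(2)[OF X(1,5)], of \<infinity>] X(8) by (simp add: ennreal_mult_less_top)
    show "(\<lambda>n. \<integral>\<^sup>+x. ennreal (norm (grad (\<phi> n) x - weak_grad u x) powr p) \<partial>lborel) \<longlonglongrightarrow> 0"
    proof (rule tendsto_sandwich[OF _ _ tendsto_const lim])
      have "(\<integral>\<^sup>+x. ennreal (norm (grad (\<phi> n) x - weak_grad u x) powr p) \<partial>lborel) \<le> X_energy p s (\<lambda>x. \<phi> n x - u x)" for n
      proof -
        have "is_weak_gradient (\<lambda>x. \<phi> n x - u x) (\<lambda>x. grad (\<phi> n) x - weak_grad u x)"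
          using is_weak_gradient_add[OF is_weak_gradient_grad[OF \<phi>] is_weak_gradient_cmult[OF X(2), of "-1"]] by simp
        from weak_grad_eq[OF this]
        have "(\<integral>\<^sup>+x. ennreal (norm (grad (\<phi> n) x - weak_grad u x) powr p) \<partial>lborel) =
          (\<integral>\<^sup>+x. ennreal (norm (weak_grad (\<lambda>x. \<phi> n x - u x) x) powr p) \<partial>lborel)"
          by (intro nn_integral_cong_AE) (auto elim!: eventually_mono)
        then show ?thesis by (simp add: X_energy_def)
      qed
      then show "\<forall>\<^sub>F n in sequentially. (\<integral>\<^sup>+x. ennreal (norm (grad (\<phi> n) x - weak_grad u x) powr p) \<partial>lborel) \<le> X_energy p s (\<lambda>x. \<phi> n x - u x)"
        by simp
    qed simp
    show "(\<lambda>n. \<integral>\<^sup>+x. ennreal (norm (\<phi> n x - u x) powr p) \<partial>lborel) \<longlonglongrightarrow> 0"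
    proof (rule tendsto_sandwich[OF _ _ tendsto_const])
      have "(\<integral>\<^sup>+x. ennreal (norm (\<phi> n x - u x) powr p) \<partial>lborel) \<le> ennreal K * X_energy p s (\<lambda>x. \<phi> n x - u x)" for n
      proof -
        have "(\<integral>\<^sup>+x. ennreal (norm (\<phi> n x - u x) powr p) \<partial>lborel) \<le> ennreal K * gagliardo p s (\<lambda>x. \<phi> n x - u x)"
          unfolding real_norm_def
          by (rule K(2)) (use X(5) test_functionD(5)[OF \<phi>] in \<open>auto elim!: eventually_mono\<close>)
        also have "\<dots> \<le> ennreal K * X_energy p s (\<lambda>x. \<phi> n x - u x)"
          by (intro mult_left_mono) (auto simp: X_energy_def)
        finally show ?thesis .
      qed
      then show "\<forall>\<^sub>F n in sequentially. (\<integral>\<^sup>+x. ennreal (norm (\<phi> n x - u x) powr p) \<partial>lborel) \<le> ennreal K * X_energy p s (\<lambda>x. \<phi> n x - u x)"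
        by simp
      show "(\<lambda>n. ennreal K * X_energy p s (\<lambda>x. \<phi> n x - u x)) \<longlonglongrightarrow> 0"
        using ennreal_tendsto_cmult[OF _ lim, of "ennreal K"] by simp
    qed simp
  qed
qed

section \<open>Ball averages and strong convergence in L^p\<close>

lemma locally_integrable_integrable_ball:
  fixes w :: "'a::euclidean_space \<Rightarrow> real"
  assumes w: "locally_integrable w"
  shows "integrable lborel (\<lambda>y. indicator (ball x e) y * w y)"
proof -
  have [measurable]: "w \<in> borel_measurable borel" using w by (simp add: locally_integrable_def)
  have "integrable lborel (\<lambda>y. indicator (cball x e) y * w y)"
    using w by (auto simp: locally_integrable_def set_integrable_def)
  then show ?thesis
    by (rule Bochner_Integration.integrable_bound) (auto simp: indicator_def intro!: AE_I2)
qed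

text \<open>By Hoelder, the p-th power of the mean difference is at most the mean of |w(x) - w(y)|^p
  over the ball. There |x - y| < e, so inserting the kernel costs e^(N+ps), and division by the
  volume of the ball leaves the factor e^(ps).\<close>

lemma ball_average_estimate:
  fixes w :: "'a::euclidean_space \<Rightarrow> real" and p :: real
  assumes p: "1 < p" and s: "0 < s" and e: "0 < e" and w: "locally_integrable w"
  defines "b \<equiv> measure lborel (ball (0::'a) e)"
  shows "ennreal (\<bar>w x - (\<integral>y. indicator (ball x e) y * w y \<partial>lborel) / b\<bar> powr p) \<le>
    ennreal (e powr (p * s) / unit_ball_vol DIM('a)) * frac_density p s w x"
proof -
  have [measurable]: "w \<in> borel_measurable borel" using w by (simp add: locally_integrable_def)
  define D where "D = real DIM('a) + p * s"
  have D: "0 < D" using p s by (simp add: D_def add_pos_pos)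
  have b: "b = unit_ball_vol DIM('a) * e ^ DIM('a)" unfolding b_def using e by (simp add: content_ball)
  have bpos: "0 < b" using e by (simp add: b)
  have bx: "measure lborel (ball x e) = b" "emeasure lborel (ball x e) = ennreal b"
    using emeasure_lborel_ball_finite[of x e] e by (auto simp: b content_ball emeasure_eq_ennreal_measure less_top)
  have cpos: "0 < e powr (p * s) / unit_ball_vol DIM('a)" using e by simp
  show ?thesis
  \<comment> \<open>The factor on the right is strictly positive, so an infinite density makes the
    right side infinite and the claim trivial.\<close>
  proof (cases "frac_density p s w x = \<infinity>")
    case True
    moreover have "ennreal c * \<infinity> = \<infinity>" if "0 < c" for c
      using that by (simp add: ennreal_mult_eq_top_iff)
    ultimately show ?thesis using cpos by (metis infinity_ennreal_def top_greatest)
  next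
    case False
    define F where "F = enn2real (frac_density p s w x)"
    have F: "frac_density p s w x = ennreal F" "0 \<le> F" using False by (auto simp: F_def less_top)
    note iw = locally_integrable_integrable_ball[OF w, of x e]
    have i1: "integrable lborel (\<lambda>y. indicator (ball x e) y * w x)"
      by (intro integrable_mult_left integrable_real_indicator emeasure_lborel_ball_finite) simp
    have eq: "b * w x - (\<integral>y. indicator (ball x e) y * w y \<partial>lborel) = (\<integral>y. indicator (ball x e) y * (w x - w y) \<partial>lborel)"
      using iw i1 bx by (simp add: right_diff_distrib)
    have i2: "integrable lborel (\<lambda>y. indicator (ball x e) y * (w x - w y))"
      using iw i1 by (simp add: right_diff_distrib)
    have pw: "(\<integral>\<^sup>+y. ennreal (\<bar>indicator (ball x e) y * (w x - w y)\<bar> powr p) \<partial>lborel) \<le> ennreal (e powr D * F)"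
    proof -
      have "(\<integral>\<^sup>+y. ennreal (\<bar>indicator (ball x e) y * (w x - w y)\<bar> powr p) \<partial>lborel) \<le>
        (\<integral>\<^sup>+y. ennreal (e powr D) * ennreal (\<bar>w x - w y\<bar> powr p / norm (x - y) powr D) \<partial>lborel)"
      proof (rule nn_integral_mono)
        fix y
        have "\<bar>w x - w y\<bar> powr p \<le> e powr D * (\<bar>w x - w y\<bar> powr p / norm (x - y) powr D)" if "y \<in> ball x e" "y \<noteq> x"
        proof -
          have "norm (x - y) powr D \<le> e powr D"
            using that D by (intro powr_mono2) (auto simp: dist_norm)
          then have "norm (x - y) powr D * (\<bar>w x - w y\<bar> powr p / norm (x - y) powr D) \<le> e powr D * (\<bar>w x - w y\<bar> powr p / norm (x - y) powr D)"
            by (rule mult_right_mono) simp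
          then show ?thesis using that by simp
        qed
        then show "ennreal (\<bar>indicator (ball x e) y * (w x - w y)\<bar> powr p) \<le> ennreal (e powr D) * ennreal (\<bar>w x - w y\<bar> powr p / norm (x - y) powr D)"
          by (cases "y = x") (auto simp: indicator_def ennreal_mult[symmetric] intro!: ennreal_leI)
      qed
      also have "\<dots> = ennreal (e powr D) * frac_density p s w x"
        unfolding frac_density_def D_def by (rule nn_integral_cmult) measurable
      also have "\<dots> = ennreal (e powr D * F)" using F by (simp add: ennreal_mult)
      finally show ?thesis .
    qed
    have "(\<integral>\<^sup>+y. ennreal \<bar>indicator (ball x e) y * (indicator (ball x e) y * (w x - w y))\<bar> \<partial>lborel) \<le>
       ennreal (b powr ((p - 1) / p) * (e powr D * F) powr (1 / p))"
    proof (rule Hoelder_inequality[OF _ _ p])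
      have "(\<integral>\<^sup>+y. ennreal (\<bar>indicator (ball x e) y\<bar> powr (p / (p - 1))) \<partial>lborel) = (\<integral>\<^sup>+y. indicator (ball x e) y \<partial>lborel)"
        by (intro nn_integral_cong) (auto simp: indicator_def)
      then show "(\<integral>\<^sup>+y. ennreal (\<bar>indicator (ball x e) y\<bar> powr (p / (p - 1))) \<partial>lborel) \<le> ennreal b"
        using bx by simp
      show "(\<lambda>y. indicator (ball x e) y :: real) \<in> borel_measurable lborel"
        by (intro borel_measurable_indicator) simp
      show "(\<lambda>y. indicator (ball x e) y * (w x - w y)) \<in> borel_measurable lborel"
        by (rule borel_measurable_integrable[OF i2])
    qed (use pw bpos F in auto)
    \<comment> \<open>The indicator is idempotent: in Hoelder's inequality one copy serves as the
      second function and contributes the volume b, the other restricts the difference to the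
      ball.\<close>
    moreover have "indicator (ball x e) y * (indicator (ball x e) y * (w x - w y)) = indicator (ball x e) y * (w x - w y)" for y
      by (auto simp: indicator_def)
    ultimately have hol: "(\<integral>\<^sup>+y. ennreal (norm (indicator (ball x e) y * (w x - w y))) \<partial>lborel) \<le> ennreal (b powr ((p - 1) / p) * (e powr D * F) powr (1 / p))"
      by simp
    have "\<bar>b * w x - (\<integral>y. indicator (ball x e) y * w y \<partial>lborel)\<bar> \<le> b powr ((p - 1) / p) * (e powr D * F) powr (1 / p)"
    proof -
      have "(\<integral>y. norm (indicator (ball x e) y * (w x - w y)) \<partial>lborel) \<le> b powr ((p - 1) / p) * (e powr D * F) powr (1 / p)"
        using hol i2 by (subst (asm) nn_integral_eq_integral) (auto simp: ennreal_le_iff)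
      then show ?thesis unfolding eq
        using order_trans[OF integral_norm_bound[of lborel "\<lambda>y. indicator (ball x e) y * (w x - w y)"]] by simp
    qed
    then have "\<bar>b * w x - (\<integral>y. indicator (ball x e) y * w y \<partial>lborel)\<bar> powr p \<le> (b powr ((p - 1) / p) * (e powr D * F) powr (1 / p)) powr p"
      using p by (intro powr_mono2) auto
    also have "\<dots> = b powr (p - 1) * (e powr D * F)"
      using p F by (simp add: powr_mult powr_powr)
    finally have 1: "\<bar>b * w x - (\<integral>y. indicator (ball x e) y * w y \<partial>lborel)\<bar> powr p \<le> b powr (p - 1) * (e powr D * F)" .
    have "\<bar>w x - (\<integral>y. indicator (ball x e) y * w y \<partial>lborel) / b\<bar> powr p = \<bar>b * w x - (\<integral>y. indicator (ball x e) y * w y \<partial>lborel)\<bar> powr p / b powr p"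
    proof -
      have "w x - (\<integral>y. indicator (ball x e) y * w y \<partial>lborel) / b = (b * w x - (\<integral>y. indicator (ball x e) y * w y \<partial>lborel)) / b"
        using bpos by (simp add: field_simps)
      then show ?thesis using bpos by (simp add: powr_divide)
    qed
    also have "\<dots> \<le> b powr (p - 1) * (e powr D * F) / b powr p"
      using 1 by (rule divide_right_mono) simp
    also have "\<dots> = e powr D / b * F" using bpos by (simp add: powr_diff)
    also have "e powr D / b = e powr (p * s) / unit_ball_vol DIM('a)"
      using e by (simp add: b D_def powr_add powr_realpow)
    finally show ?thesis unfolding F(1) using cpos F(2) by (simp add: ennreal_mult[symmetric] ennreal_leI)
  qed
qed

lemma X_weakly_converges_functional:
  "X_weakly_converges p s \<Omega> u v \<Longrightarrow> F \<in> X_dual p s \<Omega> \<Longrightarrow> (\<lambda>k. F (u k)) \<longlonglongrightarrow> F v"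
  by (simp add: X_weakly_converges_def)

text \<open>Every L^q function yields a functional on X(\<Omega>), so its pairings with the
  gradients (or difference quotients) of the sequence converge and are bounded. Uniform boundedness
  is then applied to these two L^p sequences separately.\<close>

lemma X_weakly_converges_bounded:
  fixes u :: "nat \<Rightarrow> 'a::euclidean_space \<Rightarrow> real" and p s :: real
  assumes p: "1 < p" and u: "\<And>k. u k \<in> X_space p s \<Omega>" and weak: "X_weakly_converges p s \<Omega> u v"
  obtains C where "0 \<le> C" "\<And>k. (\<integral>\<^sup>+x. ennreal (norm (weak_grad (u k) x) powr p) \<partial>lborel) \<le> ennreal C"
    "\<And>k. gagliardo p s (u k) \<le> ennreal C"
proof -
  note [measurable] = X_spaceD(1,3)[OF u]
  obtain C1 where C1: "\<And>k. (\<integral>\<^sup>+x. ennreal (norm (weak_grad (u k) x) powr p) \<partial>lborel) \<le> ennreal C1"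
  proof (rule Lp_weakly_bounded_imp_bounded[of "\<lambda>k. weak_grad (u k)" lborel p])
    show "Bseq (\<lambda>k. \<integral>x. G x \<bullet> weak_grad (u k) x \<partial>lborel)"
      if "G \<in> borel_measurable lborel" "(\<integral>\<^sup>+x. ennreal (norm (G x) powr (p / (p - 1))) \<partial>lborel) < \<infinity>" for G
      using X_weakly_converges_functional[OF weak X_functional_weak_grad[OF p, of G]] that
      by (intro convergent_imp_Bseq) (auto simp: convergent_def)
  qed (use p X_spaceD(7)[OF u] in auto)
  obtain C2 where C2: "\<And>k. (\<integral>\<^sup>+z. ennreal (norm (diff_quotient p s (u k) z) powr p) \<partial>(lborel \<Otimes>\<^sub>M lborel)) \<le> ennreal C2"
  proof (rule Lp_weakly_bounded_imp_bounded[of "\<lambda>k. diff_quotient p s (u k)" "lborel \<Otimes>\<^sub>M lborel" p])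
    show "(\<integral>\<^sup>+z. ennreal (norm (diff_quotient p s (u k) z) powr p) \<partial>(lborel \<Otimes>\<^sub>M lborel)) < \<infinity>" for k
      using p X_spaceD(1,8)[OF u, of k] by (subst gagliardo_diff_quotient) auto
    show "Bseq (\<lambda>k. \<integral>x. G x \<bullet> diff_quotient p s (u k) x \<partial>(lborel \<Otimes>\<^sub>M lborel))"
      if "G \<in> borel_measurable (lborel \<Otimes>\<^sub>M lborel)" "(\<integral>\<^sup>+x. ennreal (norm (G x) powr (p / (p - 1))) \<partial>(lborel \<Otimes>\<^sub>M lborel)) < \<infinity>" for G
      using X_weakly_converges_functional[OF weak X_functional_diff_quotient[OF p that]]
      by (intro convergent_imp_Bseq) (auto simp: convergent_def)
  qed (use p in auto)
  show thesis
  proof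
    show "0 \<le> max 0 (max C1 C2)" by simp
    show "(\<integral>\<^sup>+x. ennreal (norm (weak_grad (u k) x) powr p) \<partial>lborel) \<le> ennreal (max 0 (max C1 C2))" for k
      by (rule order_trans[OF C1]) (simp add: ennreal_leI)
    show "gagliardo p s (u k) \<le> ennreal (max 0 (max C1 C2))" for k
    proof -
      have "gagliardo p s (u k) \<le> ennreal C2"
        using C2[of k] gagliardo_diff_quotient[of p "u k" s] p by simp
      also have "\<dots> \<le> ennreal (max 0 (max C1 C2))" by (simp add: ennreal_leI)
      finally show ?thesis .
    qed
  qed
qed

text \<open>The Poincare inequality bounds the L^p norm by the energy. With G the indicator of a
  ball, this makes ball averages weakly continuous.\<close>

lemma X_functional_identity:
  fixes G :: "'a::euclidean_space \<Rightarrow> real"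
  assumes p: "1 < p" and s: "0 < s" and \<Omega>: "bounded \<Omega>"
    and G: "G \<in> borel_measurable borel" "(\<integral>\<^sup>+x. ennreal (norm (G x) powr (p / (p - 1))) \<partial>lborel) < \<infinity>"
  shows "(\<lambda>v. \<integral>x. G x \<bullet> v x \<partial>lborel) \<in> X_dual p s \<Omega>"
proof -
  obtain K where K: "0 < K" "\<And>u. u \<in> borel_measurable borel \<Longrightarrow> (AE x in lborel. x \<notin> \<Omega> \<longrightarrow> u x = 0) \<Longrightarrow>
    (\<integral>\<^sup>+x. ennreal (\<bar>u x\<bar> powr p) \<partial>lborel) \<le> ennreal K * gagliardo p s u"
    by (rule gagliardo_Poincare[OF _ s \<Omega>, of p]) (use p in auto)
  show ?thesis
  proof (rule X_functional[OF p, where K=K and T="\<lambda>v. v"])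
    fix v w :: "'a \<Rightarrow> real" and c :: real
    assume v: "v \<in> X_space p s \<Omega>"
    note [measurable] = X_spaceD(1)[OF v]
    show "v \<in> borel_measurable lborel" by simp
    have "ennreal K * gagliardo p s v \<le> ennreal K * X_energy p s v"
      by (intro mult_left_mono) (auto simp: X_energy_def)
    then show "(\<integral>\<^sup>+x. ennreal (norm (v x) powr p) \<partial>lborel) \<le> ennreal K * X_energy p s v"
      using order_trans[OF K(2)[OF X_spaceD(1,5)[OF v]]] by simp
    show "(\<lambda>x. c * v x) \<in> borel_measurable lborel \<and> (AE x in lborel. c * v x = c *\<^sub>R v x)" by simp
    assume w: "w \<in> X_space p s \<Omega>"
    note [measurable] = X_spaceD(1)[OF w]
    show "(\<lambda>x. v x + w x) \<in> borel_measurable lborel \<and> (AE x in lborel. v x + w x = v x + w x)" by simp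
  qed (use G K(1) in auto)
qed

text \<open>The difference w of \<open>u k\<close> and v is compared with its averages over balls of
  radius e. The error is of order e^(ps), uniformly in k, by the bound on the seminorms. For fixed e
  the averages tend to 0 pointwise by weak convergence and are uniformly bounded, so they tend to 0
  in L^p of the bounded set \<Omega>. First e is chosen, then k.\<close>

lemma X_compact_embedding:
  fixes u :: "nat \<Rightarrow> 'a::euclidean_space \<Rightarrow> real" and p s :: real
  assumes p: "1 < p" and s: "0 < s" and \<Omega>: "bounded \<Omega>" "open \<Omega>"
    and u: "\<And>k. u k \<in> X_space p s \<Omega>" and v: "v \<in> X_space p s \<Omega>"
    and weak: "X_weakly_converges p s \<Omega> u v"
    and C: "0 \<le> C" "\<And>k. gagliardo p s (u k) \<le> ennreal C"
  shows "(\<lambda>k. \<integral>\<^sup>+x. ennreal (norm (u k x - v x) powr p) \<partial>lborel) \<longlonglongrightarrow> 0"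
proof -
  note [measurable] = X_spaceD(1)[OF u] X_spaceD(1)[OF v]
  have [measurable]: "\<Omega> \<in> sets borel" using \<Omega> by simp
  obtain K where K: "0 < K" "\<And>u. u \<in> borel_measurable borel \<Longrightarrow> (AE x in lborel. x \<notin> \<Omega> \<longrightarrow> u x = 0) \<Longrightarrow>
    (\<integral>\<^sup>+x. ennreal (\<bar>u x\<bar> powr p) \<partial>lborel) \<le> ennreal K * gagliardo p s u"
    by (rule gagliardo_Poincare[OF _ s \<Omega>(1), of p]) (use p in auto)
  define w where "w k x = u k x - v x" for k x
  have [measurable]: "w k \<in> borel_measurable borel" for k unfolding w_def by measurable
  have liw: "locally_integrable (w k)" for k
    using locally_integrable_add[OF X_spaceD(4)[OF u] locally_integrable_scaleR[OF X_spaceD(4)[OF v], of "-1"]]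
    by (simp add: w_def[abs_def])
  have wz: "AE x in lborel. x \<notin> \<Omega> \<longrightarrow> w k x = 0" for k
    using X_spaceD(5)[OF u, of k] X_spaceD(5)[OF v] by eventually_elim (simp add: w_def)
  define C' where "C' = 2 powr (p - 1) * (C + enn2real (gagliardo p s v))"
  have C'0: "0 \<le> C'" using C by (simp add: C'_def)
  have C': "gagliardo p s (w k) \<le> ennreal C'" for k
  proof -
    have "gagliardo p s (w k) \<le> ennreal (2 powr (p - 1)) * (gagliardo p s (u k) + gagliardo p s v)"
      unfolding w_def using p by (intro gagliardo_diff_le) auto
    also have "\<dots> \<le> ennreal (2 powr (p - 1)) * (ennreal C + gagliardo p s v)"
      by (intro mult_left_mono add_right_mono C) auto
    also have "gagliardo p s v = ennreal (enn2real (gagliardo p s v))"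
      using X_spaceD(8)[OF v] by (simp add: less_top)
    finally show ?thesis using C by (simp add: C'_def ennreal_mult[symmetric] ennreal_plus[symmetric] del: ennreal_plus)
  qed
  define J where "J = K * C'"
  have J0: "0 \<le> J" using K C'0 by (simp add: J_def)
  have J: "(\<integral>\<^sup>+x. ennreal (norm (w k x) powr p) \<partial>lborel) \<le> ennreal J" for k
  proof -
    have "(\<integral>\<^sup>+x. ennreal (norm (w k x) powr p) \<partial>lborel) \<le> ennreal K * gagliardo p s (w k)"
      using K(2)[OF _ wz[of k]] by simp
    also have "\<dots> \<le> ennreal K * ennreal C'" by (intro mult_left_mono C') auto
    finally show ?thesis using K C'0 by (simp add: J_def ennreal_mult)
  qed
  have lim: "\<forall>\<^sub>F k in sequentially. (\<integral>\<^sup>+x. ennreal (norm (w k x) powr p) \<partial>lborel) < ennreal (2 powr (p - 1) * (e powr (p * s) / unit_ball_vol DIM('a) * C')) + ennreal d"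
    if e: "0 < e" and d: "0 < d" for e d
  proof -
    define b where "b = measure lborel (ball (0::'a) e)"
    have bpos: "0 < b" using e by (simp add: b_def content_ball_pos)
    have bx: "emeasure lborel (ball x e) = ennreal b" for x :: 'a
      using emeasure_lborel_ball_finite[of x e] content_ball[of e x] content_ball[of e "0::'a"] e
      by (simp add: b_def emeasure_eq_ennreal_measure less_top)
    define A where "A k x = (\<integral>y. indicator (ball x e) y * w k y \<partial>lborel) / b" for k x
    \<comment> \<open>Writing the indicator of the moving ball as a condition on
      \<open>dist x y\<close> exposes joint measurability in x and y, which the measurability of the
      average in x needs.\<close>
    have A': "A k x = (\<integral>y. (if dist x y < e then w k y else 0) \<partial>lborel) / b" for k x
      unfolding A_def by (auto simp: indicator_def intro!: Bochner_Integration.integral_cong arg_cong[where f="\<lambda>x. x / b"])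
    have [measurable]: "A k \<in> borel_measurable borel" for k
      unfolding A'[abs_def] by measurable
    have Gq: "(\<integral>\<^sup>+y. ennreal (norm (indicator (ball x e) y :: real) powr (p / (p - 1))) \<partial>lborel) = ennreal b" for x :: 'a
    proof -
      have "(\<integral>\<^sup>+y. ennreal (norm (indicator (ball x e) y :: real) powr (p / (p - 1))) \<partial>lborel) = (\<integral>\<^sup>+y. indicator (ball x e) y \<partial>lborel)"
        by (intro nn_integral_cong) (auto simp: indicator_def)
      then show ?thesis using bx by simp
    qed
    have A0: "(\<lambda>k. A k x) \<longlonglongrightarrow> 0" for x
    proof -
      have "(\<lambda>v. \<integral>y. indicator (ball x e) y \<bullet> v y \<partial>lborel) \<in> X_dual p s \<Omega>"
        by (rule X_functional_identity[OF p s \<Omega>(1)]) (measurable, use Gq[of x] in \<open>auto simp: less_top[symmetric]\<close>)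
      from X_weakly_converges_functional[OF weak this]
      have "(\<lambda>k. ((\<integral>y. indicator (ball x e) y * u k y \<partial>lborel) - (\<integral>y. indicator (ball x e) y * v y \<partial>lborel)) / b) \<longlonglongrightarrow>
        ((\<integral>y. indicator (ball x e) y * v y \<partial>lborel) - (\<integral>y. indicator (ball x e) y * v y \<partial>lborel)) / b"
        unfolding inner_real_def using bpos by (intro tendsto_divide tendsto_diff tendsto_const) simp_all
      moreover have "(\<integral>y. indicator (ball x e) y * u k y \<partial>lborel) - (\<integral>y. indicator (ball x e) y * v y \<partial>lborel) = (\<integral>y. indicator (ball x e) y * w k y \<partial>lborel)"
        for k
        using locally_integrable_integrable_ball[OF X_spaceD(4)[OF u, of k]] locally_integrable_integrable_ball[OF X_spaceD(4)[OF v]]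
        by (simp add: w_def right_diff_distrib)
      ultimately show ?thesis by (simp add: A_def)
    qed
    \<comment> \<open>Hoelder's bound for the averages, uniform in k and x; it supplies the
      dominating function on \<Omega>.\<close>
    define m where "m = b powr ((p - 1) / p) * J powr (1 / p) / b"
    have Am: "\<bar>A k x\<bar> \<le> m" for k x
    proof -
      have "\<bar>\<integral>y. indicator (ball x e) y \<bullet> w k y \<partial>lborel\<bar> \<le> enn2real (\<integral>\<^sup>+y. ennreal (norm (indicator (ball x e) y :: real) powr (p / (p - 1))) \<partial>lborel) powr ((p - 1) / p) *
        enn2real (\<integral>\<^sup>+y. ennreal (norm (w k y) powr p) \<partial>lborel) powr (1 / p)"
        by (rule integrable_inner_Lp(2)[OF _ _ p]) (measurable, use Gq[of x] le_less_trans[OF J[of k], of \<infinity>] in \<open>auto simp: less_top[symmetric]\<close>)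
      also have "\<dots> \<le> b powr ((p - 1) / p) * J powr (1 / p)"
      proof (rule mult_mono)
        have "enn2real (\<integral>\<^sup>+y. ennreal (norm (w k y) powr p) \<partial>lborel) \<le> J"
          using enn2real_mono[OF J[of k]] J0 by simp
        then show "enn2real (\<integral>\<^sup>+y. ennreal (norm (w k y) powr p) \<partial>lborel) powr (1 / p) \<le> J powr (1 / p)"
          using p by (intro powr_mono2) auto
      qed (use Gq bpos in auto)
      finally show ?thesis using bpos unfolding A_def m_def by (simp add: abs_div divide_right_mono)
    qed
    have "(\<lambda>k. \<integral>\<^sup>+x. ennreal (\<bar>A k x\<bar> powr p) * indicator \<Omega> x \<partial>lborel) \<longlonglongrightarrow> (\<integral>\<^sup>+x. 0 * indicator \<Omega> x \<partial>(lborel :: 'a measure))"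
    proof (rule nn_integral_dominated_convergence[where w="\<lambda>x. ennreal (m powr p) * indicator \<Omega> x"])
      show "AE x in lborel. ennreal (\<bar>A k x\<bar> powr p) * indicator \<Omega> x \<le> ennreal (m powr p) * indicator \<Omega> x" for k
        using Am p by (intro AE_I2 mult_right_mono ennreal_leI powr_mono2) auto
      show "(\<integral>\<^sup>+x. ennreal (m powr p) * indicator \<Omega> x \<partial>lborel) < \<infinity>"
        using emeasure_bounded_finite[OF \<Omega>(1)] by (simp add: nn_integral_cmult_indicator ennreal_mult_less_top)
      show "AE x in lborel. (\<lambda>k. ennreal (\<bar>A k x\<bar> powr p) * indicator \<Omega> x) \<longlonglongrightarrow> 0 * indicator \<Omega> x"
      proof (rule AE_I2)
        fix x
        have "(\<lambda>k. \<bar>A k x\<bar> powr p) \<longlonglongrightarrow> 0"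
          using tendsto_powr'[OF tendsto_rabs[OF A0[of x]] tendsto_const, of p] p by simp
        then have "(\<lambda>k. ennreal (\<bar>A k x\<bar> powr p)) \<longlonglongrightarrow> 0"
          using tendsto_ennrealI by fastforce
        then show "(\<lambda>k. ennreal (\<bar>A k x\<bar> powr p) * indicator \<Omega> x) \<longlonglongrightarrow> 0 * indicator \<Omega> x"
          by (cases "x \<in> \<Omega>") auto
      qed
    qed measurable
    then have I0: "(\<lambda>k. ennreal (2 powr (p - 1)) * (\<integral>\<^sup>+x. ennreal (\<bar>A k x\<bar> powr p) * indicator \<Omega> x \<partial>lborel)) \<longlonglongrightarrow> 0"
      using ennreal_tendsto_cmult[of "ennreal (2 powr (p - 1))"] by fastforce
    have ev: "\<forall>\<^sub>F k in sequentially. ennreal (2 powr (p - 1)) * (\<integral>\<^sup>+x. ennreal (\<bar>A k x\<bar> powr p) * indicator \<Omega> x \<partial>lborel) < ennreal d"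
      using order_tendstoD(2)[OF I0, of "ennreal d"] d by simp
    define c where "c = e powr (p * s) / unit_ball_vol DIM('a)"
    have c0: "0 \<le> c" by (simp add: c_def)
    have le: "(\<integral>\<^sup>+x. ennreal (norm (w k x) powr p) \<partial>lborel) \<le> ennreal (2 powr (p - 1) * (c * C')) +
       ennreal (2 powr (p - 1)) * (\<integral>\<^sup>+x. ennreal (\<bar>A k x\<bar> powr p) * indicator \<Omega> x \<partial>lborel)" for k
    proof -
      have "(\<integral>\<^sup>+x. ennreal (norm (w k x) powr p) \<partial>lborel) \<le>
        (\<integral>\<^sup>+x. ennreal (2 powr (p - 1)) * (ennreal c * frac_density p s (w k) x) + ennreal (2 powr (p - 1)) * (ennreal (\<bar>A k x\<bar> powr p) * indicator \<Omega> x) \<partial>lborel)"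
      proof (rule nn_integral_mono_AE, use wz[of k] in eventually_elim)
        case (elim x)
        show ?case
        proof (cases "x \<in> \<Omega>")
          case True
          have "norm (w k x) powr p \<le> (\<bar>w k x - A k x\<bar> + \<bar>A k x\<bar>) powr p"
            using p by (intro powr_mono2) auto
          also have "\<dots> \<le> 2 powr (p - 1) * (\<bar>w k x - A k x\<bar> powr p + \<bar>A k x\<bar> powr p)"
            using p by (intro powr_add_le) auto
          finally have "ennreal (norm (w k x) powr p) \<le> ennreal (2 powr (p - 1)) * (ennreal (\<bar>w k x - A k x\<bar> powr p) + ennreal (\<bar>A k x\<bar> powr p))"
            by (simp add: ennreal_mult[symmetric] ennreal_plus[symmetric] ennreal_leI del: ennreal_plus)
          also have "\<dots> \<le> ennreal (2 powr (p - 1)) * (ennreal c * frac_density p s (w k) x + ennreal (\<bar>A k x\<bar> powr p))"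
            using ball_average_estimate[OF p s e liw, of k x] unfolding A_def b_def c_def
            by (intro mult_left_mono add_right_mono) auto
          finally show ?thesis using True by (simp add: distrib_left)
        qed (use elim in simp)
      qed
      also have "\<dots> = ennreal (2 powr (p - 1)) * (ennreal c * gagliardo p s (w k)) + ennreal (2 powr (p - 1)) * (\<integral>\<^sup>+x. ennreal (\<bar>A k x\<bar> powr p) * indicator \<Omega> x \<partial>lborel)"
        by (simp add: nn_integral_add nn_integral_cmult gagliardo_def)
      also have "\<dots> \<le> ennreal (2 powr (p - 1)) * (ennreal c * ennreal C') + ennreal (2 powr (p - 1)) * (\<integral>\<^sup>+x. ennreal (\<bar>A k x\<bar> powr p) * indicator \<Omega> x \<partial>lborel)"
        by (intro add_right_mono mult_left_mono C') auto
      finally show ?thesis using c0 C'0 by (simp add: ennreal_mult)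
    qed
    show ?thesis
      unfolding c_def[symmetric] using ev
    proof eventually_elim
      case (elim k)
      show ?case
        by (rule le_less_trans[OF le]) (use elim in \<open>simp add: ennreal_add_left_cancel_less\<close>)
    qed
  qed
  have "(\<lambda>k. \<integral>\<^sup>+x. ennreal (norm (w k x) powr p) \<partial>lborel) \<longlonglongrightarrow> 0"
  proof (rule order_tendstoI)
    fix a :: ennreal
    assume a: "0 < a"
    \<comment> \<open>The threshold a may be infinite, so a finite positive r below it takes its
      place.\<close>
    obtain r where r: "0 < r" "ennreal r \<le> a"
      using a that[of 1] by (cases a) auto
    define f where "f e = 2 powr (p - 1) * (e powr (p * s) / unit_ball_vol DIM('a) * C')" for e
    have "((\<lambda>e. e powr (p * s)) \<longlongrightarrow> 0 powr (p * s)) (at_right (0::real))"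
      by (rule tendsto_powr') (use p s in \<open>auto intro!: eventually_at_right_less[THEN eventually_mono]\<close>)
    then have "((\<lambda>e. 2 powr (p - 1) / unit_ball_vol DIM('a) * C' * e powr (p * s)) \<longlongrightarrow> 2 powr (p - 1) / unit_ball_vol DIM('a) * C' * (0 powr (p * s))) (at_right 0)"
      by (rule tendsto_mult_left)
    then have "(f \<longlongrightarrow> 0) (at_right 0)"
      by (simp add: f_def[abs_def] mult_ac)
    then have "\<forall>\<^sub>F e in at_right 0. f e < r / 2"
      using r by (intro order_tendstoD(2)[of f 0]) auto
    with eventually_at_right_less[of "0::real"] have "\<forall>\<^sub>F e in at_right 0. 0 < e \<and> f e < r / 2"
      by eventually_elim auto
    then obtain e where e: "0 < e" "f e < r / 2"
      using eventually_happens'[of "at_right (0::real)"] by auto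
    have f0: "0 \<le> f e" using C'0 by (simp add: f_def)
    have "ennreal (f e) + ennreal (r / 2) \<le> a"
      using e f0 r by (intro order_trans[OF _ r(2)]) (simp add: ennreal_plus[symmetric] ennreal_leI del: ennreal_plus)
    then show "\<forall>\<^sub>F k in sequentially. (\<integral>\<^sup>+x. ennreal (norm (w k x) powr p) \<partial>lborel) < a"
      using lim[OF e(1), of "r / 2"] r unfolding f_def by (auto elim!: eventually_mono intro: less_le_trans)
  qed auto
  then show ?thesis unfolding w_def .
qed

section \<open>Limits of the Hardy and energy measures\<close>

lemma hardy_measure_simps [simp]:
  "sets (hardy_measure p \<theta> u) = sets borel" "space (hardy_measure p \<theta> u) = UNIV"
  by (simp_all add: hardy_measure_def)

lemma energy_measure_simps [simp]:
  "sets (energy_measure p s u) = sets borel" "space (energy_measure p s u) = UNIV"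
  by (simp_all add: energy_measure_def)

lemma nn_integral_hardy_measure:
  fixes u :: "'a::euclidean_space \<Rightarrow> real"
  assumes [measurable]: "u \<in> borel_measurable borel" "f \<in> borel_measurable borel"
  shows "(\<integral>\<^sup>+x. f x \<partial>hardy_measure p \<theta> u) = (\<integral>\<^sup>+x. f x * ennreal (\<bar>u x\<bar> powr p / norm x powr (p * \<theta>)) \<partial>lborel)"
  unfolding hardy_measure_def by (subst nn_integral_density) (auto simp: mult.commute)

lemma nn_integral_energy_measure:
  fixes u :: "'a::euclidean_space \<Rightarrow> real"
  assumes [measurable]: "u \<in> borel_measurable borel" "weak_grad u \<in> borel_measurable borel" "f \<in> borel_measurable borel"
  shows "(\<integral>\<^sup>+x. f x \<partial>energy_measure p s u) =
    (\<integral>\<^sup>+x. f x * ennreal (norm (weak_grad u x) powr p) \<partial>lborel) + (\<integral>\<^sup>+x. f x * frac_density p s u x \<partial>lborel)"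
  unfolding energy_measure_def
  by (subst nn_integral_density) (auto simp: distrib_left mult.commute[of _ "f _"] nn_integral_add)

lemma emeasure_energy_measure_UNIV:
  assumes "u \<in> X_space p s \<Omega>"
  shows "emeasure (energy_measure p s u) UNIV = X_energy p s u"
  using nn_integral_energy_measure[of u "\<lambda>_. 1" p s] X_spaceD(1,3)[OF assms]
  by (simp add: X_energy_def gagliardo_def)

lemma finite_measure_energy_measure:
  assumes "u \<in> X_space p s \<Omega>"
  shows "finite_measure (energy_measure p s u)"
  by (rule finite_measureI) (use emeasure_energy_measure_UNIV[OF assms] X_spaceD(6)[OF assms] in auto)

text \<open>Inside the unit ball |x|^(-p\<theta>) <= |x|^-p, outside it |x|^(-p\<theta>) <= 1. Total
  Hardy masses for all exponents are thereby controlled by the case \<theta> = 1 and the L^p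
  norm.\<close>

lemma hardy_density_le:
  fixes x :: "'a::euclidean_space"
  assumes p: "0 < p" and t: "0 \<le> \<theta>" "\<theta> \<le> 1"
  shows "\<bar>y\<bar> powr p / norm x powr (p * \<theta>) \<le> \<bar>y\<bar> powr p / norm x powr p + \<bar>y\<bar> powr p"
proof (cases "x = 0")
  case False
  then have n: "0 < norm x" by simp
  show ?thesis
  proof (cases "norm x \<le> 1")
    case True
    have "norm x powr p \<le> norm x powr (p * \<theta>)"
      using True n p t by (intro powr_mono') (auto simp: mult_left_le)
    then have "\<bar>y\<bar> powr p / norm x powr (p * \<theta>) \<le> \<bar>y\<bar> powr p / norm x powr p"
      using n by (intro divide_left_mono mult_pos_pos) auto
    then show ?thesis by (smt (verit) powr_ge_zero)
  next
    case False
    have "1 \<le> norm x powr (p * \<theta>)" using False p t by (intro ge_one_powr_ge_zero) auto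
    then have "\<bar>y\<bar> powr p / norm x powr (p * \<theta>) \<le> \<bar>y\<bar> powr p / 1"
      using n by (intro divide_left_mono) auto
    moreover have "0 \<le> \<bar>y\<bar> powr p / norm x powr p" by simp
    ultimately show ?thesis by linarith
  qed
qed simp

lemma X_hardy_inequality:
  fixes u :: "'a::euclidean_space \<Rightarrow> real" and p :: real
  assumes p: "1 < p" "p < DIM('a)" and s: "0 < s" and \<Omega>: "bounded \<Omega>" and u: "u \<in> X_space p s \<Omega>"
  shows "ennreal (C_H TYPE('a) p) * (\<integral>\<^sup>+x. ennreal (\<bar>u x\<bar> powr p / norm x powr p) \<partial>lborel) \<le>
    (\<integral>\<^sup>+x. ennreal (norm (weak_grad u x) powr p) \<partial>lborel)"
  using X_hardy[OF p s \<Omega> u, of "\<lambda>_. 1" "\<lambda>_ _. 0" 1 "\<lambda>_. 0"] by simp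

lemma hardy_bounds:
  fixes u :: "nat \<Rightarrow> 'a::euclidean_space \<Rightarrow> real" and p s :: real
  assumes p: "1 < p" "p < DIM('a)" and s: "0 < s" and \<Omega>: "bounded \<Omega>" and u: "\<And>k. u k \<in> X_space p s \<Omega>"
    and C: "0 \<le> C" "\<And>k. (\<integral>\<^sup>+x. ennreal (norm (weak_grad (u k) x) powr p) \<partial>lborel) \<le> ennreal C"
      "\<And>k. gagliardo p s (u k) \<le> ennreal C"
    and t: "0 \<le> \<theta>" "\<theta> \<le> 1"
  obtains H where "0 \<le> H" "\<And>k. (\<integral>\<^sup>+x. ennreal (\<bar>u k x\<bar> powr p / norm x powr p) \<partial>lborel) \<le> ennreal H"
    "\<And>k. emeasure (hardy_measure p \<theta> (u k)) UNIV \<le> ennreal H"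
proof -
  note [measurable] = X_spaceD(1)[OF u]
  obtain K where K: "0 < K" "\<And>u. u \<in> borel_measurable borel \<Longrightarrow> (AE x in lborel. x \<notin> \<Omega> \<longrightarrow> u x = 0) \<Longrightarrow>
    (\<integral>\<^sup>+x. ennreal (\<bar>u x\<bar> powr p) \<partial>lborel) \<le> ennreal K * gagliardo p s u"
    by (rule gagliardo_Poincare[OF _ s \<Omega>, of p]) (use p in auto)
  define c where "c = C_H TYPE('a) p"
  have c: "0 < c" using p by (simp add: c_def C_H_def)
  have 1: "(\<integral>\<^sup>+x. ennreal (\<bar>u k x\<bar> powr p / norm x powr p) \<partial>lborel) \<le> ennreal (C / c)" for k
  proof -
    have "(\<integral>\<^sup>+x. ennreal (\<bar>u k x\<bar> powr p / norm x powr p) \<partial>lborel) = ennreal (1 / c) * (ennreal c * (\<integral>\<^sup>+x. ennreal (\<bar>u k x\<bar> powr p / norm x powr p) \<partial>lborel))"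
      using c by (simp add: mult.assoc[symmetric] ennreal_mult[symmetric])
    also have "\<dots> \<le> ennreal (1 / c) * ennreal C"
      using order_trans[OF X_hardy_inequality[OF p s \<Omega> u] C(2), of k] by (intro mult_left_mono) (auto simp: c_def)
    finally show ?thesis using c C by (simp add: ennreal_mult[symmetric])
  qed
  have 2: "emeasure (hardy_measure p \<theta> (u k)) UNIV \<le> ennreal (C / c + K * C)" for k
  proof -
    have "emeasure (hardy_measure p \<theta> (u k)) UNIV = (\<integral>\<^sup>+x. ennreal (\<bar>u k x\<bar> powr p / norm x powr (p * \<theta>)) \<partial>lborel)"
      using nn_integral_hardy_measure[of "u k" "\<lambda>_. 1" p \<theta>] by simp
    also have "\<dots> \<le> (\<integral>\<^sup>+x. ennreal (\<bar>u k x\<bar> powr p / norm x powr p) + ennreal (\<bar>u k x\<bar> powr p) \<partial>lborel)"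
      using hardy_density_le[of p \<theta>] p t
      by (intro nn_integral_mono) (auto simp: ennreal_plus[symmetric] simp del: ennreal_plus intro!: ennreal_leI)
    also have "\<dots> = (\<integral>\<^sup>+x. ennreal (\<bar>u k x\<bar> powr p / norm x powr p) \<partial>lborel) + (\<integral>\<^sup>+x. ennreal (\<bar>u k x\<bar> powr p) \<partial>lborel)"
      by (rule nn_integral_add) auto
    also have "\<dots> \<le> ennreal (C / c) + ennreal K * ennreal C"
      using order_trans[OF K(2)[OF X_spaceD(1,5)[OF u]] mult_left_mono[OF C(3)]]
      by (intro add_mono 1) auto
    finally show ?thesis using C c K by (simp add: ennreal_mult[symmetric] ennreal_plus[symmetric] del: ennreal_plus)
  qed
  show thesis
  proof (rule that[of "C / c + K * C"])
    show "0 \<le> C / c + K * C" using C c K by simp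
    show "(\<integral>\<^sup>+x. ennreal (\<bar>u k x\<bar> powr p / norm x powr p) \<partial>lborel) \<le> ennreal (C / c + K * C)" for k
      by (rule order_trans[OF 1]) (use C K in \<open>auto intro!: ennreal_leI\<close>)
  qed (rule 2)
qed

text \<open>Weak lower semicontinuity is used twice: for the gradients with weight f, and for the
  difference quotients with the weight f of the first variable. By Tonelli the latter integral is
  the integral of f against the nonlocal density.\<close>

lemma energy_lower_semicontinuous:
  fixes u :: "nat \<Rightarrow> 'a::euclidean_space \<Rightarrow> real" and p s :: real
  assumes p: "1 < p" and u: "\<And>k. u k \<in> X_space p s \<Omega>" and v: "v \<in> X_space p s \<Omega>"
    and weak: "X_weakly_converges p s \<Omega> u v"
    and f[measurable]: "f \<in> borel_measurable borel" and B: "\<And>x. 0 \<le> f x" "\<And>x. f x \<le> B"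
  obtains c where "c \<longlonglongrightarrow> 0"
    "\<And>k. (\<integral>\<^sup>+x. ennreal (f x) \<partial>energy_measure p s v) \<le> (\<integral>\<^sup>+x. ennreal (f x) \<partial>energy_measure p s (u k)) + ennreal (c k)"
proof -
  note [measurable] = X_spaceD(1,3)[OF u] X_spaceD(1,3)[OF v]
  obtain a where a: "a \<longlonglongrightarrow> 0" "\<And>k. (\<integral>\<^sup>+x. ennreal (f x) * ennreal (norm (weak_grad v x) powr p) \<partial>lborel) \<le>
      (\<integral>\<^sup>+x. ennreal (f x) * ennreal (norm (weak_grad (u k) x) powr p) \<partial>lborel) + ennreal (a k)"
  proof (rule weak_lower_semicontinuous[of "\<lambda>k. weak_grad (u k)" lborel "weak_grad v" f p B])
    show "(\<lambda>k. \<integral>x. G x \<bullet> weak_grad (u k) x \<partial>lborel) \<longlonglongrightarrow> (\<integral>x. G x \<bullet> weak_grad v x \<partial>lborel)"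
      if "G \<in> borel_measurable lborel" "(\<integral>\<^sup>+x. ennreal (norm (G x) powr (p / (p - 1))) \<partial>lborel) < \<infinity>" for G
      using X_weakly_converges_functional[OF weak X_functional_weak_grad[OF p, of G]] that by auto
  qed (use p B X_spaceD(7)[OF u] X_spaceD(7)[OF v] in auto)
  obtain b where b: "b \<longlonglongrightarrow> 0" "\<And>k. (\<integral>\<^sup>+z. ennreal (f (fst z)) * ennreal (norm (diff_quotient p s v z) powr p) \<partial>(lborel \<Otimes>\<^sub>M lborel)) \<le>
      (\<integral>\<^sup>+z. ennreal (f (fst z)) * ennreal (norm (diff_quotient p s (u k) z) powr p) \<partial>(lborel \<Otimes>\<^sub>M lborel)) + ennreal (b k)"
  proof (rule weak_lower_semicontinuous[of "\<lambda>k. diff_quotient p s (u k)" "lborel \<Otimes>\<^sub>M lborel" "diff_quotient p s v" "\<lambda>z. f (fst z)" p B])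
    show "(\<lambda>k. \<integral>x. G x \<bullet> diff_quotient p s (u k) x \<partial>(lborel \<Otimes>\<^sub>M lborel)) \<longlonglongrightarrow> (\<integral>x. G x \<bullet> diff_quotient p s v x \<partial>(lborel \<Otimes>\<^sub>M lborel))"
      if "G \<in> borel_measurable (lborel \<Otimes>\<^sub>M lborel)" "(\<integral>\<^sup>+x. ennreal (norm (G x) powr (p / (p - 1))) \<partial>(lborel \<Otimes>\<^sub>M lborel)) < \<infinity>" for G
      using X_weakly_converges_functional[OF weak X_functional_diff_quotient[OF p that]] .
    show "(\<integral>\<^sup>+z. ennreal (norm (diff_quotient p s v z) powr p) \<partial>(lborel \<Otimes>\<^sub>M lborel)) < \<infinity>"
      using p X_spaceD(1,8)[OF v] by (subst gagliardo_diff_quotient) auto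
    show "(\<integral>\<^sup>+z. ennreal (norm (diff_quotient p s (u k) z) powr p) \<partial>(lborel \<Otimes>\<^sub>M lborel)) < \<infinity>" for k
      using p X_spaceD(1,8)[OF u, of k] by (subst gagliardo_diff_quotient) auto
  qed (use p B in auto)
  have b': "(\<integral>\<^sup>+x. ennreal (f x) * frac_density p s v x \<partial>lborel) \<le> (\<integral>\<^sup>+x. ennreal (f x) * frac_density p s (u k) x \<partial>lborel) + ennreal (b k)" for k
    using b(2)[of k] p weighted_gagliardo[of p v "\<lambda>x. ennreal (f x)" s] weighted_gagliardo[of p "u k" "\<lambda>x. ennreal (f x)" s] by simp
  show thesis
  proof (rule that[of "\<lambda>k. \<bar>a k\<bar> + \<bar>b k\<bar>"])
    show "(\<lambda>k. \<bar>a k\<bar> + \<bar>b k\<bar>) \<longlonglongrightarrow> 0"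
      using tendsto_add[OF tendsto_rabs[OF a(1)] tendsto_rabs[OF b(1)]] by simp
    fix k
    have "(\<integral>\<^sup>+x. ennreal (f x) \<partial>energy_measure p s v) \<le>
      ((\<integral>\<^sup>+x. ennreal (f x) * ennreal (norm (weak_grad (u k) x) powr p) \<partial>lborel) + ennreal (a k)) +
      ((\<integral>\<^sup>+x. ennreal (f x) * frac_density p s (u k) x \<partial>lborel) + ennreal (b k))"
      by (subst nn_integral_energy_measure) (auto intro!: add_mono a(2) b')
    also have "\<dots> = (\<integral>\<^sup>+x. ennreal (f x) \<partial>energy_measure p s (u k)) + (ennreal (a k) + ennreal (b k))"
      by (subst nn_integral_energy_measure) (auto simp: ac_simps)
    also have "\<dots> \<le> (\<integral>\<^sup>+x. ennreal (f x) \<partial>energy_measure p s (u k)) + ennreal (\<bar>a k\<bar> + \<bar>b k\<bar>)"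
      by (intro add_left_mono) (auto intro!: add_mono ennreal_leI)
    finally show "(\<integral>\<^sup>+x. ennreal (f x) \<partial>energy_measure p s v) \<le> (\<integral>\<^sup>+x. ennreal (f x) \<partial>energy_measure p s (u k)) + ennreal (\<bar>a k\<bar> + \<bar>b k\<bar>)" .
  qed
qed

text \<open>The sum of \<mu> and c times the Dirac mass, built from its set function. The formula
  for integrals is first proved for nonnegative functions by induction over measurable functions and
  then transferred to positive and negative parts.\<close>

lemma measure_plus_dirac:
  fixes \<mu> :: "'a::euclidean_space measure"
  assumes \<mu>: "finite_measure \<mu>" "sets \<mu> = sets borel" and c: "0 \<le> c"
  obtains \<sigma> where "finite_radon \<sigma>" "\<And>A. A \<in> sets borel \<Longrightarrow> emeasure \<sigma> A = emeasure \<mu> A + ennreal c * emeasure dirac0 A"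
    "\<And>f B. f \<in> borel_measurable borel \<Longrightarrow> (\<And>x. \<bar>f x :: real\<bar> \<le> B) \<Longrightarrow> (\<integral>x. f x \<partial>\<sigma>) = (\<integral>x. f x \<partial>\<mu>) + c * f 0"
proof -
  interpret \<mu>: finite_measure \<mu> by (rule \<mu>(1))
  note [measurable_cong] = \<mu>(2)
  define m where "m A = emeasure \<mu> A + ennreal c * emeasure (dirac0 :: 'a measure) A" for A
  define \<sigma> where "\<sigma> = measure_of UNIV (sets borel) m"
  have sets_\<sigma>: "sets \<sigma> = sets borel" unfolding \<sigma>_def by (simp add: sets.sigma_sets_eq[of borel, simplified])
  note [measurable_cong] = sets_\<sigma>
  have em: "emeasure \<sigma> A = m A" if A: "A \<in> sets borel" for A
    unfolding \<sigma>_def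
  proof (rule emeasure_measure_of_sigma)
    show "sigma_algebra UNIV (sets (borel :: 'a measure))" using sets.sigma_algebra_axioms[of borel] by simp
    show "positive (sets borel) m" by (simp add: positive_def m_def)
    show "countably_additive (sets borel) m"
    proof (rule countably_additiveI)
      fix A :: "nat \<Rightarrow> 'a set"
      assume A: "range A \<subseteq> sets borel" "disjoint_family A"
      have "(\<Sum>i. m (A i)) = (\<Sum>i. emeasure \<mu> (A i)) + (\<Sum>i. ennreal c * emeasure dirac0 (A i))"
        unfolding m_def by (rule suminf_add[symmetric]) auto
      also have "\<dots> = (\<Sum>i. emeasure \<mu> (A i)) + ennreal c * (\<Sum>i. emeasure dirac0 (A i))"
        by (simp add: ennreal_suminf_cmult)
      also have "(\<Sum>i. emeasure \<mu> (A i)) = emeasure \<mu> (\<Union>i. A i)"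
        using A by (intro suminf_emeasure) (auto simp: \<mu>(2))
      also have "(\<Sum>i. emeasure dirac0 (A i)) = emeasure dirac0 (\<Union>i. A i)"
        using A by (intro suminf_emeasure) auto
      finally show "(\<Sum>i. m (A i)) = m (\<Union>i. A i)" by (simp add: m_def)
    qed
  qed (rule A)
  have fin: "finite_measure \<sigma>"
    by (rule finite_measureI)
      (use em[of UNIV] sets_eq_imp_space_eq[OF sets_\<sigma>] sets_eq_imp_space_eq[OF \<mu>(2)] \<mu>.emeasure_finite[of UNIV]
        in \<open>auto simp: m_def ennreal_mult_eq_top_iff\<close>)
  have nn: "(\<integral>\<^sup>+x. f x \<partial>\<sigma>) = (\<integral>\<^sup>+x. f x \<partial>\<mu>) + ennreal c * f 0" if "f \<in> borel_measurable borel" for f :: "'a \<Rightarrow> ennreal"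
    using that
  proof (induction rule: borel_measurable_induct)
    case (cong f g)
    then show ?case by simp
  next
    case (set A)
    then show ?case using em[of A] by (simp add: m_def \<mu>(2) sets_\<sigma>)
  next
    case (mult f a)
    note [measurable] = mult(2)
    show ?case by (simp add: nn_integral_cmult mult distrib_left mult.left_commute)
  next
    case (add f g)
    note [measurable] = add(1,3)
    have [measurable]: "f \<in> borel_measurable borel" "g \<in> borel_measurable borel" using add by auto
    show ?case using add by (simp add: nn_integral_add distrib_left ac_simps)
  next
    case (seq U)
    have [measurable]: "\<And>i. U i \<in> borel_measurable borel" using seq by auto
    have inc0: "incseq (\<lambda>i. U i 0)" using seq(3) by (auto simp: incseq_def le_fun_def)
    have "(\<integral>\<^sup>+x. (SUP i. U i) x \<partial>\<sigma>) = (SUP i. \<integral>\<^sup>+x. U i x \<partial>\<sigma>)"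
      unfolding SUP_apply by (rule nn_integral_monotone_convergence_SUP[OF seq(3)]) measurable
    also have "\<dots> = (SUP i. (\<integral>\<^sup>+x. U i x \<partial>\<mu>) + ennreal c * U i 0)" using seq by simp
    also have "\<dots> = (SUP i. \<integral>\<^sup>+x. U i x \<partial>\<mu>) + (SUP i. ennreal c * U i 0)"
      using seq(3) inc0
      by (intro ennreal_SUP_add) (auto simp: incseq_def le_fun_def intro!: nn_integral_mono mult_left_mono)
    also have "\<dots> = (\<integral>\<^sup>+x. (SUP i. U i) x \<partial>\<mu>) + ennreal c * (SUP i. U i) 0"
      unfolding SUP_apply by (subst nn_integral_monotone_convergence_SUP[OF seq(3)]) (auto simp: SUP_mult_left_ennreal)
    finally show ?case .
  qed
  have int: "(\<integral>x. f x \<partial>\<sigma>) = (\<integral>x. f x \<partial>\<mu>) + c * f 0"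
    if f[measurable]: "f \<in> borel_measurable borel" and B: "\<And>x. \<bar>f x :: real\<bar> \<le> B" for f B
  proof -
    have i\<mu>: "integrable \<mu> f" by (rule \<mu>.integrable_const_bound[of _ B]) (use B in auto)
    have i\<sigma>: "integrable \<sigma> f" by (rule finite_measure.integrable_const_bound[OF fin, of _ B]) (use B in auto)
    have t: "(\<integral>\<^sup>+x. ennreal (g x) \<partial>\<mu>) < \<infinity>" if "g \<in> borel_measurable borel" "\<And>x. \<bar>g x :: real\<bar> \<le> B" for g
    proof -
      have "integrable \<mu> g" by (rule \<mu>.integrable_const_bound[of _ B]) (use that in auto)
      then have "(\<integral>\<^sup>+x. ennreal (norm (g x)) \<partial>\<mu>) < \<infinity>" by (simp add: integrable_iff_bounded)
      then show ?thesis by (rule le_less_trans[rotated]) (auto intro!: nn_integral_mono ennreal_leI)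
    qed
    \<comment> \<open>The \<open>max 0\<close> reflects the truncation in \<open>ennreal\<close>;
      applied to f(0) and to -f(0), the two values recombine to f(0).\<close>
    have e: "enn2real (ennreal c * ennreal y) = c * max 0 y" for y
      using c by (cases "0 \<le> y") (auto simp: enn2real_mult ennreal_neg)
    have "(\<integral>x. f x \<partial>\<sigma>) = (enn2real (\<integral>\<^sup>+x. f x \<partial>\<mu>) + c * max 0 (f 0)) - (enn2real (\<integral>\<^sup>+x. - f x \<partial>\<mu>) + c * max 0 (- f 0))"
      unfolding real_lebesgue_integral_def[OF i\<sigma>]
      using nn[of "\<lambda>x. ennreal (f x)"] nn[of "\<lambda>x. ennreal (- f x)"] t[of f] t[of "\<lambda>x. - f x"] B
      by (simp add: enn2real_plus e ennreal_mult_less_top)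
    also have "\<dots> = (\<integral>x. f x \<partial>\<mu>) + c * f 0"
      unfolding real_lebesgue_integral_def[OF i\<mu>] by (simp add: algebra_simps max_def)
    finally show ?thesis .
  qed
  show thesis
  proof (rule that[of \<sigma>])
    show "finite_radon \<sigma>" using fin sets_\<sigma> by (simp add: finite_radon_def)
    show "emeasure \<sigma> A = emeasure \<mu> A + ennreal c * emeasure dirac0 A" if "A \<in> sets borel" for A
      using em[OF that] by (simp add: m_def)
  qed (rule int)
qed

lemma tendsto_0_at_infinity_bounded_support:
  fixes f :: "'a::euclidean_space \<Rightarrow> real"
  assumes "\<And>x. R \<le> norm x \<Longrightarrow> f x = 0"
  shows "(f \<longlongrightarrow> 0) at_infinity"
  using assms by (intro tendsto_eventually) (auto simp: eventually_at_infinity)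

text \<open>Where |x| >= \<rho> the Hardy weight is at most \<rho>^(-p\<theta>), so strong L^p
  convergence is enough. Only measurability of g is asked, because g will be a continuous function
  cut off sharply at the sphere of radius \<rho>.\<close>

lemma hardy_measure_tendsto_away:
  fixes u :: "nat \<Rightarrow> 'a::euclidean_space \<Rightarrow> real" and p :: real
  assumes p: "1 < p" and t: "0 \<le> \<theta>"
    and [measurable]: "\<And>k. u k \<in> borel_measurable borel" "v \<in> borel_measurable borel"
    and lim: "(\<lambda>k. \<integral>\<^sup>+x. ennreal (norm (u k x - v x) powr p) \<partial>lborel) \<longlonglongrightarrow> 0"
    and vp: "(\<integral>\<^sup>+x. ennreal (norm (v x) powr p) \<partial>lborel) < \<infinity>"
    and fin: "\<And>k. finite_measure (hardy_measure p \<theta> (u k))" "finite_measure (hardy_measure p \<theta> v)"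
    and g[measurable]: "g \<in> borel_measurable borel" and B: "\<And>x. \<bar>g x :: real\<bar> \<le> B" and \<rho>: "0 < \<rho>" "\<And>x. norm x < \<rho> \<Longrightarrow> g x = 0"
  shows "(\<lambda>k. \<integral>x. g x \<partial>hardy_measure p \<theta> (u k)) \<longlonglongrightarrow> (\<integral>x. g x \<partial>hardy_measure p \<theta> v)"
proof -
  have B0: "0 \<le> B" using B[of 0] by linarith
  have pos: "(\<lambda>k. enn2real (\<integral>\<^sup>+x. ennreal (f x) \<partial>hardy_measure p \<theta> (u k))) \<longlonglongrightarrow> enn2real (\<integral>\<^sup>+x. ennreal (f x) \<partial>hardy_measure p \<theta> v)"
    if f[measurable]: "f \<in> borel_measurable borel" and fB: "\<And>x. f x \<le> B" "\<And>x. norm x < \<rho> \<Longrightarrow> f x = 0" for f :: "'a \<Rightarrow> real"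
  proof -
    have "ennreal (f x) * ennreal (1 / norm x powr (p * \<theta>)) \<le> ennreal (B / \<rho> powr (p * \<theta>))" for x
    proof (cases "0 \<le> f x \<and> \<rho> \<le> norm x")
      case True
      then have "f x * (1 / norm x powr (p * \<theta>)) \<le> B * (1 / \<rho> powr (p * \<theta>))"
        using fB(1)[of x] \<rho>(1) p t B0 by (intro mult_mono divide_left_mono powr_mono2 mult_pos_pos) auto
      then show ?thesis using True by (simp add: ennreal_mult[symmetric] ennreal_leI)
    next
      case False
      then have "ennreal (f x) = 0" using fB(2)[of x] by (auto simp: ennreal_neg not_le)
      then show ?thesis by simp
    qed
    then have "(\<lambda>k. \<integral>\<^sup>+x. (ennreal (f x) * ennreal (1 / norm x powr (p * \<theta>))) * ennreal (norm (u k x) powr p) \<partial>lborel) \<longlonglongrightarrow>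
       (\<integral>\<^sup>+x. (ennreal (f x) * ennreal (1 / norm x powr (p * \<theta>))) * ennreal (norm (v x) powr p) \<partial>lborel)"
      using p by (intro nn_integral_powr_tendsto[OF _ _ _ _ lim vp, where B="B / \<rho> powr (p * \<theta>)"]) auto
    moreover have eq: "(\<integral>\<^sup>+x. (ennreal (f x) * ennreal (1 / norm x powr (p * \<theta>))) * ennreal (norm (w x) powr p) \<partial>lborel) =
       (\<integral>\<^sup>+x. ennreal (f x) \<partial>hardy_measure p \<theta> w)" if "w \<in> borel_measurable borel" for w :: "'a \<Rightarrow> real"
      using that by (subst nn_integral_hardy_measure) (auto simp: mult.assoc ennreal_mult[symmetric])
    moreover have "(\<integral>\<^sup>+x. ennreal (f x) \<partial>hardy_measure p \<theta> v) < \<infinity>"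
    proof -
      have "(\<integral>\<^sup>+x. ennreal (f x) \<partial>hardy_measure p \<theta> v) \<le> (\<integral>\<^sup>+x. ennreal B \<partial>hardy_measure p \<theta> v)"
        using fB by (intro nn_integral_mono ennreal_leI) auto
      also have "\<dots> < \<infinity>"
        using finite_measure.emeasure_finite[OF fin(2), of UNIV] by (simp add: ennreal_mult_less_top less_top)
      finally show ?thesis .
    qed
    ultimately show ?thesis
      using tendsto_enn2real[of "\<lambda>k. \<integral>\<^sup>+x. ennreal (f x) \<partial>hardy_measure p \<theta> (u k)" "enn2real (\<integral>\<^sup>+x. ennreal (f x) \<partial>hardy_measure p \<theta> v)" sequentially]
      by (simp add: less_top)
  qed
  have int: "integrable (hardy_measure p \<theta> w) g" if "finite_measure (hardy_measure p \<theta> w)" for w :: "'a \<Rightarrow> real"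
    by (rule finite_measure.integrable_const_bound[OF that, of _ B])
      (use B in \<open>auto simp: measurable_cong_sets[OF hardy_measure_simps(1) refl]\<close>)
  show ?thesis
    unfolding real_lebesgue_integral_def[OF int[OF fin(1)]] real_lebesgue_integral_def[OF int[OF fin(2)]]
    using B \<rho>(2) by (intro tendsto_diff pos) (auto simp: abs_le_iff)
qed

text \<open>Functions vanishing at 0 have convergent integrals: the part near the origin is small
  uniformly in k, the rest is covered by strong convergence. A general f is f - f(0) plus a
  constant, and the constant sees only the total mass. So all mass lost in the limit sits at the
  origin.\<close>

lemma hardy_measure_weak_limit:
  fixes u :: "nat \<Rightarrow> 'a::euclidean_space \<Rightarrow> real" and p :: real
  assumes p: "1 < p" and t: "0 \<le> \<theta>"
    and [measurable]: "\<And>k. u k \<in> borel_measurable borel" "v \<in> borel_measurable borel"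
    and lim: "(\<lambda>k. \<integral>\<^sup>+x. ennreal (norm (u k x - v x) powr p) \<partial>lborel) \<longlonglongrightarrow> 0"
    and vp: "(\<integral>\<^sup>+x. ennreal (norm (v x) powr p) \<partial>lborel) < \<infinity>"
    and fin: "\<And>k. finite_measure (hardy_measure p \<theta> (u k))" "finite_measure (hardy_measure p \<theta> v)"
    and mass: "(\<lambda>k. measure (hardy_measure p \<theta> (u k)) UNIV) \<longlonglongrightarrow> m"
  shows "measure (hardy_measure p \<theta> v) UNIV \<le> m" (is "?mv \<le> m")
    "\<And>f B. continuous_on UNIV f \<Longrightarrow> (\<And>x. \<bar>f x :: real\<bar> \<le> B) \<Longrightarrow>
      (\<lambda>k. \<integral>x. f x \<partial>hardy_measure p \<theta> (u k)) \<longlonglongrightarrow> (\<integral>x. f x \<partial>hardy_measure p \<theta> v) + (m - measure (hardy_measure p \<theta> v) UNIV) * f 0"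
proof -
  define \<sigma> where "\<sigma> k = hardy_measure p \<theta> (u k)" for k
  define \<tau> where "\<tau> = hardy_measure p \<theta> v"
  have fin': "finite_measure (\<sigma> k)" "finite_measure \<tau>" for k using fin by (auto simp: \<sigma>_def \<tau>_def)
  have [measurable_cong]: "sets (\<sigma> k) = sets borel" "sets \<tau> = sets borel" for k by (auto simp: \<sigma>_def \<tau>_def)
  have sp: "space (\<sigma> k) = UNIV" "space \<tau> = UNIV" for k by (auto simp: \<sigma>_def \<tau>_def)
  have Bs: "Bseq (\<lambda>k. measure (\<sigma> k) UNIV)"
    using mass by (intro convergent_imp_Bseq) (auto simp: convergent_def \<sigma>_def)
  then obtain M0 where M0: "0 < M0" "\<And>k. measure (\<sigma> k) UNIV \<le> M0" by (auto simp: Bseq_def)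
  define M where "M = max M0 (measure \<tau> UNIV)"
  have M: "0 < M" "\<And>k. measure (\<sigma> k) UNIV \<le> M" "measure \<tau> UNIV \<le> M"
    using M0 by (auto simp: M_def intro: order_trans max.coboundedI1)
  have zero: "(\<lambda>k. \<integral>x. f x \<partial>\<sigma> k) \<longlonglongrightarrow> (\<integral>x. f x \<partial>\<tau>)"
    if f: "continuous_on UNIV f" and B: "\<And>x. \<bar>f x :: real\<bar> \<le> B" and f0: "f 0 = 0" for f B
  proof (rule LIMSEQ_I)
    have [measurable]: "f \<in> borel_measurable borel" using f by (rule borel_measurable_continuous_onI)
    fix e :: real
    assume e: "0 < e"
    \<comment> \<open>Near the origin |f| < d, and M bounds the masses of all measures involved.
      This part costs at most e/4 for the k-th measure and e/4 for the limit; a further e/4 is for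
      the part away from 0.\<close>
    define d where "d = e / (4 * M)"
    have d: "0 < d" using e M by (simp add: d_def)
    obtain \<rho> where \<rho>: "0 < \<rho>" "\<And>x. norm x < \<rho> \<Longrightarrow> \<bar>f x\<bar> < d"
      using f d f0 unfolding continuous_on_iff by (metis UNIV_I dist_0_norm dist_commute dist_norm diff_zero real_norm_def)
    define g where "g x = f x * indicator (- ball 0 \<rho>) x" for x
    define h where "h x = f x * indicator (ball 0 \<rho>) x" for x
    have [measurable]: "(ball 0 \<rho> :: 'a set) \<in> sets borel" by simp
    have [measurable]: "g \<in> borel_measurable borel" "h \<in> borel_measurable borel" unfolding g_def h_def by measurable
    have fgh: "f x = g x + h x" for x by (auto simp: g_def h_def indicator_def)
    have gB: "\<bar>g x\<bar> \<le> B" for x using B[of x] by (auto simp: g_def indicator_def)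
    have hd: "\<bar>h x\<bar> \<le> d" for x using \<rho>(2)[of x] d by (auto simp: h_def indicator_def)
    have "(\<lambda>k. \<integral>x. g x \<partial>\<sigma> k) \<longlonglongrightarrow> (\<integral>x. g x \<partial>\<tau>)"
      unfolding \<sigma>_def \<tau>_def
      by (rule hardy_measure_tendsto_away[OF p t _ _ lim vp fin _ gB \<rho>(1)]) (auto simp: g_def)
    then obtain k0 where k0: "\<And>k. k \<ge> k0 \<Longrightarrow> \<bar>(\<integral>x. g x \<partial>\<sigma> k) - (\<integral>x. g x \<partial>\<tau>)\<bar> < e / 4"
      using e LIMSEQ_D[of "\<lambda>k. \<integral>x. g x \<partial>\<sigma> k" "\<integral>x. g x \<partial>\<tau>" "e / 4"] by auto
    have split: "(\<integral>x. f x \<partial>\<nu>) = (\<integral>x. g x \<partial>\<nu>) + (\<integral>x. h x \<partial>\<nu>) \<and> \<bar>\<integral>x. h x \<partial>\<nu>\<bar> \<le> d * M"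
      if \<nu>: "finite_measure \<nu>" "sets \<nu> = sets borel" "space \<nu> = UNIV" "measure \<nu> UNIV \<le> M" for \<nu> :: "'a measure"
    proof
      note [measurable_cong] = \<nu>(2)
      have i: "integrable \<nu> g" "integrable \<nu> h"
        by (rule finite_measure.integrable_const_bound[OF \<nu>(1), of _ B], use gB in auto)
           (rule finite_measure.integrable_const_bound[OF \<nu>(1), of _ d], use hd in auto)
      then show "(\<integral>x. f x \<partial>\<nu>) = (\<integral>x. g x \<partial>\<nu>) + (\<integral>x. h x \<partial>\<nu>)" by (simp add: fgh)
      have "norm (\<integral>x. h x \<partial>\<nu>) \<le> (\<integral>x. norm (h x) \<partial>\<nu>)" by (rule integral_norm_bound)
      also have "\<dots> \<le> (\<integral>x. d \<partial>\<nu>)"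
        using i hd by (intro integral_mono) (auto intro: finite_measure.integrable_const[OF \<nu>(1)])
      also have "\<dots> = d * measure \<nu> UNIV" using \<nu>(3) by simp
      also have "\<dots> \<le> d * M" using \<nu>(4) d by (intro mult_left_mono) auto
      finally show "\<bar>\<integral>x. h x \<partial>\<nu>\<bar> \<le> d * M" by simp
    qed
    have dM: "d * M = e / 4" using M by (simp add: d_def)
    have "\<bar>(\<integral>x. f x \<partial>\<sigma> k) - (\<integral>x. f x \<partial>\<tau>)\<bar> < e" if "k \<ge> k0" for k
      using k0[OF that] split[of "\<sigma> k"] split[of \<tau>] fin' M dM by (auto simp: \<sigma>_def \<tau>_def)
    then show "\<exists>k0. \<forall>k\<ge>k0. norm ((\<integral>x. f x \<partial>\<sigma> k) - (\<integral>x. f x \<partial>\<tau>)) < e" by auto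
  qed
  show lim': "(\<lambda>k. \<integral>x. f x \<partial>hardy_measure p \<theta> (u k)) \<longlonglongrightarrow> (\<integral>x. f x \<partial>hardy_measure p \<theta> v) + (m - ?mv) * f 0"
    if f: "continuous_on UNIV f" and B: "\<And>x. \<bar>f x :: real\<bar> \<le> B" for f B
  proof -
    have [measurable]: "f \<in> borel_measurable borel" using f by (rule borel_measurable_continuous_onI)
    \<comment> \<open>The oscillation f - f(0) vanishes at the origin, and the removed constant is
      integrated through the converging masses.\<close>
    have B2: "\<bar>f x - f 0\<bar> \<le> 2 * B" for x using B[of x] B[of 0] by linarith
    have "continuous_on UNIV (\<lambda>x. f x - f 0)" by (intro continuous_on_diff f continuous_on_const)
    from zero[OF this B2]
    have "(\<lambda>k. (\<integral>x. f x - f 0 \<partial>\<sigma> k) + measure (\<sigma> k) UNIV * f 0) \<longlonglongrightarrow> (\<integral>x. f x - f 0 \<partial>\<tau>) + m * f 0"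
      using mass unfolding \<sigma>_def[symmetric] by (intro tendsto_add tendsto_mult tendsto_const) simp
    moreover have "(\<integral>x. f x - f 0 \<partial>\<nu>) = (\<integral>x. f x \<partial>\<nu>) - measure \<nu> UNIV * f 0"
      if \<nu>: "finite_measure \<nu>" "sets \<nu> = sets borel" "space \<nu> = UNIV" for \<nu> :: "'a measure"
    proof -
      note [measurable_cong] = \<nu>(2)
      have "integrable \<nu> f" by (rule finite_measure.integrable_const_bound[OF \<nu>(1), of _ B]) (use B in auto)
      then show ?thesis
        using \<nu>(3) finite_measure.integrable_const[OF \<nu>(1), of "f 0"] by simp
    qed
    ultimately show ?thesis using fin' sp unfolding \<sigma>_def \<tau>_def by (simp add: algebra_simps)
  qed
  \<comment> \<open>These functions vanish at 0 and tend to 1 elsewhere. Their integrals pass to the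
    limit in k without loss and stay below m; since \<tau> has no atom at 0, they recover its total
    mass.\<close>
  have "(\<lambda>n. \<integral>x. min 1 (real n * norm x) \<partial>\<tau>) \<longlonglongrightarrow> (\<integral>x. 1 \<partial>\<tau>)"
  proof (rule integral_dominated_convergence[where w="\<lambda>_. 1"])
    show "integrable \<tau> (\<lambda>_. 1 :: real)" by (rule finite_measure.integrable_const[OF fin'(2)])
    have "AE x in \<tau>. x \<noteq> 0"
      unfolding \<tau>_def hardy_measure_def by (subst AE_density) (auto intro: AE_mp[OF AE_lborel_singleton])
    then show "AE x in \<tau>. (\<lambda>n. min 1 (real n * norm x)) \<longlonglongrightarrow> 1"
    proof eventually_elim
      case (elim x)
      obtain n0 :: nat where n0: "1 / norm x < n0" using reals_Archimedean2 by blast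
      have "\<forall>\<^sub>F n in sequentially. min 1 (real n * norm x) = 1"
        using eventually_ge_at_top[of n0]
      proof eventually_elim
        case (elim n)
        have "1 / norm x \<le> real n" using n0 elim by linarith
        then show ?case using \<open>x \<noteq> 0\<close> by (simp add: divide_le_eq)
      qed
      then show ?case by (rule tendsto_eventually)
    qed
  qed auto
  then have l: "(\<lambda>n. \<integral>x. min 1 (real n * norm x) \<partial>\<tau>) \<longlonglongrightarrow> measure \<tau> UNIV" using sp by simp
  have "(\<integral>x. min 1 (real n * norm x) \<partial>\<tau>) \<le> m" for n
  proof (rule LIMSEQ_le)
    show "(\<lambda>k. \<integral>x. min 1 (real n * norm x) \<partial>\<sigma> k) \<longlonglongrightarrow> (\<integral>x. min 1 (real n * norm x) \<partial>\<tau>)"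
      by (rule zero[where B=1]) (auto intro!: continuous_intros)
    show "(\<lambda>k. measure (\<sigma> k) UNIV) \<longlonglongrightarrow> m" using mass by (simp add: \<sigma>_def)
    have "(\<integral>x. min 1 (real n * norm x) \<partial>\<sigma> k) \<le> (\<integral>x. 1 \<partial>\<sigma> k)" for k
      by (intro integral_mono finite_measure.integrable_const_bound[OF fin'(1), of _ 1]) (auto simp: finite_measure.integrable_const[OF fin'(1)])
    then show "\<exists>N. \<forall>k\<ge>N. (\<integral>x. min 1 (real n * norm x) \<partial>\<sigma> k) \<le> measure (\<sigma> k) UNIV" using sp by simp
  qed
  then show "?mv \<le> m" using LIMSEQ_le_const2[OF l] by (auto simp: \<tau>_def)
qed

section \<open>The atom at the origin\<close>

text \<open>Continuous functions that equal 1 on K and vanish at distance 1/(n+1) and beyond.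
  Compactness gives them bounded support, so they are admissible in weak-* convergence.\<close>

lemma compact_cutoff:
  fixes K :: "'a::euclidean_space set"
  assumes K: "compact K" "K \<noteq> {}"
  defines "f \<equiv> \<lambda>n x. max 0 (1 - real (Suc n) * infdist x K)"
  shows "continuous_on UNIV (f n)" "(f n \<longlongrightarrow> 0) at_infinity" "0 \<le> f n x" "f n x \<le> 1"
    "x \<in> K \<Longrightarrow> f n x = 1" "(\<lambda>n. f n x) \<longlonglongrightarrow> indicator K x"
proof -
  show "continuous_on UNIV (f n)" unfolding f_def by (intro continuous_intros)
  show "0 \<le> f n x" "f n x \<le> 1" by (auto simp: f_def infdist_nonneg)
  show one: "x \<in> K \<Longrightarrow> f n x = 1" for n by (simp add: f_def)
  obtain R where R: "\<And>x. x \<in> K \<Longrightarrow> norm x \<le> R" using compact_imp_bounded[OF K(1)] by (auto simp: bounded_iff)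
  show "(f n \<longlongrightarrow> 0) at_infinity"
  proof (rule tendsto_0_at_infinity_bounded_support)
    fix x :: 'a
    assume x: "R + 1 \<le> norm x"
    obtain y where y: "y \<in> K" "infdist x K = dist x y"
      using infdist_attains_inf[OF compact_imp_closed[OF K(1)] K(2)] by blast
    have "1 \<le> infdist x K" using R[OF y(1)] x norm_triangle_ineq2[of x y] unfolding y(2) dist_norm by linarith
    then have "1 * 1 \<le> real (Suc n) * infdist x K" by (intro mult_mono) auto
    then show "f n x = 0" by (simp add: f_def)
  qed
  show "(\<lambda>n. f n x) \<longlonglongrightarrow> indicator K x"
  proof (cases "x \<in> K")
    case True
    then show ?thesis using one by simp
  next
    case False
    then have pos: "0 < infdist x K"
      using in_closed_iff_infdist_zero[OF compact_imp_closed[OF K(1)] K(2), of x] infdist_nonneg[of x K] by linarith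
    obtain n0 :: nat where n0: "1 / infdist x K < n0" using reals_Archimedean2 by blast
    have "\<forall>\<^sub>F n in sequentially. f n x = 0"
      using eventually_ge_at_top[of n0]
    proof eventually_elim
      case (elim n)
      have "1 / infdist x K \<le> real (Suc n)" using n0 elim by linarith
      then have "1 \<le> real (Suc n) * infdist x K" using pos by (simp add: divide_le_eq)
      then show ?case by (simp add: f_def)
    qed
    then show ?thesis using False by (simp add: tendsto_eventually)
  qed
qed

text \<open>For compact sets the cutoffs are integrated: lower semicontinuity bounds the energy of v
  by the limit of the energies, which is the integral against \<omega>, and then the cutoffs shrink
  to the compact set. Inner regularity extends the bound to Borel sets.\<close>

lemma energy_measure_le:
  fixes u :: "nat \<Rightarrow> 'a::euclidean_space \<Rightarrow> real" and p s :: real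
  assumes p: "1 < p" and u: "\<And>k. u k \<in> X_space p s \<Omega>" and v: "v \<in> X_space p s \<Omega>"
    and weak: "X_weakly_converges p s \<Omega> u v"
    and \<omega>: "finite_radon \<omega>" "weak_star_converges (\<lambda>k. energy_measure p s (u k)) \<omega>"
    and A: "A \<in> sets borel"
  shows "emeasure (energy_measure p s v) A \<le> emeasure \<omega> A"
proof -
  have fin\<omega>: "finite_measure \<omega>" and sets\<omega>[measurable_cong]: "sets \<omega> = sets borel"
    using \<omega>(1) by (auto simp: finite_radon_def)
  note finE = finite_measure_energy_measure[OF u] finite_measure_energy_measure[OF v]
  have comp: "emeasure (energy_measure p s v) K \<le> emeasure \<omega> K" if K: "compact K" for K
  proof (cases "K = {}")
    case False
    define f where "f n x = max 0 (1 - real (Suc n) * infdist x K)" for n x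
    note f = compact_cutoff[OF K False, folded f_def]
    have [measurable]: "f n \<in> borel_measurable borel" for n using f(1) by (rule borel_measurable_continuous_onI)
    have [measurable]: "K \<in> sets borel" using K by (simp add: borel_compact)
    have le: "emeasure (energy_measure p s v) K \<le> (\<integral>\<^sup>+x. ennreal (f n x) \<partial>\<omega>)" for n
    proof -
      obtain c where c: "c \<longlonglongrightarrow> 0"
        "\<And>k. (\<integral>\<^sup>+x. ennreal (f n x) \<partial>energy_measure p s v) \<le> (\<integral>\<^sup>+x. ennreal (f n x) \<partial>energy_measure p s (u k)) + ennreal (c k)"
        by (rule energy_lower_semicontinuous[OF p u v weak, of "f n" 1]) (use f(3,4) in auto)
      have i: "(\<integral>\<^sup>+x. ennreal (f n x) \<partial>\<nu>) = ennreal (\<integral>x. f n x \<partial>\<nu>)"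
        if \<nu>: "finite_measure \<nu>" "sets \<nu> = sets borel" for \<nu> :: "'a measure"
      proof -
        note [measurable_cong] = \<nu>(2)
        show ?thesis
          by (intro nn_integral_eq_integral finite_measure.integrable_const_bound[OF \<nu>(1), of _ 1]) (use f(3,4) in auto)
      qed
      have "emeasure (energy_measure p s v) K = (\<integral>\<^sup>+x. indicator K x \<partial>energy_measure p s v)" by simp
      also have "\<dots> \<le> (\<integral>\<^sup>+x. ennreal (f n x) \<partial>energy_measure p s v)"
        using f(5) by (intro nn_integral_mono) (auto simp: indicator_def)
      also have "\<dots> \<le> (\<integral>\<^sup>+x. ennreal (f n x) \<partial>\<omega>)"
      proof (rule LIMSEQ_le_const)
        have "(\<lambda>k. ennreal (\<integral>x. f n x \<partial>energy_measure p s (u k)) + ennreal (c k)) \<longlonglongrightarrow> ennreal (\<integral>x. f n x \<partial>\<omega>) + ennreal 0"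
          using \<omega>(2) f(1,2) c(1) unfolding weak_star_converges_def by (intro tendsto_add tendsto_ennrealI) auto
        then show "(\<lambda>k. (\<integral>\<^sup>+x. ennreal (f n x) \<partial>energy_measure p s (u k)) + ennreal (c k)) \<longlonglongrightarrow> (\<integral>\<^sup>+x. ennreal (f n x) \<partial>\<omega>)"
          by (simp add: i[OF finE(1)] i[OF fin\<omega> sets\<omega>])
        show "\<exists>N. \<forall>k\<ge>N. (\<integral>\<^sup>+x. ennreal (f n x) \<partial>energy_measure p s v) \<le> (\<integral>\<^sup>+x. ennreal (f n x) \<partial>energy_measure p s (u k)) + ennreal (c k)"
          using c(2) by blast
      qed
      finally show ?thesis .
    qed
    have "(\<lambda>n. \<integral>\<^sup>+x. ennreal (f n x) \<partial>\<omega>) \<longlonglongrightarrow> (\<integral>\<^sup>+x. ennreal (indicator K x) \<partial>\<omega>)"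
    proof (rule nn_integral_dominated_convergence[where w="\<lambda>_. 1"])
      show "AE x in \<omega>. (\<lambda>n. ennreal (f n x)) \<longlonglongrightarrow> ennreal (indicator K x)"
        by (intro AE_I2 tendsto_ennrealI f(6))
      show "(\<integral>\<^sup>+x. 1 \<partial>\<omega>) < \<infinity>" using finite_measure.emeasure_finite[OF fin\<omega>] by (simp add: less_top)
      show "AE x in \<omega>. ennreal (f n x) \<le> 1" for n using f(4) by (intro AE_I2) (simp add: ennreal_le_1)
    qed measurable
    moreover have "(\<integral>\<^sup>+x. ennreal (indicator K x) \<partial>\<omega>) = emeasure \<omega> K"
      by (simp add: ennreal_indicator sets\<omega>)
    ultimately show ?thesis
      using LIMSEQ_le_const[of "\<lambda>n. \<integral>\<^sup>+x. ennreal (f n x) \<partial>\<omega>" "emeasure \<omega> K"] le by auto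
  qed simp
  have "emeasure (energy_measure p s v) A = (SUP K\<in>{K. K \<subseteq> A \<and> compact K}. emeasure (energy_measure p s v) K)"
    by (rule inner_regular) (use A finite_measure.emeasure_finite[OF finE(2)] in auto)
  also have "\<dots> \<le> emeasure \<omega> A"
  proof (rule SUP_least)
    fix K assume "K \<in> {K. K \<subseteq> A \<and> compact K}"
    then show "emeasure (energy_measure p s v) K \<le> emeasure \<omega> A"
      using order_trans[OF comp emeasure_mono[of K A \<omega>]] A sets\<omega> by auto
  qed
  finally show ?thesis .
qed

lemma energy_measure_plus_atom_le:
  fixes v :: "'a::euclidean_space \<Rightarrow> real"
  assumes v: "v \<in> X_space p s \<Omega>" and \<omega>: "finite_radon \<omega>"
    and le: "\<And>A. A \<in> sets borel \<Longrightarrow> emeasure (energy_measure p s v) A \<le> emeasure \<omega> A"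
    and A: "A \<in> sets borel"
  shows "emeasure (energy_measure p s v) A + ennreal (measure \<omega> {0}) * emeasure dirac0 A \<le> emeasure \<omega> A"
proof (cases "0 \<in> A")
  case True
  note [measurable] = X_spaceD(1,3)[OF v]
  have fin\<omega>: "finite_measure \<omega>" and sets\<omega>: "sets \<omega> = sets borel"
    using \<omega> by (auto simp: finite_radon_def)
  have "emeasure (energy_measure p s v) {0} = 0"
  proof -
    have "AE x in lborel. (ennreal (norm (weak_grad v x) powr p) + frac_density p s v x) * indicator {0} x = 0"
      using AE_lborel_singleton[of "0::'a"] by eventually_elim simp
    then have "(\<integral>\<^sup>+x. (ennreal (norm (weak_grad v x) powr p) + frac_density p s v x) * indicator {0} x \<partial>lborel) = 0"
      by (subst nn_integral_0_iff_AE) auto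
    then show ?thesis unfolding energy_measure_def by (subst emeasure_density) auto
  qed
  then have "emeasure (energy_measure p s v) A = emeasure (energy_measure p s v) (A - {0})"
    using emeasure_Un_null_set[of "A - {0}" "energy_measure p s v" "{0}"] A True
    by (simp add: null_sets_def insert_absorb)
  also have "\<dots> \<le> emeasure \<omega> (A - {0})" using A by (intro le) auto
  finally have "emeasure (energy_measure p s v) A + ennreal (measure \<omega> {0}) * emeasure dirac0 A \<le> emeasure \<omega> (A - {0}) + emeasure \<omega> {0}"
    using True A by (auto simp: finite_measure.emeasure_eq_measure[OF fin\<omega>] intro: add_right_mono)
  also have "\<dots> = emeasure \<omega> A"
    using A True sets\<omega> by (subst plus_emeasure) (auto simp: insert_absorb)
  finally show ?thesis .
next
  case False
  then show ?thesis using le[OF A] A by simp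
qed

lemma hardy_atom_subcritical:
  fixes u :: "nat \<Rightarrow> 'a::euclidean_space \<Rightarrow> real" and p :: real
  assumes p: "1 < p" and t: "0 \<le> \<theta>" "\<theta> < 1"
    and [measurable]: "\<And>k. u k \<in> borel_measurable borel" "v \<in> borel_measurable borel"
    and H: "0 \<le> H" "\<And>k. (\<integral>\<^sup>+x. ennreal (\<bar>u k x\<bar> powr p / norm x powr p) \<partial>lborel) \<le> ennreal H"
    and fin: "\<And>k. finite_measure (hardy_measure p \<theta> (u k))"
    and lim: "\<And>f B. continuous_on UNIV f \<Longrightarrow> (\<And>x. \<bar>f x :: real\<bar> \<le> B) \<Longrightarrow>
      (\<lambda>k. \<integral>x. f x \<partial>hardy_measure p \<theta> (u k)) \<longlonglongrightarrow> (\<integral>x. f x \<partial>hardy_measure p \<theta> v) + c * f 0"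
  shows "c \<le> 0"
proof -
  have bound: "c \<le> \<rho> powr (p * (1 - \<theta>)) * H" if \<rho>: "0 < \<rho>" for \<rho>
  proof -
    \<comment> \<open>A tent that gives the atom full weight, f(0) = 1, and vanishes outside the
      ball of radius \<rho>.\<close>
    define f where "f x = max 0 (1 - norm x / \<rho>)" for x :: 'a
    have cf: "continuous_on UNIV f" unfolding f_def using \<rho> by (intro continuous_intros) auto
    have f1: "0 \<le> f x" "f x \<le> 1" for x using \<rho> by (auto simp: f_def)
    have [measurable]: "f \<in> borel_measurable borel" using cf by (rule borel_measurable_continuous_onI)
    have le: "(\<integral>x. f x \<partial>hardy_measure p \<theta> (u k)) \<le> \<rho> powr (p * (1 - \<theta>)) * H" for k
    proof -
      have "(\<integral>\<^sup>+x. ennreal (f x) \<partial>hardy_measure p \<theta> (u k)) = (\<integral>\<^sup>+x. ennreal (f x) * ennreal (\<bar>u k x\<bar> powr p / norm x powr (p * \<theta>)) \<partial>lborel)"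
        by (rule nn_integral_hardy_measure) auto
      also have "\<dots> \<le> (\<integral>\<^sup>+x. ennreal (\<rho> powr (p * (1 - \<theta>))) * ennreal (\<bar>u k x\<bar> powr p / norm x powr p) \<partial>lborel)"
      proof (rule nn_integral_mono)
        fix x
        show "ennreal (f x) * ennreal (\<bar>u k x\<bar> powr p / norm x powr (p * \<theta>)) \<le> ennreal (\<rho> powr (p * (1 - \<theta>))) * ennreal (\<bar>u k x\<bar> powr p / norm x powr p)"
        proof (cases "x \<noteq> 0 \<and> norm x < \<rho>")
          case True
          have "norm x powr (p * (1 - \<theta>)) * norm x powr (p * \<theta>) = norm x powr p"
            by (simp add: powr_add[symmetric] algebra_simps)
          then have "\<bar>u k x\<bar> powr p / norm x powr (p * \<theta>) = norm x powr (p * (1 - \<theta>)) * (\<bar>u k x\<bar> powr p / norm x powr p)"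
            using True by (simp add: field_simps)
          also have "\<dots> \<le> \<rho> powr (p * (1 - \<theta>)) * (\<bar>u k x\<bar> powr p / norm x powr p)"
            using True p t by (intro mult_right_mono powr_mono2) auto
          finally have "f x * (\<bar>u k x\<bar> powr p / norm x powr (p * \<theta>)) \<le> 1 * (\<rho> powr (p * (1 - \<theta>)) * (\<bar>u k x\<bar> powr p / norm x powr p))"
            using f1[of x] by (intro mult_mono) auto
          then show ?thesis using f1[of x] by (simp add: ennreal_mult[symmetric] ennreal_leI)
        next
          case False
          \<comment> \<open>At the origin both densities are 0, since division by 0 yields
            0.\<close>
          then have "x = 0 \<or> f x = 0" using \<rho> by (auto simp: f_def field_simps)
          then show ?thesis by auto
        qed
      qed
      also have "\<dots> = ennreal (\<rho> powr (p * (1 - \<theta>))) * (\<integral>\<^sup>+x. ennreal (\<bar>u k x\<bar> powr p / norm x powr p) \<partial>lborel)"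
        by (rule nn_integral_cmult) measurable
      also have "\<dots> \<le> ennreal (\<rho> powr (p * (1 - \<theta>))) * ennreal H" by (intro mult_left_mono H) auto
      finally have "(\<integral>\<^sup>+x. ennreal (f x) \<partial>hardy_measure p \<theta> (u k)) \<le> ennreal (\<rho> powr (p * (1 - \<theta>)) * H)"
        using H by (simp add: ennreal_mult)
      moreover have "integrable (hardy_measure p \<theta> (u k)) f"
        by (rule finite_measure.integrable_const_bound[OF fin, of _ 1])
          (use f1 in \<open>auto simp: measurable_cong_sets[OF hardy_measure_simps(1) refl]\<close>)
      ultimately show ?thesis using f1 H by (subst (asm) nn_integral_eq_integral) (auto simp: ennreal_le_iff)
    qed
    have "(\<lambda>k. \<integral>x. f x \<partial>hardy_measure p \<theta> (u k)) \<longlonglongrightarrow> (\<integral>x. f x \<partial>hardy_measure p \<theta> v) + c * f 0"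
      by (rule lim[OF cf, of 1]) (use f1 in auto)
    from LIMSEQ_le_const2[OF this] le have "(\<integral>x. f x \<partial>hardy_measure p \<theta> v) + c * f 0 \<le> \<rho> powr (p * (1 - \<theta>)) * H" by blast
    moreover have "0 \<le> (\<integral>x. f x \<partial>hardy_measure p \<theta> v)" using f1 by (intro integral_nonneg_AE) auto
    moreover have "f 0 = 1" by (simp add: f_def)
    ultimately show ?thesis by simp
  qed
  have "((\<lambda>\<rho>. \<rho> powr (p * (1 - \<theta>))) \<longlongrightarrow> 0 powr (p * (1 - \<theta>))) (at_right (0::real))"
    by (rule tendsto_powr') (use p t in \<open>auto intro!: eventually_at_right_less[THEN eventually_mono]\<close>)
  then have "((\<lambda>\<rho>. \<rho> powr (p * (1 - \<theta>)) * H) \<longlongrightarrow> 0 powr (p * (1 - \<theta>)) * H) (at_right (0::real))"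
    by (rule tendsto_mult_right)
  moreover have "\<forall>\<^sub>F \<rho> in at_right (0::real). c \<le> \<rho> powr (p * (1 - \<theta>)) * H"
    using eventually_at_right_less[of "0::real"] by eventually_elim (rule bound)
  ultimately show ?thesis using tendsto_lowerbound[of "\<lambda>\<rho>. \<rho> powr (p * (1 - \<theta>)) * H" 0 "at_right (0::real)" c] by simp
qed

text \<open>Squaring the positive part removes its kink. One continuous derivative is all that the
  localized Hardy inequality asks of a cutoff.\<close>

lemma has_derivative_max_0_squared: "((\<lambda>y::real. (max 0 y)\<^sup>2) has_real_derivative 2 * max 0 y) (at y)"
proof -
  consider "y < 0" | "y = 0" | "0 < y" by linarith
  then show ?thesis
  proof cases
    case 1
    have "((\<lambda>_. 0::real) has_real_derivative 2 * max 0 y) (at y)" using 1 by simp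
    then show ?thesis
      by (rule has_field_derivative_transform_within_open[where S="{..<0}"]) (use 1 in auto)
  next
    case 2
    have "((\<lambda>h::real. max 0 h) \<longlongrightarrow> max 0 0) (at 0)" by (intro tendsto_intros)
    moreover have "\<forall>\<^sub>F h::real in at 0. max 0 h = ((max 0 h)\<^sup>2 - (max 0 0)\<^sup>2) / (h - 0)"
      by (rule eventually_mono[OF eventually_at_ball'[of 1]]) (auto simp: max_def power2_eq_square)
    ultimately have "((\<lambda>h::real. ((max 0 h)\<^sup>2 - (max 0 0)\<^sup>2) / (h - 0)) \<longlongrightarrow> 0) (at 0)"
      using Lim_transform_eventually by fastforce
    then show ?thesis using 2 by (simp add: has_field_derivative_iff)
  next
    case 3
    have "((\<lambda>y::real. y\<^sup>2) has_real_derivative 2 * max 0 y) (at y)" using 3 by (auto intro!: derivative_eq_intros)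
    then show ?thesis
      by (rule has_field_derivative_transform_within_open[where S="{0<..}"]) (use 3 in auto)
  qed
qed

text \<open>Its square is the cutoff \<eta> around the origin. It depends on |x|^2 rather than |x|
  in order to be differentiable at 0.\<close>

definition bump_profile :: "real \<Rightarrow> 'a::euclidean_space \<Rightarrow> real" where
  "bump_profile \<rho> x = max 0 (1 - (norm x)\<^sup>2 / \<rho>\<^sup>2)"

lemma bump_profile_basic:
  fixes x :: "'a::euclidean_space"
  assumes "0 < \<rho>"
  shows "continuous_on UNIV (bump_profile \<rho> :: 'a \<Rightarrow> real)" "0 \<le> bump_profile \<rho> x" "bump_profile \<rho> x \<le> 1"
    "\<rho> \<le> norm x \<Longrightarrow> bump_profile \<rho> x = 0" "bump_profile \<rho> (0::'a) = 1"
    "bump_profile \<rho> x * ((norm x)\<^sup>2 / \<rho>\<^sup>2) \<le> 1"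
proof -
  show "continuous_on UNIV (bump_profile \<rho> :: 'a \<Rightarrow> real)"
    unfolding bump_profile_def using assms by (intro continuous_intros) auto
  show b: "0 \<le> bump_profile \<rho> x" "bump_profile \<rho> x \<le> 1" by (auto simp: bump_profile_def)
  show z: "\<rho> \<le> norm x \<Longrightarrow> bump_profile \<rho> x = 0"
    using assms power_mono[of \<rho> "norm x" 2] by (auto simp: bump_profile_def)
  show "bump_profile \<rho> (0::'a) = 1" by (simp add: bump_profile_def)
  show "bump_profile \<rho> x * ((norm x)\<^sup>2 / \<rho>\<^sup>2) \<le> 1"
  proof (cases "\<rho> \<le> norm x")
    case False
    then have "(norm x)\<^sup>2 / \<rho>\<^sup>2 \<le> 1" using assms by (simp add: power_mono)
    then show ?thesis using b mult_le_one[of "bump_profile \<rho> x" "(norm x)\<^sup>2 / \<rho>\<^sup>2"] by simp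
  qed (simp add: z)
qed

lemma bump_profile_squared_has_derivative:
  fixes x :: "'a::euclidean_space"
  assumes "0 < \<rho>"
  shows "((\<lambda>x. (bump_profile \<rho> x)\<^sup>2) has_derivative (\<lambda>h. - (4 * bump_profile \<rho> x / \<rho>\<^sup>2) * (x \<bullet> h))) (at x)"
proof -
  have "((\<lambda>x. 1 - (x \<bullet> x) * inverse (\<rho>\<^sup>2)) has_derivative (\<lambda>h. - (2 * (x \<bullet> h) * inverse (\<rho>\<^sup>2)))) (at x)"
    by (auto intro!: derivative_eq_intros simp: inner_commute)
  from has_derivative_compose[OF this has_field_derivative_imp_has_derivative[OF has_derivative_max_0_squared]]
  show ?thesis by (simp add: bump_profile_def power2_norm_eq_inner divide_inverse mult.assoc mult.left_commute mult.commute)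
qed

lemma hardy_atom_critical:
  fixes u :: "nat \<Rightarrow> 'a::euclidean_space \<Rightarrow> real" and p s :: real
  assumes p: "1 < p" "p < DIM('a)" and s: "0 < s" and \<Omega>: "bounded \<Omega>"
    and u: "\<And>k. u k \<in> X_space p s \<Omega>"
    and \<omega>: "finite_radon \<omega>" "weak_star_converges (\<lambda>k. energy_measure p s (u k)) \<omega>"
    and fin: "\<And>k. finite_measure (hardy_measure p 1 (u k))" "finite_measure (hardy_measure p 1 v)"
    and lim: "\<And>f B. continuous_on UNIV f \<Longrightarrow> (\<And>x. \<bar>f x :: real\<bar> \<le> B) \<Longrightarrow>
      (\<lambda>k. \<integral>x. f x \<partial>hardy_measure p 1 (u k)) \<longlonglongrightarrow> (\<integral>x. f x \<partial>hardy_measure p 1 v) + c * f 0"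
  shows "C_H TYPE('a) p * c \<le> measure \<omega> {0}"
proof -
  note [measurable] = X_spaceD(1,3)[OF u]
  have fin\<omega>: "finite_measure \<omega>" and sets\<omega>[measurable_cong]: "sets \<omega> = sets borel"
    using \<omega>(1) by (auto simp: finite_radon_def)
  define C where "C = C_H TYPE('a) p"
  define d where "d = ((DIM('a) - p) / p) powr (p - 1)"
  have C: "0 < C" using p by (simp add: C_def C_H_def)
  have d: "0 \<le> d" by (simp add: d_def)
  define \<eta> where "\<eta> \<rho> x = (bump_profile \<rho> x)\<^sup>2" for \<rho> and x :: 'a
  \<comment> \<open>This is exactly |x . grad \<eta>| for the squared profile; the factor 4 is 2
    from the square times 2 from |x|^2.\<close>
  define \<xi> where "\<xi> \<rho> x = 4 * (bump_profile \<rho> x * ((norm x)\<^sup>2 / \<rho>\<^sup>2))" for \<rho> and x :: 'a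
  have c\<eta>: "continuous_on UNIV (\<eta> \<rho>)" if "0 < \<rho>" for \<rho>
    unfolding \<eta>_def using bump_profile_basic(1)[OF that] by (intro continuous_intros)
  have c\<xi>: "continuous_on UNIV (\<xi> \<rho>)" if "0 < \<rho>" for \<rho>
    unfolding \<xi>_def using bump_profile_basic(1)[OF that] that by (intro continuous_intros) auto
  have \<eta>1: "0 \<le> \<eta> \<rho> x" "\<eta> \<rho> x \<le> 1" if "0 < \<rho>" for \<rho> x
    using bump_profile_basic(2,3)[OF that, of x] by (auto simp: \<eta>_def power_le_one)
  have \<xi>4: "0 \<le> \<xi> \<rho> x" "\<xi> \<rho> x \<le> 4" if "0 < \<rho>" for \<rho> x
    using bump_profile_basic(2,6)[OF that, of x] by (auto simp: \<xi>_def)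
  have main: "C * c \<le> (\<integral>x. \<eta> \<rho> x \<partial>\<omega>) + d * (\<integral>x. \<xi> \<rho> x \<partial>hardy_measure p 1 v)" if \<rho>: "0 < \<rho>" for \<rho>
  proof -
    note b = bump_profile_basic[where 'a='a, OF \<rho>]
    have [measurable]: "\<eta> \<rho> \<in> borel_measurable borel" "\<xi> \<rho> \<in> borel_measurable borel"
      using c\<eta>[OF \<rho>] c\<xi>[OF \<rho>] borel_measurable_continuous_onI by blast+
    have i: "integrable \<nu> f" "(\<integral>\<^sup>+x. ennreal (f x) \<partial>\<nu>) = ennreal (\<integral>x. f x \<partial>\<nu>)" "0 \<le> (\<integral>x. f x \<partial>\<nu>)"
      if \<nu>: "finite_measure \<nu>" "sets \<nu> = sets borel" and f: "f \<in> borel_measurable borel" "\<And>x. 0 \<le> f x" "\<And>x. f x \<le> 4"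
      for \<nu> :: "'a measure" and f :: "'a \<Rightarrow> real"
    proof -
      note [measurable_cong] = \<nu>(2)
      show i: "integrable \<nu> f"
        by (rule finite_measure.integrable_const_bound[OF \<nu>(1), of _ 4]) (use f in auto)
      show "(\<integral>\<^sup>+x. ennreal (f x) \<partial>\<nu>) = ennreal (\<integral>x. f x \<partial>\<nu>)"
        by (rule nn_integral_eq_integral[OF i]) (use f in auto)
      show "0 \<le> (\<integral>x. f x \<partial>\<nu>)" using f by (intro integral_nonneg_AE) auto
    qed
    \<comment> \<open>The Hardy lemma takes one common bound for \<eta> and \<xi>, hence 4 for
      both.\<close>
    have \<eta>4: "\<eta> \<rho> x \<le> 4" for x using \<eta>1[OF \<rho>, of x] by linarith
    note i\<eta> = i[OF _ _ _ \<eta>1(1)[OF \<rho>] \<eta>4] and i\<xi> = i[OF _ _ _ \<xi>4[OF \<rho>]]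
    have le: "C * (\<integral>x. \<eta> \<rho> x \<partial>hardy_measure p 1 (u k)) \<le> (\<integral>x. \<eta> \<rho> x \<partial>energy_measure p s (u k)) + d * (\<integral>x. \<xi> \<rho> x \<partial>hardy_measure p 1 (u k))" for k
    proof -
      have "ennreal C * (\<integral>\<^sup>+x. ennreal (\<eta> \<rho> x) * ennreal (\<bar>u k x\<bar> powr p / norm x powr p) \<partial>lborel) \<le>
        (\<integral>\<^sup>+x. ennreal (\<eta> \<rho> x) * ennreal (norm (weak_grad (u k) x) powr p) \<partial>lborel) +
        ennreal d * (\<integral>\<^sup>+x. ennreal (\<xi> \<rho> x) * ennreal (\<bar>u k x\<bar> powr p / norm x powr p) \<partial>lborel)"
        unfolding C_def d_def
      proof (rule X_hardy[OF p s \<Omega> u, where B=4])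
        show "(\<eta> \<rho> has_derivative (\<lambda>h. - (4 * bump_profile \<rho> x / \<rho>\<^sup>2) * (x \<bullet> h))) (at x)" for x
          unfolding \<eta>_def by (rule bump_profile_squared_has_derivative[OF \<rho>])
        show "continuous_on UNIV (\<lambda>x. - (4 * bump_profile \<rho> x / \<rho>\<^sup>2) * (x \<bullet> i))" for i :: 'a
          using \<rho> by (intro continuous_intros b(1)) auto
        show "\<bar>- (4 * bump_profile \<rho> x / \<rho>\<^sup>2) * (x \<bullet> x)\<bar> \<le> \<xi> \<rho> x" for x
          using b(2)[of x] by (simp add: \<xi>_def power2_norm_eq_inner abs_mult)
      qed (use \<eta>1[OF \<rho>] \<eta>4 \<xi>4[OF \<rho>] c\<xi>[OF \<rho>] in auto)
      \<comment> \<open>The nonlocal part of the energy measure is added here; being nonnegative, it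
        can only enlarge the right side.\<close>
      also have "\<dots> \<le> (\<integral>\<^sup>+x. ennreal (\<eta> \<rho> x) \<partial>energy_measure p s (u k)) + ennreal d * (\<integral>\<^sup>+x. ennreal (\<xi> \<rho> x) \<partial>hardy_measure p 1 (u k))"
        by (intro add_mono) (auto simp: nn_integral_energy_measure nn_integral_hardy_measure)
      also have "(\<integral>\<^sup>+x. ennreal (\<eta> \<rho> x) * ennreal (\<bar>u k x\<bar> powr p / norm x powr p) \<partial>lborel) = (\<integral>\<^sup>+x. ennreal (\<eta> \<rho> x) \<partial>hardy_measure p 1 (u k))"
        by (simp add: nn_integral_hardy_measure)
      finally have le: "ennreal C * (\<integral>\<^sup>+x. ennreal (\<eta> \<rho> x) \<partial>hardy_measure p 1 (u k)) \<le>
        (\<integral>\<^sup>+x. ennreal (\<eta> \<rho> x) \<partial>energy_measure p s (u k)) + ennreal d * (\<integral>\<^sup>+x. ennreal (\<xi> \<rho> x) \<partial>hardy_measure p 1 (u k))" .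
      have mb: "\<eta> \<rho> \<in> borel_measurable borel" "\<xi> \<rho> \<in> borel_measurable borel" by measurable
      note a1 = i\<eta>(2,3)[OF fin(1)[of k] hardy_measure_simps(1) mb(1)]
      note a2 = i\<eta>(2,3)[OF finite_measure_energy_measure[OF u[of k]] energy_measure_simps(1) mb(1)]
      note a3 = i\<xi>(2,3)[OF fin(1)[of k] hardy_measure_simps(1) mb(2)]
      have "ennreal (C * (\<integral>x. \<eta> \<rho> x \<partial>hardy_measure p 1 (u k))) \<le>
        ennreal ((\<integral>x. \<eta> \<rho> x \<partial>energy_measure p s (u k)) + d * (\<integral>x. \<xi> \<rho> x \<partial>hardy_measure p 1 (u k)))"
        unfolding ennreal_plus[OF a2(2) mult_nonneg_nonneg[OF d a3(2)]] ennreal_mult[OF d a3(2)] ennreal_mult[OF less_imp_le[OF C] a1(2)]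
        using le unfolding a1(1) a2(1) a3(1) .
      then show ?thesis
        by (subst (asm) ennreal_le_iff) (intro add_nonneg_nonneg mult_nonneg_nonneg d a2(2) a3(2))
    qed
    have z\<eta>: "(\<eta> \<rho> \<longlongrightarrow> 0) at_infinity"
      by (rule tendsto_0_at_infinity_bounded_support[of \<rho>]) (simp add: \<eta>_def b(4))
    have l1: "(\<lambda>k. \<integral>x. \<eta> \<rho> x \<partial>energy_measure p s (u k)) \<longlonglongrightarrow> (\<integral>x. \<eta> \<rho> x \<partial>\<omega>)"
      using \<omega>(2) c\<eta>[OF \<rho>] z\<eta> by (simp add: weak_star_converges_def)
    have l2: "(\<lambda>k. \<integral>x. \<eta> \<rho> x \<partial>hardy_measure p 1 (u k)) \<longlonglongrightarrow> (\<integral>x. \<eta> \<rho> x \<partial>hardy_measure p 1 v) + c * \<eta> \<rho> 0"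
      by (rule lim[OF c\<eta>[OF \<rho>], of 1]) (use \<eta>1[OF \<rho>] in auto)
    have l3: "(\<lambda>k. \<integral>x. \<xi> \<rho> x \<partial>hardy_measure p 1 (u k)) \<longlonglongrightarrow> (\<integral>x. \<xi> \<rho> x \<partial>hardy_measure p 1 v) + c * \<xi> \<rho> 0"
      by (rule lim[OF c\<xi>[OF \<rho>], of 4]) (use \<xi>4[OF \<rho>] in auto)
    have "C * ((\<integral>x. \<eta> \<rho> x \<partial>hardy_measure p 1 v) + c * \<eta> \<rho> 0) \<le> (\<integral>x. \<eta> \<rho> x \<partial>\<omega>) + d * ((\<integral>x. \<xi> \<rho> x \<partial>hardy_measure p 1 v) + c * \<xi> \<rho> 0)"
      by (rule LIMSEQ_le[OF tendsto_mult_left[OF l2] tendsto_add[OF l1 tendsto_mult_left[OF l3]]]) (use le in auto)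
    \<comment> \<open>The atom c enters the left side with full weight and disappears from the error
      term.\<close>
    moreover have "\<eta> \<rho> 0 = 1" "\<xi> \<rho> 0 = 0" using b(5) by (auto simp: \<eta>_def \<xi>_def)
    moreover have "0 \<le> C * (\<integral>x. \<eta> \<rho> x \<partial>hardy_measure p 1 v)"
      using C i\<eta>(3)[OF fin(2) hardy_measure_simps(1)] by simp
    ultimately show ?thesis by (simp add: distrib_left)
  qed
  define \<rho> where "\<rho> n = 1 / real (Suc n)" for n
  have \<rho>: "0 < \<rho> n" for n by (simp add: \<rho>_def)
  have \<rho>x: "\<forall>\<^sub>F n in sequentially. bump_profile (\<rho> n) x = 0" if "x \<noteq> 0" for x :: 'a
  proof -
    have "\<rho> \<longlonglongrightarrow> 0" unfolding \<rho>_def using LIMSEQ_inverse_real_of_nat by (simp add: inverse_eq_divide)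
    then have "\<forall>\<^sub>F n in sequentially. \<rho> n < norm x" using that by (intro order_tendstoD(2)[of _ 0]) auto
    then show ?thesis by eventually_elim (rule bump_profile_basic(4)[OF \<rho> less_imp_le])
  qed
  have mb[measurable]: "\<eta> (\<rho> n) \<in> borel_measurable borel" "\<xi> (\<rho> n) \<in> borel_measurable borel" for n
    using c\<eta>[OF \<rho>] c\<xi>[OF \<rho>] borel_measurable_continuous_onI by blast+
  have L1: "(\<lambda>n. \<integral>x. \<eta> (\<rho> n) x \<partial>\<omega>) \<longlonglongrightarrow> (\<integral>x. indicator {0} x \<partial>\<omega>)"
  proof (rule integral_dominated_convergence[where w="\<lambda>_. 1"])
    show "AE x in \<omega>. (\<lambda>n. \<eta> (\<rho> n) x) \<longlonglongrightarrow> indicator {0} x"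
    proof (rule AE_I2)
      fix x :: 'a
      show "(\<lambda>n. \<eta> (\<rho> n) x) \<longlonglongrightarrow> indicator {0} x"
      proof (cases "x = 0")
        case True
        then show ?thesis using bump_profile_basic(5)[where 'a='a, OF \<rho>] by (simp add: \<eta>_def)
      next
        case False
        have "\<forall>\<^sub>F n in sequentially. \<eta> (\<rho> n) x = 0" using \<rho>x[OF False] by eventually_elim (simp add: \<eta>_def)
        then show ?thesis using False by (simp add: tendsto_eventually)
      qed
    qed
    show "integrable \<omega> (\<lambda>_. 1 :: real)" by (rule finite_measure.integrable_const[OF fin\<omega>])
    show "AE x in \<omega>. norm (\<eta> (\<rho> n) x) \<le> 1" for n using \<eta>1[OF \<rho>[of n]] by (intro AE_I2) auto
  qed measurable
  have L2: "(\<lambda>n. \<integral>x. \<xi> (\<rho> n) x \<partial>hardy_measure p 1 v) \<longlonglongrightarrow> (\<integral>x. 0 \<partial>hardy_measure p 1 v)"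
  proof (rule integral_dominated_convergence[where w="\<lambda>_. 4"])
    show "AE x in hardy_measure p 1 v. (\<lambda>n. \<xi> (\<rho> n) x) \<longlonglongrightarrow> 0"
    proof (rule AE_I2)
      fix x :: 'a
      show "(\<lambda>n. \<xi> (\<rho> n) x) \<longlonglongrightarrow> 0"
      proof (cases "x = 0")
        case True
        then show ?thesis by (simp add: \<xi>_def)
      next
        case False
        have "\<forall>\<^sub>F n in sequentially. \<xi> (\<rho> n) x = 0" using \<rho>x[OF False] by eventually_elim (simp add: \<xi>_def)
        then show ?thesis by (simp add: tendsto_eventually)
      qed
    qed
    show "integrable (hardy_measure p 1 v) (\<lambda>_. 4 :: real)" by (rule finite_measure.integrable_const[OF fin(2)])
    show "AE x in hardy_measure p 1 v. norm (\<xi> (\<rho> n) x) \<le> 4" for n using \<xi>4[OF \<rho>[of n]] by (intro AE_I2) auto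
  qed (use mb in \<open>auto simp: measurable_cong_sets[OF hardy_measure_simps(1) refl]\<close>)
  have "(\<lambda>n. (\<integral>x. \<eta> (\<rho> n) x \<partial>\<omega>) + d * (\<integral>x. \<xi> (\<rho> n) x \<partial>hardy_measure p 1 v)) \<longlonglongrightarrow> (\<integral>x. indicator {0} x \<partial>\<omega>) + d * (\<integral>x. 0 \<partial>hardy_measure p 1 v)"
    by (intro tendsto_add tendsto_mult_left L1 L2)
  from LIMSEQ_le_const[OF this, of "C * c"] main[OF \<rho>] have "C * c \<le> (\<integral>x. indicator {0} x \<partial>\<omega>)" by auto
  then show ?thesis using sets\<omega> by (simp add: C_def)
qed

text \<open>Weak convergence still allows the energy densities to oscillate in k, so the limit
  measures belong to a subsequence r. Equality and inequality of measures are expressed by their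
  values on all Borel sets.\<close>

theorem theorem1p1:
  fixes \<Omega> :: "(real ^ 'n) set"
    and p s \<theta> :: real
    and u :: "nat \<Rightarrow> real ^ 'n \<Rightarrow> real"
    and v :: "real ^ 'n \<Rightarrow> real"
  assumes "3 \<le> CARD('n)"
    and "0 < s" and "s < 1" and "1 < p" and "p < real CARD('n)"
    and "s \<le> \<theta>" and "\<theta> \<le> 1"
    and "open \<Omega>" and "bounded \<Omega>" and "0 \<in> \<Omega>"
    and "\<And>k. u k \<in> X_space p s \<Omega>" and "v \<in> X_space p s \<Omega>"
    and "X_weakly_converges p s \<Omega> u v"
  shows "\<exists>(r :: nat \<Rightarrow> nat) \<omega> \<sigma>. strict_mono r \<and> finite_radon \<omega> \<and> finite_radon \<sigma> \<and>
    weak_star_converges (\<lambda>k. energy_measure p s (u (r k))) \<omega> \<and>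
    weak_star_converges (\<lambda>k. hardy_measure p \<theta> (u (r k))) \<sigma> \<and>
    (\<exists>\<omega>0 \<sigma>0. 0 \<le> \<omega>0 \<and> 0 \<le> \<sigma>0 \<and>
      (\<forall>A\<in>sets borel. emeasure \<sigma> A =
         emeasure (hardy_measure p \<theta> v) A + ennreal \<sigma>0 * emeasure dirac0 A) \<and>
      (\<forall>A\<in>sets borel. emeasure \<omega> A \<ge>
         emeasure (energy_measure p s v) A + ennreal \<omega>0 * emeasure dirac0 A) \<and>
      0 \<le> mu_bar TYPE(real ^ 'n) p s \<theta> * \<sigma>0 \<and> mu_bar TYPE(real ^ 'n) p s \<theta> * \<sigma>0 \<le> \<omega>0)"
proof -
  note s = \<open>0 < s\<close> and p = \<open>1 < p\<close> and \<Omega> = \<open>bounded \<Omega>\<close> and u = assms(11) and v = assms(12) and weak = assms(13)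
  have pN: "p < real DIM(real ^ 'n)" using \<open>p < real CARD('n)\<close> by simp
  have t: "0 \<le> \<theta>" "\<theta> \<le> 1" using assms by auto
  obtain C where C: "0 \<le> C" "\<And>k. (\<integral>\<^sup>+x. ennreal (norm (weak_grad (u k) x) powr p) \<partial>lborel) \<le> ennreal C"
    "\<And>k. gagliardo p s (u k) \<le> ennreal C"
    by (rule X_weakly_converges_bounded[OF p u weak]) blast
  obtain H where H: "0 \<le> H" "\<And>k. (\<integral>\<^sup>+x. ennreal (\<bar>u k x\<bar> powr p / norm x powr p) \<partial>lborel) \<le> ennreal H"
    "\<And>k. emeasure (hardy_measure p \<theta> (u k)) UNIV \<le> ennreal H"
    by (rule hardy_bounds[where u=u, OF p pN s \<Omega> u C t]) blast
  have finu: "finite_measure (hardy_measure p \<theta> (u k))" for k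
    by (rule finite_measureI) (use H(3)[of k] in \<open>auto simp: top_unique\<close>)
  \<comment> \<open>The uniform bound for sequences is applied to the constant sequence v.\<close>
  have finv: "finite_measure (hardy_measure p \<theta> v)"
  proof -
    obtain Cv where Cv: "0 \<le> Cv" "(\<integral>\<^sup>+x. ennreal (norm (weak_grad v x) powr p) \<partial>lborel) \<le> ennreal Cv" "gagliardo p s v \<le> ennreal Cv"
    proof
      show "0 \<le> enn2real (X_energy p s v)" by simp
      show "(\<integral>\<^sup>+x. ennreal (norm (weak_grad v x) powr p) \<partial>lborel) \<le> ennreal (enn2real (X_energy p s v))"
        "gagliardo p s v \<le> ennreal (enn2real (X_energy p s v))"
        using X_spaceD(6)[OF v] by (auto simp: less_top X_energy_def)
    qed
    obtain H' where "emeasure (hardy_measure p \<theta> v) UNIV \<le> ennreal H'"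
      by (rule hardy_bounds[where u="\<lambda>_. v", OF p pN s \<Omega> v Cv t]) blast
    then show ?thesis by (intro finite_measureI) (auto simp: top_unique)
  qed
  have Eb: "emeasure (energy_measure p s (u k)) UNIV \<le> ennreal (C + C)" for k
    unfolding emeasure_energy_measure_UNIV[OF u] X_energy_def ennreal_plus[OF C(1) C(1)]
    by (rule add_mono[OF C(2,3)])
  obtain r1 \<omega> where r1: "strict_mono (r1 :: nat \<Rightarrow> nat)" and \<omega>: "finite_radon \<omega>"
    and w1: "weak_star_converges (\<lambda>k. energy_measure p s (u (r1 k))) \<omega>"
    using weak_star_compactness[of "\<lambda>k. energy_measure p s (u k)", OF _ Eb] by auto
  \<comment> \<open>A second extraction concerns only the real sequence of total Hardy masses; once
    it converges, the limit measure \<sigma> can be written down explicitly.\<close>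
  have "bounded (range (\<lambda>k. measure (hardy_measure p \<theta> (u (r1 k))) UNIV))"
    using H(3) H(1) by (auto simp: bounded_iff finite_measure.emeasure_eq_measure[OF finu] intro!: exI[of _ H])
  then obtain r2 :: "nat \<Rightarrow> nat" and m where r2: "strict_mono r2"
    and m: "((\<lambda>k. measure (hardy_measure p \<theta> (u (r1 k))) UNIV) \<circ> r2) \<longlonglongrightarrow> m"
    using bounded_imp_convergent_subsequence by blast
  define r where "r = r1 \<circ> r2"
  have r: "strict_mono r" unfolding r_def by (rule strict_mono_o[OF r1 r2])
  define w where "w k = u (r k)" for k
  have w: "w k \<in> X_space p s \<Omega>" for k unfolding w_def by (rule u)
  have weakw: "X_weakly_converges p s \<Omega> w v"
    unfolding X_weakly_converges_def
  proof
    fix F assume "F \<in> X_dual p s \<Omega>"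
    from LIMSEQ_subseq_LIMSEQ[OF X_weakly_converges_functional[OF weak this] r]
    show "(\<lambda>k. F (w k)) \<longlonglongrightarrow> F v" by (simp add: comp_def w_def)
  qed
  have w\<omega>: "weak_star_converges (\<lambda>k. energy_measure p s (w k)) \<omega>"
    unfolding weak_star_converges_def
  proof (intro allI impI)
    fix f :: "real ^ 'n \<Rightarrow> real"
    assume "continuous_on UNIV f \<and> (f \<longlongrightarrow> 0) at_infinity"
    with w1 have "(\<lambda>k. \<integral>x. f x \<partial>energy_measure p s (u (r1 k))) \<longlonglongrightarrow> (\<integral>x. f x \<partial>\<omega>)"
      by (simp add: weak_star_converges_def)
    from LIMSEQ_subseq_LIMSEQ[OF this r2]
    show "(\<lambda>k. \<integral>x. f x \<partial>energy_measure p s (w k)) \<longlonglongrightarrow> (\<integral>x. f x \<partial>\<omega>)" by (simp add: comp_def w_def r_def)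
  qed
  have mass: "(\<lambda>k. measure (hardy_measure p \<theta> (w k)) UNIV) \<longlonglongrightarrow> m"
    using m by (simp add: comp_def w_def r_def)
  have finw: "finite_measure (hardy_measure p \<theta> (w k))" for k unfolding w_def by (rule finu)
  have lim: "(\<lambda>k. \<integral>\<^sup>+x. ennreal (norm (w k x - v x) powr p) \<partial>lborel) \<longlonglongrightarrow> 0"
    by (rule X_compact_embedding[OF p s \<Omega> \<open>open \<Omega>\<close> w v weakw C(1)]) (simp add: w_def C(3))
  have vp: "(\<integral>\<^sup>+x. ennreal (norm (v x) powr p) \<partial>lborel) < \<infinity>"
  proof -
    obtain K where "0 < K" "\<And>u. u \<in> borel_measurable borel \<Longrightarrow> (AE x in lborel. x \<notin> \<Omega> \<longrightarrow> u x = 0) \<Longrightarrow>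
      (\<integral>\<^sup>+x. ennreal (\<bar>u x\<bar> powr p) \<partial>lborel) \<le> ennreal K * gagliardo p s u"
      by (rule gagliardo_Poincare[OF _ s \<Omega>, of p]) (use p in auto)
    note this(2)[OF X_spaceD(1,5)[OF v]]
    also have "ennreal K * gagliardo p s v < \<infinity>"
      using X_spaceD(8)[OF v] by (simp add: ennreal_mult_less_top)
    finally show ?thesis by simp
  qed
  \<comment> \<open>The mass lost by the Hardy measures in the limit.\<close>
  define \<sigma>0 where "\<sigma>0 = m - measure (hardy_measure p \<theta> v) UNIV"
  note hl = hardy_measure_weak_limit[OF p t(1) X_spaceD(1)[OF w] X_spaceD(1)[OF v] lim vp finw finv mass, folded \<sigma>0_def]
  have \<sigma>0: "0 \<le> \<sigma>0" using hl(1) by (simp add: \<sigma>0_def)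
  obtain \<sigma> where \<sigma>: "finite_radon \<sigma>" "\<And>A. A \<in> sets borel \<Longrightarrow> emeasure \<sigma> A = emeasure (hardy_measure p \<theta> v) A + ennreal \<sigma>0 * emeasure dirac0 A"
    "\<And>f B. f \<in> borel_measurable borel \<Longrightarrow> (\<And>x. \<bar>f x :: real\<bar> \<le> B) \<Longrightarrow> (\<integral>x. f x \<partial>\<sigma>) = (\<integral>x. f x \<partial>hardy_measure p \<theta> v) + \<sigma>0 * f 0"
    by (rule measure_plus_dirac[OF finv hardy_measure_simps(1) \<sigma>0]) blast
  have w\<sigma>: "weak_star_converges (\<lambda>k. hardy_measure p \<theta> (w k)) \<sigma>"
    unfolding weak_star_converges_def
  proof (intro allI impI)
    fix f :: "real ^ 'n \<Rightarrow> real"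
    assume f: "continuous_on UNIV f \<and> (f \<longlongrightarrow> 0) at_infinity"
    obtain B where B: "\<And>x. \<bar>f x\<bar> \<le> B"
      by (rule vanishing_at_infinity_bounded[of f]) (use f in blast)+
    have "f \<in> borel_measurable borel" using f by (intro borel_measurable_continuous_onI) blast
    from hl(2)[of f B, OF conjunct1[OF f] B] \<sigma>(3)[of f B, OF this B]
    show "(\<lambda>k. \<integral>x. f x \<partial>hardy_measure p \<theta> (w k)) \<longlonglongrightarrow> (\<integral>x. f x \<partial>\<sigma>)" by simp
  qed
  define \<omega>0 where "\<omega>0 = measure \<omega> {0}"
  have bound: "0 \<le> mu_bar TYPE(real ^ 'n) p s \<theta> * \<sigma>0 \<and> mu_bar TYPE(real ^ 'n) p s \<theta> * \<sigma>0 \<le> \<omega>0"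
  proof (cases "\<theta> = 1")
    case True
    \<comment> \<open>Since s < 1 = \<theta>, the first branch of \<open>mu_bar\<close> is excluded
      and the second one applies.\<close>
    have "mu_bar TYPE(real ^ 'n) p s \<theta> = C_H TYPE(real ^ 'n) p" using True \<open>s < 1\<close> by (simp add: mu_bar_def)
    moreover have "C_H TYPE(real ^ 'n) p * \<sigma>0 \<le> \<omega>0"
      unfolding \<omega>0_def
      by (rule hardy_atom_critical[OF p pN s \<Omega> w \<omega> w\<omega> finw[unfolded True] finv[unfolded True] hl(2)[unfolded True]])
    ultimately show ?thesis using \<sigma>0 by (simp add: C_H_def)
  next
    case False
    then have "\<theta> < 1" using t by simp
    then have "\<sigma>0 \<le> 0"
      by (rule hardy_atom_subcritical[OF p t(1) _ X_spaceD(1)[OF w] X_spaceD(1)[OF v] H(1) _ finw hl(2)])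
        (simp_all add: w_def H(2))
    \<comment> \<open>With \<sigma>0 = 0 both inequalities reduce to 0 <= \<omega>0.\<close>
    then show ?thesis using \<sigma>0 by (simp add: \<omega>0_def)
  qed
  have "\<forall>A\<in>sets borel. emeasure \<omega> A \<ge> emeasure (energy_measure p s v) A + ennreal \<omega>0 * emeasure dirac0 A"
    unfolding \<omega>0_def
    using energy_measure_plus_atom_le[OF v \<omega> energy_measure_le[OF p w v weakw \<omega> w\<omega>]] by blast
  moreover have "0 \<le> \<omega>0" by (simp add: \<omega>0_def)
  ultimately show ?thesis
    using r \<omega> \<sigma>(1,2) w\<omega> w\<sigma> \<sigma>0 bound unfolding w_def by blast
qed

end
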